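(* Let $q$ be an odd prime. Then $$ \mathfrak{G}_q^+ = \frac{q-1}{2}\,\gamma + \frac{q-3}{2}\log(2\pi) - \frac{1}{2}\sum_{\substack{\chi\neq\chi_0\\ \chi\ \mathrm{even}}} \frac{\sum_{a=1}^{q-1}\overline{\chi}(a)\, S(a/q)}{\sum_{a=1}^{q-1}\overline{\chi}(a)\log\bigl(\Gamma(a/q)\bigr)}, $$ where the outer sum runs over the non-trivial even Dirichlet characters $\chi$ modulo $q$.
   Context: Here $\gamma$ is the Euler-Mascheroni constant, $\Gamma$ is Euler's Gamma function, $\chi_0$ is the trivial (principal) Dirichlet character modulo $q$, and $L(s,\chi)$ is the Dirichlet $L$-function of $\chi$. A Dirichlet character $\chi$ is even if $\chi(-1)=1$ and odd if $\chi(-1)=-1$. The Euler-Kronecker constant $\mathfrak{G}_q^+$ of the maximal real subfield $\mathbb{Q}(\zeta_q+\zeta_q^{-1})$ of the prime cyclotomic field $\mathbb{Q}(\zeta_q)$ ($\zeta_q$ a primitive $q$-th root of unity) is defined by $$ \mathfrak{G}_q^+ := \gamma + \sum_{\substack{\chi\neq\chi_0\\ \chi\ \mathrm{even}}} \frac{L'}{L}(1,\chi), $$ the sum being over the non-trivial even Dirichlet characters modulo $q$ (an empty sum is $0$). For real $x>0$ the function $S$ is defined by $$ S(x) := 2\gamma_1 x + (\log x)^2 + \sum_{m=1}^{+\infty}\Bigl( \bigl(\log(x+m)\bigr)^2 - (\log m)^2 - 2x\,\frac{\log m}{m}\Bigr), $$ where $$ \gamma_1 := \lim_{N\to+\infty}\Bigl(\sum_{j=1}^{N}\frac{\log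 j}{j} - \frac{(\log N)^2}{2}\Bigr). $$ *)

theory Defs
  imports "HOL-Complex_Analysis.Complex_Analysis" "HOL-Computational_Algebra.Primes"
begin

definition dirichlet_character :: "nat \<Rightarrow> (int \<Rightarrow> complex) \<Rightarrow> bool" where
  "dirichlet_character q \<psi> \<longleftrightarrow>
     (\<forall>m n. \<psi> (m * n) = \<psi> m * \<psi> n) \<and>
     (\<forall>n. \<psi> (n + int q) = \<psi> n) \<and>
     (\<forall>n. \<psi> n \<noteq> 0 \<longleftrightarrow> coprime n (int q))"

definition principal_character :: "nat \<Rightarrow> int \<Rightarrow> complex" where
  "principal_character q n = (if coprime n (int q) then 1 else 0)"

definition even_nontrivial_characters :: "nat \<Rightarrow> (int \<Rightarrow> complex) set" where
  "even_nontrivial_characters q =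
     {\<psi>. dirichlet_character q \<psi> \<and> \<psi> \<noteq> principal_character q \<and> \<psi> (-1) = 1}"

definition dirichlet_series :: "(int \<Rightarrow> complex) \<Rightarrow> complex \<Rightarrow> complex" where
  "dirichlet_series \<psi> s = (\<Sum>n. \<psi> (int (Suc n)) / of_nat (Suc n) powr s)"

(* The Dirichlet series on Re s > 1, continued analytically to the left through the half-planes
   Re z > c (minus the possible pole at 1 if the character is principal). The continuation to such
   a domain is unique by the identity theorem, so different c give the same value at s.
   For the principal character the value at s = 1 is unspecified. *)
definition dirichlet_L :: "nat \<Rightarrow> (int \<Rightarrow> complex) \<Rightarrow> complex \<Rightarrow> complex" where
  "dirichlet_L q \<psi> s =
     (THE l. \<exists>c f. c < 1 \<and> c < Re s \<and>
        f holomorphic_on ({z. c < Re z} - (if \<psi> = principal_character q then {1} else {})) \<and>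
        (\<forall>z. 1 < Re z \<longrightarrow> f z = dirichlet_series \<psi> z) \<and> l = f s)"

definition euler_kronecker_plus :: "nat \<Rightarrow> complex" where
  "euler_kronecker_plus q =
     euler_mascheroni +
     (\<Sum>\<psi>\<in>even_nontrivial_characters q. deriv (dirichlet_L q \<psi>) 1 / dirichlet_L q \<psi> 1)"

definition gamma_1 :: real where
  "gamma_1 = lim (\<lambda>N. (\<Sum>j=1..N. ln (real j) / real j) - (ln (real N))\<^sup>2 / 2)"

definition S_fun :: "real \<Rightarrow> real" where
  "S_fun x = 2 * gamma_1 * x + (ln x)\<^sup>2 +
     (\<Sum>k. let m = real (Suc k)
           in (ln (x + m))\<^sup>2 - (ln m)\<^sup>2 - 2 * x * (ln m / m))"

end

theory Submission
  imports Defs "HOL-Number_Theory.Residue_Primitive_Roots" "HOL-Number_Theory.Prime_Powers"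
begin

text \<open>
  For each non-trivial even character \<open>\<psi>\<close> modulo \<open>q\<close> it is shown (\<open>log_deriv_L_1\<close>) that
  \<open>L'/L(1, \<psi>) = \<gamma> + log (2 \<pi>) - B / (2 A)\<close>, where \<open>A\<close> and \<open>B\<close> are the sums of
  \<open>log \<Gamma>(a/q)\<close> and of \<open>S(a/q)\<close> against the conjugate character. As there are \<open>(q - 3) / 2\<close> such
  characters (\<open>finite_card_even_nontrivial_characters\<close>), summation gives the theorem.

  The identity for one character compares the expansions of the functional equation at \<open>s = 1\<close> and at
  \<open>s = 0\<close>. Since \<open>\<psi>\<close> is even and non-trivial, both the sum of \<open>\<psi>(a)\<close> and that of \<open>a \<psi>(a)\<close> over a
  period vanish; hence the Dirichlet series, summed one period at a time, converges locally uniformly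
  for \<open>Re s > -1\<close>. This gives the analytic continuation together with all its derivatives
  (\<open>L_higher_deriv_sums\<close>, \<open>dirichlet_L_eq\<close>). At \<open>s = 0\<close> the first two derivatives are block sums of
  \<open>- log n\<close> and of \<open>(log n)\<^sup>2\<close>, which are identified with sums of \<open>log \<Gamma>(a/q)\<close> and \<open>S(a/q)\<close> by
  \<open>sum_ln_Gamma\<close> and \<open>sum_S_fun\<close>; the constant \<open>\<gamma>\<^sub>1\<close> and all the convergence terms in the definition of
  \<open>S\<close> cancel because of the two vanishing sums.

  The functional equation is proved for real \<open>0 < s < 1\<close> (\<open>functional_equation_real\<close>) and extended by
  the identity theorem (\<open>functional_equation\<close>). The Mellin transform of the sum of
  \<open>\<psi>(n) exp (- n t)\<close> is \<open>\<Gamma>(s) L(s, \<psi>)\<close>. On the other hand, a finite Fourier expansion of \<open>\<psi>\<close> and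
  the partial fractions of the cotangent turn this sum into the sum of
  \<open>t / (q\<^sup>2 t\<^sup>2 + 4 \<pi>\<^sup>2 n\<^sup>2)\<close> against the conjugate character (\<open>exp_kernel_transform\<close>), whose Mellin
  transform is a multiple of \<open>L(1 - s)\<close> of that character. Both termwise integrations are justified by
  one bound for block sums of decreasing functions (\<open>norm_sum_blocks_le\<close>).

  Finally \<open>L(1, \<psi>) \<noteq> 0\<close> is needed. For a real character this is the elementary argument with a Lambert
  series: if \<open>L(1, \<psi>) = 0\<close>, then the power series whose coefficients are the divisor sums of \<open>\<psi>\<close> stays
  bounded as \<open>t\<close> tends to \<open>1\<close>, although its coefficients are non-negative, and at least \<open>1\<close> at squares.
  For a complex character it is the classical inequality \<open>3 + 4 cos \<theta> + cos (2 \<theta>) \<ge> 0\<close>, applied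
  to the logarithmic derivatives of \<open>\<zeta>\<close>, \<open>L(s, \<psi>)\<close> and \<open>L(s, \<psi>\<^sup>2)\<close> near \<open>s = 1\<close>.
\<close>

section \<open>Even characters modulo an odd prime\<close>

text \<open>The modulus and a non-trivial even character, fixed throughout.\<close>
locale even_char =
  fixes q :: nat and \<psi> :: "int \<Rightarrow> complex"
  assumes prime_q: "prime q" and odd_q: "odd q" and char: "\<psi> \<in> even_nontrivial_characters q"
begin

lemma q_ge_3: "q \<ge> 3"
  using prime_q odd_q prime_ge_2_nat[of q] by (cases "q = 2") auto

lemma q_pos: "q > 0" using q_ge_3 by simp

lemma dchar: "dirichlet_character q \<psi>"
  using char by (simp add: even_nontrivial_characters_def)

lemma mult: "\<psi> (m * n) = \<psi> m * \<psi> n"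
  using dchar by (simp add: dirichlet_character_def)

lemma period: "\<psi> (n + int q) = \<psi> n"
  using dchar by (simp add: dirichlet_character_def)

lemma nonzero_iff: "\<psi> n \<noteq> 0 \<longleftrightarrow> coprime n (int q)"
  using dchar by (simp add: dirichlet_character_def)

lemma nonzero_iff': "\<psi> (int n) \<noteq> 0 \<longleftrightarrow> \<not> q dvd n"
proof -
  have "coprime n q \<longleftrightarrow> \<not> q dvd n"
    using prime_q by (metis coprime_commute prime_imp_coprime coprime_absorb_left not_prime_unit)
  thus ?thesis by (simp add: nonzero_iff coprime_int_iff)
qed

lemma zero_at_multiple: "\<psi> (int (q * m + q)) = 0"
  using nonzero_iff'[of "q * m + q"] by auto

lemma at_1: "\<psi> 1 = 1"
proof -
  have "\<psi> 1 * \<psi> 1 = \<psi> 1" using mult[of 1 1] by simp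
  moreover have "\<psi> 1 \<noteq> 0" by (subst nonzero_iff) auto
  ultimately show ?thesis by simp
qed

lemma even: "\<psi> (- n) = \<psi> n"
  using mult[of "-1" n] char by (simp add: even_nontrivial_characters_def)

lemma period_mult: "\<psi> (n + int q * int k) = \<psi> n"
proof (induction k)
  case (Suc k)
  have "\<psi> (n + int q * int (Suc k)) = \<psi> ((n + int q * int k) + int q)"
    by (simp add: algebra_simps)
  with Suc show ?case by (simp add: period)
qed auto

lemma cong_eq: "[m = n] (mod int q) \<Longrightarrow> \<psi> m = \<psi> n"
proof -
  have main: "\<psi> (n + int q * k) = \<psi> n" for n k :: int
  proof (cases "k \<ge> 0")
    case True
    then show ?thesis using period_mult[of n "nat k"] by simp
  next
    case False
    then show ?thesis using period_mult[of "n + int q * k" "nat (- k)"] by (simp add: algebra_simps)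
  qed
  assume "[m = n] (mod int q)"
  then obtain k where "n = m + int q * k" by (metis cong_iff_lin)
  thus ?thesis using main by simp
qed

lemma period_nat: "\<psi> (int (q * m + a)) = \<psi> (int a)"
  using period_mult[of "int a" m] by (simp add: add_ac)

lemma mod_nat: "\<psi> (int (n mod q)) = \<psi> (int n)"
  using period_nat[of "n div q" "n mod q"] by simp

lemma reflect: "a \<le> q \<Longrightarrow> \<psi> (int (q - a)) = \<psi> (int a)"
  using period[of "- int a"] by (simp add: even of_nat_diff)

lemma power: "\<psi> (n ^ k) = \<psi> n ^ k"
  by (induction k) (auto simp: at_1 mult)

lemma norm_eq_1: "coprime n (int q) \<Longrightarrow> norm (\<psi> n) = 1"
proof -
  assume *: "coprime n (int q)"
  define m where "m = nat (n mod int q)"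
  have m: "int m = n mod int q" using q_pos by (simp add: m_def)
  have psi_m: "\<psi> n = \<psi> (int m)"
    by (rule cong_eq) (simp add: m cong_def)
  have "\<psi> (int m) \<noteq> 0" using * psi_m nonzero_iff[of n] by simp
  hence "\<not> q dvd m" by (simp add: nonzero_iff')
  hence "[m ^ (q - 1) = 1] (mod q)"
    using fermat_theorem[of q m] prime_q by simp
  hence "(m ^ (q - 1)) mod q = 1 mod q" by (simp add: cong_def)
  hence "\<psi> (int m ^ (q - 1)) = \<psi> 1" using mod_nat[of "m ^ (q - 1)"] mod_nat[of 1] by simp
  hence "\<psi> (int m) ^ (q - 1) = 1" by (simp add: power at_1)
  hence "norm (\<psi> (int m)) ^ (q - 1) = 1 ^ (q - 1)" by (simp flip: norm_power)
  hence "norm (\<psi> (int m)) = 1"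
    by (rule power_eq_imp_eq_base) (use q_ge_3 in auto)
  thus ?thesis using psi_m by simp
qed

lemma norm_le_1: "norm (\<psi> n) \<le> 1"
  using norm_eq_1[of n] nonzero_iff[of n] by (cases "\<psi> n = 0") auto

text \<open>Multiplication by a unit permutes the non-zero residues.\<close>
lemma bij_mult:
  assumes "\<not> q dvd b"
  shows "bij_betw (\<lambda>a. (b * a) mod q) {1..<q} {1..<q}"
proof -
  have nd: "\<not> q dvd a" if "a \<in> {1..<q}" for a using that by (auto dest: dvd_imp_le)
  have inj: "inj_on (\<lambda>a. (b * a) mod q) {1..<q}"
  proof (rule inj_onI)
    fix x y assume xy: "x \<in> {1..<q}" "y \<in> {1..<q}" and "(b * x) mod q = (b * y) mod q"
    hence "[b * x = b * y] (mod q)" by (simp add: cong_def)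
    moreover have "coprime b q" using assms prime_q prime_imp_coprime coprime_commute by blast
    ultimately have "[x = y] (mod q)" by (simp add: cong_mult_lcancel_nat)
    thus "x = y" using xy by (auto simp: cong_def)
  qed
  moreover have "(\<lambda>a. (b * a) mod q) ` {1..<q} \<subseteq> {1..<q}"
  proof safe
    fix a assume "a \<in> {1..<q}"
    hence "\<not> q dvd b * a" using nd assms prime_q by (simp add: prime_dvd_mult_iff)
    thus "(b * a) mod q \<in> {1..<q}" using q_pos by (auto simp: dvd_eq_mod_eq_0)
  qed
  ultimately show ?thesis
    by (simp add: bij_betw_def card_subset_eq card_image)
qed

lemma sum_zero: "(\<Sum>a\<in>{1..<q}. \<psi> (int a)) = 0"
proof -
  obtain n where n: "\<psi> n \<noteq> principal_character q n"
    using char by (auto simp: even_nontrivial_characters_def)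
  have "coprime n (int q)" using n nonzero_iff[of n] by (auto simp: principal_character_def)
  with n have n1: "\<psi> n \<noteq> 1" "\<psi> n \<noteq> 0" using nonzero_iff[of n] by (auto simp: principal_character_def)
  obtain b :: nat where b: "\<psi> (int b) = \<psi> n"
  proof (cases "n \<ge> 0")
    case True thus ?thesis using that[of "nat n"] by simp
  next
    case False thus ?thesis using that[of "nat (-n)"] by (simp add: even)
  qed
  have nb: "\<not> q dvd b" using b n1 nonzero_iff' by metis
  have "(\<Sum>a\<in>{1..<q}. \<psi> (int a)) = (\<Sum>a\<in>{1..<q}. \<psi> (int ((b * a) mod q)))"
    by (rule sum.reindex_bij_betw [OF bij_mult[OF nb], symmetric])
  also have "\<dots> = \<psi> n * (\<Sum>a\<in>{1..<q}. \<psi> (int a))"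
    by (simp add: mod_nat b mult sum_distrib_left del: zmod_int)
  finally show ?thesis using n1 by simp
qed

lemma sum_reflect: "(\<Sum>a\<in>{1..<q}. \<psi> (int a) * f (q - a)) = (\<Sum>a\<in>{1..<q}. \<psi> (int a) * f a)"
  by (rule sum.reindex_bij_witness[of _ "\<lambda>a. q - a" "\<lambda>a. q - a"])
     (auto simp: reflect simp del: of_nat_diff of_nat_diff_if)

text \<open>Reflecting \<open>a\<close> to \<open>q - a\<close> changes the sign of the sum, up to a multiple of the previous one.\<close>
lemma sum_linear_zero: "(\<Sum>a\<in>{1..<q}. \<psi> (int a) * of_nat a) = 0"
proof -
  have "(\<Sum>a\<in>{1..<q}. \<psi> (int a) * of_nat a) = (\<Sum>a\<in>{1..<q}. \<psi> (int a) * (of_nat (q - a)))"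
    by (rule sum_reflect [symmetric])
  also have "\<dots> = (\<Sum>a\<in>{1..<q}. of_nat q * \<psi> (int a) - \<psi> (int a) * of_nat a)"
    by (intro sum.cong) (auto simp: of_nat_diff algebra_simps)
  also have "\<dots> = - (\<Sum>a\<in>{1..<q}. \<psi> (int a) * of_nat a)"
    using sum_zero by (simp add: sum_subtractf flip: sum_distrib_left)
  finally show ?thesis by simp
qed

end

lemma even_char_cnj: "even_char q \<psi> \<Longrightarrow> even_char q (\<lambda>n. cnj (\<psi> n))"
proof -
  assume "even_char q \<psi>"
  then interpret even_char q \<psi> .
  have "(\<lambda>n. cnj (\<psi> n)) \<noteq> principal_character q"
  proof
    assume *: "(\<lambda>n. cnj (\<psi> n)) = principal_character q"
    have "\<psi> = principal_character q"
    proof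
      fix n show "\<psi> n = principal_character q n"
        using fun_cong[OF *, of n] by (auto simp: principal_character_def split: if_splits)
    qed
    thus False using char by (auto simp: even_nontrivial_characters_def)
  qed
  thus ?thesis using char prime_q odd_q
    by (auto simp: even_char_def even_nontrivial_characters_def dirichlet_character_def)
qed

section \<open>Gauss sums\<close>

context even_char
begin

text \<open>The root of unity \<open>exp (2 \<pi> i k / q)\<close>.\<close>
definition unity :: "nat \<Rightarrow> complex" where
  "unity k = exp (2 * of_real pi * \<i> * of_nat k / of_nat q)"

lemma unity_mod: "unity (k mod q) = unity k"
proof -
  have "unity k = exp (2 * of_real pi * \<i> * of_nat (q * (k div q) + k mod q) / of_nat q)"
    by (simp only: unity_def mult_div_mod_eq)
  also have "2 * of_real pi * \<i> * of_nat (q * (k div q) + k mod q) / of_nat q =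
    2 * of_real pi * \<i> * of_nat (k mod q) / of_nat q + \<i> * of_nat (k div q) * (of_real pi * 2)"
    using q_pos by (simp only: of_nat_add of_nat_mult) (simp add: field_simps del: mult_div_mod_eq)
  also have "exp \<dots> = unity (k mod q)"
  proof -
    have "exp (\<i> * of_nat (k div q) * (of_real pi * 2)) = (1::complex)"
      using exp_integer_2pi[of "of_nat (k div q)"] by (simp add: mult_ac)
    thus ?thesis by (simp add: exp_add unity_def)
  qed
  finally show ?thesis by simp
qed

lemma unity_power: "unity (a * n) = unity a ^ n"
  by (simp add: unity_def flip: exp_of_nat_mult) (simp add: mult_ac)

lemma unity_add: "unity (a + b) = unity a * unity b"
  by (simp add: unity_def field_simps add_divide_distrib flip: exp_add)

lemma unity_eq_1_iff: "unity k = 1 \<longleftrightarrow> q dvd k"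
proof
  assume "q dvd k"
  hence "k mod q = 0" by simp
  thus "unity k = 1" using unity_mod[of k] by (simp add: unity_def)
next
  assume "unity k = 1"
  then obtain n :: int where "2 * pi * of_nat k / of_nat q = of_int (2 * n) * pi"
    by (auto simp: unity_def exp_eq_1)
  hence "real k = real_of_int n * real q" using q_pos by (simp add: field_simps)
  hence "int k = n * int q" by (metis of_int_eq_iff of_int_mult of_int_of_nat_eq)
  thus "q dvd k" by (metis dvd_triv_right int_dvd_int_iff)
qed

text \<open>The Gauss sum of the conjugate character.\<close>
definition gauss :: complex where
  "gauss = (\<Sum>a\<in>{1..<q}. cnj (\<psi> (int a)) * unity a)"

lemma gauss_sum: "(\<Sum>a\<in>{1..<q}. cnj (\<psi> (int a)) * unity (a * n)) = \<psi> (int n) * gauss"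
proof (cases "q dvd n")
  case True
  hence "unity (a * n) = 1" for a by (subst unity_eq_1_iff) auto
  moreover have "\<psi> (int n) = 0" using True nonzero_iff' by blast
  moreover have "(\<Sum>a\<in>{1..<q}. cnj (\<psi> (int a))) = 0"
    by (metis sum_zero cnj_sum complex_cnj_zero)
  ultimately show ?thesis by simp
next
  case False
  hence nn: "norm (\<psi> (int n)) = 1" by (metis nonzero_iff' nonzero_iff norm_eq_1)
  have "gauss = (\<Sum>a\<in>{1..<q}. cnj (\<psi> (int ((n * a) mod q))) * unity ((n * a) mod q))"
    unfolding gauss_def by (rule sum.reindex_bij_betw [OF bij_mult[OF False], symmetric])
  also have "\<dots> = cnj (\<psi> (int n)) * (\<Sum>a\<in>{1..<q}. cnj (\<psi> (int a)) * unity (a * n))"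
    by (simp add: mod_nat unity_mod mult sum_distrib_left mult_ac del: zmod_int)
  finally have "\<psi> (int n) * gauss = (\<psi> (int n) * cnj (\<psi> (int n))) *
     (\<Sum>a\<in>{1..<q}. cnj (\<psi> (int a)) * unity (a * n))" by simp
  also have "\<psi> (int n) * cnj (\<psi> (int n)) = 1" using nn by (simp add: complex_norm_square [symmetric])
  finally show ?thesis by simp
qed

lemma sum_unity: "(\<Sum>n<q. unity (k * n)) = (if q dvd k then of_nat q else 0)"
proof (cases "q dvd k")
  case True
  hence "unity (k * n) = 1" for n by (subst unity_eq_1_iff) auto
  thus ?thesis using True by simp
next
  case False
  hence "unity k \<noteq> 1" by (simp add: unity_eq_1_iff)
  moreover have "unity k ^ q = 1" by (simp add: unity_power [symmetric] unity_eq_1_iff)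
  ultimately show ?thesis using False by (simp add: unity_power sum_gp_strict)
qed

text \<open>If the Gauss sum vanished, so would the finite Fourier transform of the character.\<close>
lemma gauss_nonzero: "gauss \<noteq> 0"
proof
  assume *: "gauss = 0"
  have "0 = (\<Sum>n<q. (\<Sum>a\<in>{1..<q}. cnj (\<psi> (int a)) * unity (a * n)) * unity ((q - 1) * n))"
    by (simp only: gauss_sum * mult_zero_left mult_zero_right sum.neutral_const)
  also have "\<dots> = (\<Sum>a\<in>{1..<q}. cnj (\<psi> (int a)) * (\<Sum>n<q. unity ((a + (q - 1)) * n)))"
    unfolding sum_distrib_left sum_distrib_right
    by (subst sum.swap) (simp only: distrib_right unity_add mult.assoc)
  also have "\<dots> = (\<Sum>a\<in>{1..<q}. if a = 1 then of_nat q else 0)"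
  proof (intro sum.cong refl)
    fix a assume a: "a \<in> {1..<q}"
    have "q dvd a + (q - 1) \<longleftrightarrow> a = 1"
    proof
      assume "q dvd a + (q - 1)"
      moreover have "a + (q - 1) = (a - 1) + q" using a by auto
      ultimately have "q dvd a - 1" by simp
      thus "a = 1" using a by (auto dest: dvd_imp_le)
    qed (use a in auto)
    thus "cnj (\<psi> (int a)) * (\<Sum>n<q. unity ((a + (q - 1)) * n)) = (if a = 1 then of_nat q else 0)"
      by (subst sum_unity) (auto simp: at_1)
  qed
  also have "\<dots> = of_nat q" using q_ge_3 by simp
  finally show False using q_pos by simp
qed

end

section \<open>Counting even characters\<close>

lemma primroot_exponent:
  fixes q g :: nat and n :: int
  assumes "prime q" "residue_primroot q g" "coprime n (int q)"
  shows "\<exists>i. [int g ^ i = n] (mod int q)"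
proof -
  have q1: "q > 1" using assms(1) prime_gt_1_nat by blast
  define m where "m = nat (n mod int q)"
  have m: "int m = n mod int q" using q1 by (simp add: m_def)
  have "coprime (int m) (int q)" using assms(3) q1 by (simp add: m coprime_mod_left_iff)
  hence "coprime m q" by (simp add: coprime_int_iff)
  moreover have "m < q" using q1 m by (metis of_nat_less_iff pos_mod_bound of_nat_0_less_iff less_trans zero_less_one)
  moreover have "m > 0" using \<open>coprime m q\<close> q1 by (cases "m = 0") auto
  ultimately have "m \<in> totatives q" by (auto simp: totatives_def)
  hence "m \<in> (\<lambda>i. g ^ i mod q) ` {..<totient q}"
    using residue_primroot_is_generator[OF q1 assms(2)] by (simp add: bij_betw_def)
  then obtain i where "m = g ^ i mod q" by auto
  hence "int g ^ i mod int q = n mod int q" using m by (metis of_nat_mod of_nat_power)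
  thus ?thesis by (auto simp: cong_def)
qed

context even_char
begin

lemma primroot_eq_power:
  assumes "[int g ^ i = n] (mod int q)"
  shows "\<psi> n = \<psi> (int g) ^ i"
  using cong_eq[OF assms] by (simp add: power)

end

text \<open>An even character is determined by its value at a primitive root \<open>g\<close>; as
  \<open>g ^ ((q - 1) div 2)\<close> is congruent to \<open>-1\<close>, that value is an arbitrary root of unity of
  order dividing \<open>(q - 1) div 2\<close>.\<close>
lemma bij_even_characters:
  assumes "prime q" "odd q"
  obtains g :: nat where "bij_betw (\<lambda>\<psi>. \<psi> (int g)) (even_nontrivial_characters q)
     ({z. z ^ ((q - 1) div 2) = 1} - {1})"
proof -
  have "q \<noteq> 2" using assms by auto
  hence q3: "q \<ge> 3" using prime_ge_2_nat[OF assms(1)] by simp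
  define h where "h = (q - 1) div 2"
  have h: "q - 1 = 2 * h" "h > 0" using assms(2) q3 by (auto simp: h_def)
  obtain g where "residue_primroot q g"
    using residue_primroot_odd_prime_power_exists[OF assms] by (metis power_one_right zero_less_one)
  note g = this
  have cop_g: "coprime q g" and ord: "ord q g = q - 1"
    using g assms(1) by (auto simp: residue_primroot_def totient_prime)
  have ndq: "\<not> q dvd g" using cop_g assms(1) by (metis coprime_absorb_left not_prime_unit)
  have cop: "coprime (int g ^ i) (int q)" for i
    using cop_g by (simp add: coprime_commute coprime_int_iff)
  \<comment> \<open>the square of \<open>g ^ h\<close> is congruent to \<open>1\<close>, but \<open>g ^ h\<close> itself is not\<close>
  have gh: "[int g ^ h = -1] (mod int q)"
  proof -
    have "[g ^ (q - 1) = 1] (mod q)" using fermat_theorem[OF assms(1) ndq] .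
    hence "[int g ^ (q - 1) = 1] (mod int q)" by (metis cong_int_iff of_nat_1 of_nat_power)
    hence "int q dvd int g ^ (2 * h) - 1" by (simp only: h cong_iff_dvd_diff)
    also have "int g ^ (2 * h) - 1 = (int g ^ h - 1) * (int g ^ h + 1)"
      by (simp add: power_mult power2_eq_square algebra_simps mult_2 power_add)
    finally have "int q dvd int g ^ h - 1 \<or> int q dvd int g ^ h + 1"
      using assms(1) by (subst (asm) prime_dvd_mult_iff) auto
    moreover have "\<not> int q dvd int g ^ h - 1"
    proof
      assume "int q dvd int g ^ h - 1"
      hence "[int g ^ h = 1] (mod int q)" by (simp add: cong_iff_dvd_diff)
      hence "[g ^ h = 1] (mod q)" by (metis cong_int_iff of_nat_1 of_nat_power)
      hence "q - 1 dvd h" using ord_divides[of g h q] by (simp add: ord)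
      thus False using h by (auto dest: dvd_imp_le)
    qed
    ultimately show ?thesis by (simp add: cong_iff_dvd_diff)
  qed
  have "bij_betw (\<lambda>\<psi>. \<psi> (int g)) (even_nontrivial_characters q) ({z. z ^ h = 1} - {1})"
    unfolding bij_betw_def
  proof
    show "inj_on (\<lambda>\<psi>. \<psi> (int g)) (even_nontrivial_characters q)"
    proof (rule inj_onI)
      fix \<psi> \<psi>' assume "\<psi> \<in> even_nontrivial_characters q" "\<psi>' \<in> even_nontrivial_characters q"
        and eq: "\<psi> (int g) = \<psi>' (int g)"
      then interpret A: even_char q \<psi> + B: even_char q \<psi>'
        using assms by (auto simp: even_char_def)
      show "\<psi> = \<psi>'"
      proof
        fix n show "\<psi> n = \<psi>' n"
        proof (cases "coprime n (int q)")
          case True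
          then obtain i where "[int g ^ i = n] (mod int q)"
            using primroot_exponent[OF assms(1) g] by blast
          thus ?thesis using A.primroot_eq_power B.primroot_eq_power eq by metis
        qed (metis A.nonzero_iff B.nonzero_iff)
      qed
    qed
    show "(\<lambda>\<psi>. \<psi> (int g)) ` even_nontrivial_characters q = {z. z ^ h = 1} - {1}"
    proof (intro equalityI subsetI)
      fix z assume "z \<in> (\<lambda>\<psi>. \<psi> (int g)) ` even_nontrivial_characters q"
      then obtain \<psi> where psi: "\<psi> \<in> even_nontrivial_characters q" "z = \<psi> (int g)" by auto
      then interpret A: even_char q \<psi>
        using assms by (auto simp: even_char_def)
      have "z ^ h = 1" using A.primroot_eq_power[OF gh] A.even[of 1] A.at_1 psi by simp
      moreover have "z \<noteq> 1"
      proof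
        assume "z = 1"
        have "\<psi> n = principal_character q n" for n
        proof (cases "coprime n (int q)")
          case True
          then obtain i where "[int g ^ i = n] (mod int q)"
            using primroot_exponent[OF assms(1) g] by blast
          thus ?thesis using A.primroot_eq_power psi \<open>z = 1\<close> True
            by (simp add: principal_character_def)
        next
          case False
          thus ?thesis using A.nonzero_iff by (auto simp: principal_character_def)
        qed
        hence "\<psi> = principal_character q" by blast
        thus False using psi by (simp add: even_nontrivial_characters_def)
      qed
      ultimately show "z \<in> {z. z ^ h = 1} - {1}" by simp
    next
      fix z :: complex assume z: "z \<in> {z. z ^ h = 1} - {1}"
      define ind where "ind n = (SOME i. [int g ^ i = n] (mod int q))" for n :: int
      have ind: "[int g ^ ind n = n] (mod int q)" if "coprime n (int q)" for n
        unfolding ind_def using primroot_exponent[OF assms(1) g that] by (rule someI_ex)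
      have z1: "z ^ (q - 1) = 1" using z by (simp only: h mult.commute[of 2] power_mult) simp
      have pw: "z ^ i = z ^ j" if "[int g ^ i = int g ^ j] (mod int q)" for i j
      proof -
        have "[g ^ i = g ^ j] (mod q)" using that by (metis cong_int_iff of_nat_power)
        hence "[i = j] (mod (q - 1))"
          using order_divides_expdiff[OF cop_g] ord by simp
        hence "i mod (q - 1) = j mod (q - 1)" by (simp add: cong_def)
        moreover have "z ^ k = z ^ (k mod (q - 1))" for k
        proof -
          have "z ^ k = z ^ ((q - 1) * (k div (q - 1)) + k mod (q - 1))" by simp
          also have "\<dots> = z ^ (k mod (q - 1))" by (simp only: power_add power_mult z1) simp
          finally show ?thesis .
        qed
        ultimately show ?thesis by metis
      qed
      define \<psi> where "\<psi> n = (if coprime n (int q) then z ^ ind n else 0)" for n :: int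
      have \<psi>_eq: "\<psi> n = z ^ i" if "[int g ^ i = n] (mod int q)" for n i
      proof -
        have c: "coprime n (int q)" using cop[of i] that
          by (metis cong_imp_coprime)
        have "[int g ^ ind n = int g ^ i] (mod int q)"
          using ind[OF c] that cong_sym cong_trans by blast
        thus ?thesis using c pw by (simp add: \<psi>_def)
      qed
      have z0: "z \<noteq> 0" using z h by (auto simp: zero_power)
      have "dirichlet_character q \<psi>"
        unfolding dirichlet_character_def
      proof (intro conjI allI)
        fix m n
        show "\<psi> (m * n) = \<psi> m * \<psi> n"
        proof (cases "coprime m (int q) \<and> coprime n (int q)")
          case True
          hence i: "[int g ^ ind m = m] (mod int q)" "[int g ^ ind n = n] (mod int q)"
            using ind by auto
          hence "[int g ^ (ind m + ind n) = m * n] (mod int q)"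
            by (simp add: power_add cong_mult)
          from \<psi>_eq[OF this] \<psi>_eq[OF i(1)] \<psi>_eq[OF i(2)] show ?thesis by (simp add: power_add)
        qed (auto simp: \<psi>_def)
      next
        fix n
        show "\<psi> (n + int q) = \<psi> n"
        proof (cases "coprime n (int q)")
          case True
          have "[int g ^ ind n = n + int q] (mod int q)"
            using ind[OF True] by (simp add: cong_def)
          from \<psi>_eq[OF this] \<psi>_eq[OF ind[OF True]] show ?thesis by simp
        next
          case False
          hence "\<not> coprime (n + int q) (int q)" by (metis gcd_add1 coprime_iff_gcd_eq_1)
          thus ?thesis using False by (simp add: \<psi>_def)
        qed
      next
        fix n show "\<psi> n \<noteq> 0 \<longleftrightarrow> coprime n (int q)" using z0 by (simp add: \<psi>_def)
      qed
      moreover have "\<psi> (int g) = z" using \<psi>_eq[of 1 "int g"] by simp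
      moreover have "\<psi> \<noteq> principal_character q"
        using z z0 \<open>\<psi> (int g) = z\<close> by (auto simp: principal_character_def split: if_splits)
      moreover have "\<psi> (-1) = 1" using \<psi>_eq[OF gh] z by simp
      ultimately show "z \<in> (\<lambda>\<psi>. \<psi> (int g)) ` even_nontrivial_characters q"
        by (auto simp: even_nontrivial_characters_def intro!: image_eqI[of _ _ \<psi>])
    qed
  qed
  thus ?thesis using that unfolding h_def by blast
qed

lemma finite_card_even_nontrivial_characters:
  assumes "prime q" "odd q"
  shows "finite (even_nontrivial_characters q)" "card (even_nontrivial_characters q) = (q - 3) div 2"
proof -
  have "q \<noteq> 2" using assms by auto
  hence q3: "q \<ge> 3" using prime_ge_2_nat[OF assms(1)] by simp
  obtain g where b: "bij_betw (\<lambda>\<psi>. \<psi> (int g)) (even_nontrivial_characters q)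
     ({z. z ^ ((q - 1) div 2) = 1} - {1})"
    using bij_even_characters[OF assms] .
  have pos: "(q - 1) div 2 > 0" using q3 by simp
  have f: "finite {z::complex. z ^ ((q - 1) div 2) = 1}" using pos by (intro finite_roots_unity) auto
  show "finite (even_nontrivial_characters q)" using bij_betw_finite[OF b] f by simp
  have "card (even_nontrivial_characters q) = card ({z::complex. z ^ ((q - 1) div 2) = 1} - {1})"
    using bij_betw_same_card[OF b] .
  also have "\<dots> = (q - 1) div 2 - 1"
    using card_roots_unity_eq[OF pos] f by (subst card_Diff_singleton) auto
  finally show "card (even_nontrivial_characters q) = (q - 3) div 2" using q3 by simp
qed

section \<open>Analytic continuation of the L-function\<close>

text \<open>The part of the sum of \<open>\<psi>(n) f(n)\<close> in which \<open>n\<close> runs through \<open>q m + 1, ..., q m + q - 1\<close>, where \<open>\<psi>\<close>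
  has period \<open>q\<close> and vanishes at the multiples of \<open>q\<close>.\<close>
definition char_block :: "(int \<Rightarrow> complex) \<Rightarrow> nat \<Rightarrow> (nat \<Rightarrow> complex) \<Rightarrow> nat \<Rightarrow> complex" where
  "char_block \<psi> q f m = (\<Sum>a\<in>{1..<q}. \<psi> (int a) * f (q * m + a))"

text \<open>The Dirichlet series summed block by block, so that it converges for \<open>Re s > -1\<close>
  (for non-trivial even \<open>\<psi>\<close>).\<close>
definition block_L :: "(int \<Rightarrow> complex) \<Rightarrow> nat \<Rightarrow> complex \<Rightarrow> complex" where
  "block_L \<psi> q s = (\<Sum>m. char_block \<psi> q (\<lambda>n. of_nat n powr (-s)) m)"

lemma powr_second_difference_bound:
  fixes Q d :: real and s :: complex
  assumes "Q > 0" "d \<ge> 0" "Re s > -2"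
  shows "norm (of_real (Q + d) powr (-s) - (of_real Q powr (-s) + (-s) * of_real Q powr (-s-1) * of_real d))
     \<le> (norm s * norm (s + 1) * Q powr (- Re s - 2)) * d\<^sup>2"
proof -
  define f where "f i z = (if i = 0 then z powr (-s) else if i = 1 then (-s) * z powr (-s-1) else
     (-s) * ((-s-1) * z powr (-s-2)))" for i :: nat and z :: complex
  let ?S = "closed_segment (of_real Q) (of_real (Q + d)) :: complex set"
  have S: "Re z \<ge> Q" "Im z = 0" if "z \<in> ?S" for z
  proof -
    from that obtain u where u: "0 \<le> u" "z = of_real Q + of_real u * of_real d"
      by (auto simp: closed_segment_def algebra_simps scaleR_conv_of_real)
    thus "Re z \<ge> Q" "Im z = 0" using assms by auto
  qed
  have "norm (f 0 (of_real (Q + d)) - (\<Sum>i\<le>1. f i (of_real Q) * (of_real (Q + d) - of_real Q) ^ i / fact i)) \<le>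
     (norm s * norm (s + 1) * Q powr (- Re s - 2)) * norm (of_real (Q + d) - of_real Q :: complex) ^ Suc 1 / fact 1"
  proof (rule complex_Taylor[where S = ?S])
    fix i z assume z: "z \<in> ?S" and i: "i \<le> (1::nat)"
    have "z \<notin> \<real>\<^sub>\<le>\<^sub>0" using S[OF z] assms by (auto simp: complex_nonpos_Reals_iff)
    note D = has_field_derivative_powr[OF this]
    have "(f i has_field_derivative f (Suc i) z) (at z)"
    proof (cases "i = 0")
      case True
      thus ?thesis using D[of "-s"] by (simp add: f_def [abs_def])
    next
      case False
      hence "i = 1" using i by simp
      moreover have "-s-1-1 = -s-2" by simp
      ultimately show ?thesis using DERIV_cmult[OF D[of "-s-1"], of "-s"]
        by (simp only: f_def [abs_def]) simp
    qed
    thus "(f i has_field_derivative f (Suc i) z) (at z within ?S)"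
      by (rule has_field_derivative_at_within)
  next
    fix z assume z: "z \<in> ?S"
    have z': "z = of_real (Re z)" using S[OF z] by (simp add: complex_eq_iff)
    have "norm (f (Suc 1) z) = norm s * norm (s + 1) * norm (z powr (-s-2))"
      by (simp add: f_def norm_mult) (metis add.commute minus_add norm_minus_cancel uminus_add_conv_diff)
    also have "norm (z powr (-s-2)) = Re z powr (- Re s - 2)"
      using S[OF z] assms by (subst z', subst norm_powr_real_powr) auto
    also have "\<dots> \<le> Q powr (- Re s - 2)"
      using S[OF z] assms by (intro powr_mono2') auto
    finally show "norm (f (Suc 1) z) \<le> norm s * norm (s + 1) * Q powr (- Re s - 2)"
      by (simp add: mult_left_mono)
  qed auto
  thus ?thesis using assms by (simp add: f_def power2_eq_square)
qed

context even_char
begin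

abbreviation block :: "(nat \<Rightarrow> complex) \<Rightarrow> nat \<Rightarrow> complex" where
  "block \<equiv> char_block \<psi> q"

abbreviation L :: "complex \<Rightarrow> complex" where
  "L \<equiv> block_L \<psi> q"

text \<open>The constant and the linear term of the Taylor expansion at \<open>q m\<close> do not contribute to a block.\<close>
lemma block_bound:
  assumes "Re s > -2" "m > 0"
  shows "norm (block (\<lambda>n. of_nat n powr (-s)) m)
    \<le> real q ^ 3 * (norm s * norm (s + 1)) * real m powr (- Re s - 2)"
proof -
  define Q where "Q = real (q * m)"
  have Q: "Q > 0" "Q \<ge> real m" using assms q_ge_3 by (auto simp: Q_def)
  define c where "c = norm s * norm (s + 1) * real m powr (- Re s - 2)"
  let ?D = "\<lambda>a. of_real (Q + real a) powr (-s) - (of_real Q powr (-s) + (-s) * of_real Q powr (-s-1) * of_real (real a))"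
  have "block (\<lambda>n. of_nat n powr (-s)) m = (\<Sum>a\<in>{1..<q}. \<psi> (int a) * of_real (Q + real a) powr (-s))
     - of_real Q powr (-s) * (\<Sum>a\<in>{1..<q}. \<psi> (int a))
     - (-s) * of_real Q powr (-s-1) * (\<Sum>a\<in>{1..<q}. \<psi> (int a) * of_nat a)"
    unfolding sum_zero sum_linear_zero by (simp add: char_block_def Q_def)
  also have "\<dots> = (\<Sum>a\<in>{1..<q}. \<psi> (int a) * ?D a)"
    unfolding sum_distrib_left sum_subtractf [symmetric] by (intro sum.cong) (auto simp: algebra_simps)
  finally have "norm (block (\<lambda>n. of_nat n powr (-s)) m) \<le> (\<Sum>a\<in>{1..<q}. norm (\<psi> (int a) * ?D a))"
    by (simp only: norm_sum)
  also have "\<dots> \<le> (\<Sum>a\<in>{1..<q}. c * (real q)\<^sup>2)"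
  proof (rule sum_mono)
    fix a assume a: "a \<in> {1..<q}"
    have "norm (\<psi> (int a) * ?D a) \<le> norm (?D a)"
      using norm_le_1[of "int a"] by (simp only: norm_mult mult_left_le_one_le norm_ge_zero)
    also have "\<dots> \<le> (norm s * norm (s + 1) * Q powr (- Re s - 2)) * (real a)\<^sup>2"
      using assms Q by (intro powr_second_difference_bound) auto
    also have "\<dots> \<le> c * (real q)\<^sup>2"
      unfolding c_def using a Q assms by (intro mult_mono power_mono powr_mono2') auto
    finally show "norm (\<psi> (int a) * ?D a) \<le> c * (real q)\<^sup>2" .
  qed
  also have "\<dots> = real (q - 1) * (c * (real q)\<^sup>2)" by simp
  also have "\<dots> \<le> real q * (c * (real q)\<^sup>2)"
    by (intro mult_right_mono) (auto simp: c_def)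
  also have "\<dots> = real q ^ 3 * (norm s * norm (s + 1)) * real m powr (- Re s - 2)"
    by (simp add: c_def power2_eq_square power3_eq_cube)
  finally show ?thesis .
qed

lemma L_uniform_limit:
  assumes "\<delta> > 0"
  shows "uniform_limit {s. norm s < R \<and> Re s > -1 + \<delta>}
    (\<lambda>N s. \<Sum>m<N. block (\<lambda>n. of_nat n powr (-s)) m) L sequentially"
proof -
  let ?A = "{s. norm s < R \<and> Re s > -1 + \<delta>}"
  have "uniform_limit ?A (\<lambda>N s. \<Sum>m<N. block (\<lambda>n. of_nat n powr (-s)) m)
    (\<lambda>s. \<Sum>m. block (\<lambda>n. of_nat n powr (-s)) m) sequentially"
  proof (rule Weierstrass_m_test_ev)
    show "summable (\<lambda>m. real q ^ 3 * (R * (R + 1)) * of_nat m powr (-1 - \<delta>))"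
      using assms by (intro summable_mult) (simp only: summable_real_powr_iff)
    show "\<forall>\<^sub>F m in sequentially. \<forall>s\<in>?A. norm (block (\<lambda>n. of_nat n powr (-s)) m)
       \<le> real q ^ 3 * (R * (R + 1)) * of_nat m powr (-1 - \<delta>)"
      using eventually_gt_at_top[of 0]
    proof eventually_elim
      case (elim m)
      show ?case
      proof
        fix s assume s: "s \<in> ?A"
        hence R: "norm s < R" by simp
        hence "R \<ge> 0" using norm_ge_zero[of s] by linarith
        have "norm (s + 1) \<le> R + 1" using norm_triangle_ineq[of s 1] R by simp
        hence "real q ^ 3 * (norm s * norm (s + 1)) * real m powr (- Re s - 2)
          \<le> real q ^ 3 * (R * (R + 1)) * of_nat m powr (-1 - \<delta>)"
          using R \<open>R \<ge> 0\<close> s elim by (intro mult_mono powr_mono) auto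
        moreover have "Re s > -2" using s assms by simp
        ultimately show "norm (block (\<lambda>n. of_nat n powr (-s)) m)
       \<le> real q ^ 3 * (R * (R + 1)) * of_nat m powr (-1 - \<delta>)"
          using block_bound[of s m] elim by linarith
      qed
    qed
  qed
  thus ?thesis by (simp add: block_L_def [abs_def])
qed

lemma L_uniform_nhd:
  assumes "Re s > -1"
  obtains A where "open A" "s \<in> A" "A \<subseteq> {s. Re s > -1}"
    "uniform_limit A (\<lambda>N s. \<Sum>m<N. block (\<lambda>n. of_nat n powr (-s)) m) L sequentially"
proof -
  define \<delta> where "\<delta> = (Re s + 1) / 2"
  let ?A = "{z. norm z < norm s + 1 \<and> Re z > -1 + \<delta>}"
  have eq: "?A = ball 0 (norm s + 1) \<inter> {z. Re z > -1 + \<delta>}" by auto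
  have d: "\<delta> > 0" using assms by (simp add: \<delta>_def)
  have "open ?A" unfolding eq by (intro open_Int open_ball open_halfspace_Re_gt)
  moreover have "s \<in> ?A" using assms by (auto simp: \<delta>_def field_simps)
  moreover have "?A \<subseteq> {s. Re s > -1}" using d by auto
  ultimately show ?thesis using that[of ?A] L_uniform_limit[OF d] by blast
qed

lemma partial_sum_higher_deriv:
  "(deriv ^^ k) (\<lambda>s. \<Sum>m<N. block (\<lambda>n. of_nat n powr (-s)) m) =
   (\<lambda>s. \<Sum>m<N. block (\<lambda>n. (- of_real (ln (real n))) ^ k * of_nat n powr (-s)) m)"
proof (induction k)
  case (Suc k)
  have "deriv (\<lambda>s. \<Sum>m<N. block (\<lambda>n. (- of_real (ln (real n))) ^ k * of_nat n powr (-s)) m) s =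
    (\<Sum>m<N. block (\<lambda>n. (- of_real (ln (real n))) ^ Suc k * of_nat n powr (-s)) m)" for s
  proof (rule DERIV_imp_deriv)
    have D: "((\<lambda>s. (- of_real (ln (real n))) ^ k * of_nat n powr (-s)) has_field_derivative
       (- of_real (ln (real n))) ^ Suc k * of_nat n powr (-s)) (at s)" if "n > 0" for n
    proof -
      have "((\<lambda>s. of_nat n powr (-s)) has_field_derivative (Ln (of_nat n) * of_nat n powr (-s)) * (-1)) (at s)"
        using that by (intro DERIV_chain2[OF has_field_derivative_powr_right]) (auto intro!: derivative_eq_intros)
      from DERIV_cmult[OF this] show ?thesis
        by (rule DERIV_cong) (simp add: Ln_of_nat that)
    qed
    show "((\<lambda>s. \<Sum>m<N. block (\<lambda>n. (- of_real (ln (real n))) ^ k * of_nat n powr (-s)) m) has_field_derivative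
     (\<Sum>m<N. block (\<lambda>n. (- of_real (ln (real n))) ^ Suc k * of_nat n powr (-s)) m)) (at s)"
      unfolding char_block_def by (intro DERIV_sum DERIV_cmult D) auto
  qed
  thus ?case by (simp only: funpow.simps o_apply Suc)
qed simp

lemma partial_sum_holomorphic:
  "(\<lambda>s. \<Sum>m<N. block (\<lambda>n. of_nat n powr (-s)) m) holomorphic_on A"
  unfolding char_block_def by (intro holomorphic_intros)

lemma L_holomorphic: "L holomorphic_on {s. Re s > -1}"
proof (rule holomorphic_uniform_sequence[OF open_halfspace_Re_gt partial_sum_holomorphic])
  fix s assume "s \<in> {s. Re s > -1}"
  then obtain A where A: "open A" "s \<in> A" "A \<subseteq> {s. Re s > -1}"
    "uniform_limit A (\<lambda>N s. \<Sum>m<N. block (\<lambda>n. of_nat n powr (-s)) m) L sequentially"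
    using L_uniform_nhd by blast
  obtain d where "d > 0" "cball s d \<subseteq> A" using A by (meson open_contains_cball)
  thus "\<exists>d>0. cball s d \<subseteq> {s. - 1 < Re s} \<and>
    uniform_limit (cball s d) (\<lambda>N s. \<Sum>m<N. block (\<lambda>n. of_nat n powr (-s)) m) L sequentially"
    using A by (intro exI[of _ d]) (auto intro: uniform_limit_on_subset)
qed

lemma L_higher_deriv_sums:
  assumes "Re s > -1"
  shows "(\<lambda>m. block (\<lambda>n. (- of_real (ln (real n))) ^ k * of_nat n powr (-s)) m) sums (deriv ^^ k) L s"
proof -
  obtain A where A: "open A" "s \<in> A" "A \<subseteq> {s. Re s > -1}"
    "uniform_limit A (\<lambda>N s. \<Sum>m<N. block (\<lambda>n. of_nat n powr (-s)) m) L sequentially"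
    using L_uniform_nhd[OF assms] by blast
  have "(\<lambda>N. (deriv ^^ k) (\<lambda>s. \<Sum>m<N. block (\<lambda>n. of_nat n powr (-s)) m) s) \<longlonglongrightarrow> (deriv ^^ k) L s"
    by (rule higher_deriv_complex_uniform_limit[OF A(4)])
       (use A in \<open>auto intro!: partial_sum_holomorphic always_eventually\<close>)
  thus ?thesis by (simp add: partial_sum_higher_deriv sums_def)
qed

lemma L_sums: "Re s > -1 \<Longrightarrow> (\<lambda>m. block (\<lambda>n. of_nat n powr (-s)) m) sums L s"
  using L_higher_deriv_sums[of s 0] by simp

lemma sum_to_block:
  "(\<Sum>i\<in>{m*q..<m*q+q}. \<psi> (int (Suc i)) * f (Suc i)) = block f m"
proof -
  have "(\<Sum>i\<in>{m*q..<m*q+q}. \<psi> (int (Suc i)) * f (Suc i)) = (\<Sum>a\<in>{1..q}. \<psi> (int (q * m + a)) * f (q * m + a))"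
    by (rule sum.reindex_bij_witness[of _ "\<lambda>a. m * q + a - 1" "\<lambda>i. Suc i - m * q"])
       (auto simp: mult_ac)
  also have "{1..q} = insert q {1..<q}" using q_pos by auto
  also have "(\<Sum>a\<in>insert q {1..<q}. \<psi> (int (q * m + a)) * f (q * m + a)) =
     (\<Sum>a\<in>{1..<q}. \<psi> (int (q * m + a)) * f (q * m + a))"
    by (subst sum.insert) (simp_all only: zero_at_multiple finite_atLeastLessThan, auto)
  also have "\<dots> = block f m"
    unfolding char_block_def by (intro sum.cong refl) (simp only: period_nat)
  finally show ?thesis .
qed

lemma sums_block:
  assumes "(\<lambda>n. \<psi> (int (Suc n)) * f (Suc n)) sums S"
  shows "block f sums S"
  using sums_group[OF assms q_pos] by (simp only: sum_to_block)

lemma summable_dirichlet_series: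
  assumes "Re s > 1"
  shows "summable (\<lambda>n. norm (\<psi> (int (Suc n)) * of_nat (Suc n) powr (-s)))"
proof (rule summable_comparison_test_ev)
  show "summable (\<lambda>n. real (Suc n) powr (- Re s))"
    using assms by (subst summable_Suc_iff) (simp only: summable_real_powr_iff)
  have "norm (\<psi> (int (Suc n)) * of_nat (Suc n) powr (-s)) \<le> real (Suc n) powr (- Re s)" for n
  proof -
    have "norm (of_nat (Suc n) powr (-s)) = real (Suc n) powr (- Re s)"
      using norm_powr_real_powr[of "of_nat (Suc n)" "-s"] by simp
    thus ?thesis using mult_left_le_one_le[OF powr_ge_zero norm_ge_zero norm_le_1]
      by (simp only: norm_mult)
  qed
  thus "\<forall>\<^sub>F n in sequentially. norm (norm (\<psi> (int (Suc n)) * of_nat (Suc n) powr (-s))) \<le> real (Suc n) powr (- Re s)"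
    by (simp only: real_norm_def abs_norm_cancel eventually_sequentially) blast
qed

lemma dirichlet_series_eq_L:
  assumes "Re s > 1"
  shows "dirichlet_series \<psi> s = L s"
proof -
  have eq: "\<psi> (int (Suc n)) / of_nat (Suc n) powr s = \<psi> (int (Suc n)) * of_nat (Suc n) powr (-s)" for n
    by (simp only: powr_minus divide_inverse)
  have "(\<lambda>n. \<psi> (int (Suc n)) * of_nat (Suc n) powr (-s)) sums dirichlet_series \<psi> s"
    unfolding dirichlet_series_def eq
    using summable_norm_cancel[OF summable_dirichlet_series[OF assms]] by (rule summable_sums)
  hence "block (\<lambda>n. of_nat n powr (-s)) sums dirichlet_series \<psi> s" by (rule sums_block)
  moreover have "block (\<lambda>n. of_nat n powr (-s)) sums L s" using assms by (intro L_sums) auto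
  ultimately show ?thesis by (rule sums_unique2)
qed

text \<open>Any two continuations to half-planes agree on the smaller one by the identity theorem.\<close>
lemma dirichlet_L_eq:
  assumes "Re s > -1"
  shows "dirichlet_L q \<psi> s = L s"
proof -
  have np: "\<psi> \<noteq> principal_character q"
    using char by (simp add: even_nontrivial_characters_def)
  show ?thesis
    unfolding dirichlet_L_def if_not_P[OF np] Diff_empty
  proof (rule the_equality)
    show "\<exists>c f. c < 1 \<and> c < Re s \<and> f holomorphic_on {z. c < Re z} \<and>
            (\<forall>z. 1 < Re z \<longrightarrow> f z = dirichlet_series \<psi> z) \<and> L s = f s"
      using assms L_holomorphic dirichlet_series_eq_L by (intro exI[of _ "-1"] exI[of _ L]) auto
  next
    fix l assume "\<exists>c f. c < 1 \<and> c < Re s \<and> f holomorphic_on {z. c < Re z} \<and>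
            (\<forall>z. 1 < Re z \<longrightarrow> f z = dirichlet_series \<psi> z) \<and> l = f s"
    then obtain c f where c: "c < 1" "c < Re s" and f: "f holomorphic_on {z. c < Re z}"
      and eq: "\<And>z. 1 < Re z \<Longrightarrow> f z = dirichlet_series \<psi> z" and l: "l = f s" by blast
    let ?D = "{z. max c (-1) < Re z}"
    have "f s = L s"
    proof (rule analytic_continuation_open[of "{z. 1 < Re z}" ?D f L])
      show "open {z. 1 < Re z}" "open ?D" by (rule open_halfspace_Re_gt)+
      show "{z. 1 < Re z} \<noteq> {}" by (auto intro: exI[of _ 2])
      show "connected ?D" by (intro convex_connected convex_halfspace_Re_gt)
      show "{z. 1 < Re z} \<subseteq> ?D" using c by auto
      show "f holomorphic_on ?D" by (rule holomorphic_on_subset[OF f]) auto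
      show "L holomorphic_on ?D" by (rule holomorphic_on_subset[OF L_holomorphic]) auto
      show "f z = L z" if "z \<in> {z. 1 < Re z}" for z using that eq dirichlet_series_eq_L by simp
      show "s \<in> ?D" using c assms by simp
    qed
    thus "l = L s" using l by simp
  qed
qed

lemma deriv_dirichlet_L_1: "deriv (dirichlet_L q \<psi>) 1 = deriv L 1"
proof (rule deriv_cong_ev)
  have "\<forall>\<^sub>F s in nhds 1. s \<in> {s. Re s > -1}"
    by (intro eventually_nhds_in_open open_halfspace_Re_gt) auto
  thus "\<forall>\<^sub>F s in nhds 1. dirichlet_L q \<psi> s = L s"
    by eventually_elim (use dirichlet_L_eq in auto)
qed auto

text \<open>Summation by parts over blocks: the sum over a full period is zero, so that a block of values of a
  decreasing function is controlled by the decrease over that period.\<close>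
lemma norm_sum_blocks_le:
  fixes f :: "nat \<Rightarrow> real"
  assumes dec: "\<And>m n. 0 < m \<Longrightarrow> m \<le> n \<Longrightarrow> f n \<le> f m" and nonneg: "\<And>n. n > 0 \<Longrightarrow> f n \<ge> 0"
  shows "norm (\<Sum>m<N. block (\<lambda>n. of_real (f n)) m) \<le> q * f 1"
proof -
  have bl: "norm (block (\<lambda>n. of_real (f n)) m) \<le> q * (f (q * m + 1) - f (q * Suc m + 1))" for m
  proof -
    have "block (\<lambda>n. of_real (f n)) m = (\<Sum>a\<in>{1..<q}. \<psi> (int a) * of_real (f (q * m + a)))
       - of_real (f (q * Suc m + 1)) * (\<Sum>a\<in>{1..<q}. \<psi> (int a))"
      by (simp only: sum_zero char_block_def mult_zero_right diff_0_right)
    also have "\<dots> = (\<Sum>a\<in>{1..<q}. \<psi> (int a) * of_real (f (q * m + a) - f (q * Suc m + 1)))"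
      unfolding sum_distrib_left sum_subtractf [symmetric] of_real_diff
      by (intro sum.cong) (auto simp: algebra_simps)
    also have "norm \<dots> \<le> (\<Sum>a\<in>{1..<q}. f (q * m + 1) - f (q * Suc m + 1))"
    proof (rule order.trans[OF norm_sum sum_mono])
      fix a assume a: "a \<in> {1..<q}"
      have "norm (\<psi> (int a) * of_real (f (q * m + a) - f (q * Suc m + 1))) \<le>
         norm (of_real (f (q * m + a) - f (q * Suc m + 1)) :: complex)"
        using norm_le_1[of "int a"] by (simp only: norm_mult mult_left_le_one_le norm_ge_zero)
      also have "\<dots> = \<bar>f (q * m + a) - f (q * Suc m + 1)\<bar>" by (simp only: norm_of_real)
      also have "\<dots> = f (q * m + a) - f (q * Suc m + 1)"
        using dec[of "q * m + a" "q * Suc m + 1"] a by simp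
      also have "\<dots> \<le> f (q * m + 1) - f (q * Suc m + 1)"
        using dec[of "q * m + 1" "q * m + a"] a by simp
      finally show "norm (\<psi> (int a) * of_real (f (q * m + a) - f (q * Suc m + 1))) \<le>
        f (q * m + 1) - f (q * Suc m + 1)" .
    qed
    also have "\<dots> = real (q - 1) * (f (q * m + 1) - f (q * Suc m + 1))" by simp
    also have "\<dots> \<le> q * (f (q * m + 1) - f (q * Suc m + 1))"
      using dec[of "q * m + 1" "q * Suc m + 1"] by (intro mult_right_mono) auto
    finally show ?thesis .
  qed
  have "norm (\<Sum>m<N. block (\<lambda>n. of_real (f n)) m) \<le> (\<Sum>m<N. q * (f (q * m + 1) - f (q * Suc m + 1)))"
    by (rule order.trans[OF norm_sum sum_mono]) (rule bl)
  also have "\<dots> = q * (f 1 - f (q * N + 1))"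
    unfolding sum_distrib_left [symmetric] by (subst sum_lessThan_telescope') simp
  also have "\<dots> \<le> q * f 1" using nonneg[of "q * N + 1"] by (intro mult_left_mono) auto
  finally show ?thesis .
qed

end

section \<open>Two integrals and the cotangent series\<close>

lemma has_integral_of_absolutely:
  fixes f :: "'a::euclidean_space \<Rightarrow> real"
  assumes "f absolutely_integrable_on S \<and> integral S f = b"
  shows "(f has_integral b) S"
  using assms by (metis has_integral_integral set_lebesgue_integral_eq_integral(1))

text \<open>Euler's integral after the substitution of \<open>c t\<close> for \<open>t\<close>.\<close>
lemma has_integral_Gamma_scaled:
  assumes "s > 0" "c > (0::real)"
  shows "((\<lambda>t. t powr (s - 1) * exp (- c * t)) has_integral Gamma s * c powr (-s)) {0<..}"
proof -
  let ?f = "\<lambda>t. t powr (s - 1) / exp t"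
  have G: "(?f has_integral Gamma s) {0<..}"
  proof -
    have "((\<lambda>t. if t \<in> {0<..} then ?f t else 0) has_integral Gamma s) {0..}"
      by (rule has_integral_spike[of "{0}", OF _ _ Gamma_integral_real[OF assms(1)]]) auto
    thus ?thesis by (subst (asm) has_integral_restrict) auto
  qed
  have img: "(\<lambda>t. c * t) ` {0<..} = {0<..}"
  proof safe
    fix x :: real assume "x > 0"
    thus "x \<in> (\<lambda>t. c * t) ` {0<..}" using assms by (intro image_eqI[of _ _ "x / c"]) auto
  qed (use assms in auto)
  have ai: "?f absolutely_integrable_on {0<..}"
    using G by (intro nonnegative_absolutely_integrable_1) (auto simp: integrable_on_def)
  have "?f absolutely_integrable_on (\<lambda>t. c * t) ` {0<..} \<and> integral ((\<lambda>t. c * t) ` {0<..}) ?f = Gamma s"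
    using ai G by (auto simp: img integral_unique)
  hence "(\<lambda>t. \<bar>c\<bar> *\<^sub>R ?f (c * t)) absolutely_integrable_on {0<..} \<and>
      integral {0<..} (\<lambda>t. \<bar>c\<bar> *\<^sub>R ?f (c * t)) = Gamma s"
    by (subst has_absolute_integral_change_of_variables_real)
       (use assms in \<open>auto intro!: derivative_eq_intros inj_onI\<close>)
  hence "((\<lambda>t. \<bar>c\<bar> *\<^sub>R ?f (c * t)) has_integral Gamma s) {0<..}"
    by (rule has_integral_of_absolutely)
  hence "((\<lambda>t. c powr (-s) * (\<bar>c\<bar> *\<^sub>R ?f (c * t))) has_integral c powr (-s) * Gamma s) {0<..}"
    by (rule has_integral_mult_right)
  thus ?thesis
  proof (subst mult.commute, elim has_integral_eq[rotated])
    fix t :: real assume t: "t \<in> {0<..}"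
    have "c powr (-s) * (c * c powr (s - 1)) = 1"
      using assms by (simp add: powr_diff powr_minus field_simps)
    thus "c powr (-s) * (\<bar>c\<bar> *\<^sub>R ?f (c * t)) = t powr (s - 1) * exp (- c * t)"
      using t assms by (simp add: powr_mult exp_minus field_simps)
  qed
qed

lemma Beta_complementary:
  assumes "0 < s" "s < (1::real)"
  shows "Beta ((1 + s) / 2) ((1 - s) / 2) = pi / cos (pi * s / 2)"
proof -
  have "complex_of_real (Gamma ((1 + s) / 2) * Gamma ((1 - s) / 2)) =
     Gamma (of_real ((1 + s) / 2)) * Gamma (1 - of_real ((1 + s) / 2))"
  proof -
    have "(1 - s) / 2 = 1 - (1 + s) / 2" by (simp add: field_simps)
    thus ?thesis using Gamma_complex_of_real[of "1 - (1 + s) / 2"] Gamma_complex_of_real[of "(1 + s) / 2"]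
      by (simp only: of_real_mult of_real_diff of_real_1)
  qed
  also have "\<dots> = of_real pi / sin (of_real pi * of_real ((1 + s) / 2))"
    by (rule Gamma_reflection_complex)
  also have "\<dots> = of_real (pi / sin (pi * ((1 + s) / 2)))"
  proof -
    have "sin (of_real pi * of_real ((1 + s) / 2)) = complex_of_real (sin (pi * ((1 + s) / 2)))"
      by (metis of_real_mult sin_of_real)
    thus ?thesis by (simp only: of_real_divide [symmetric])
  qed
  also have "sin (pi * ((1 + s) / 2)) = cos (pi * s / 2)"
    using sin_add[of "pi / 2" "pi * s / 2"] by (simp add: field_simps)
  finally have "Gamma ((1 + s) / 2) * Gamma ((1 - s) / 2) = pi / cos (pi * s / 2)"
    by (simp only: of_real_eq_iff)
  moreover have "(1 + s) / 2 + (1 - s) / 2 = 1" by (simp add: field_simps)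
  ultimately show ?thesis by (simp add: Beta_def)
qed

text \<open>The Beta integral after the substitution \<open>v = t\<^sup>2 / (t\<^sup>2 + r\<^sup>2)\<close>.\<close>
lemma has_integral_powr_over_quadratic:
  assumes "0 < s" "s < 1" "r > (0::real)"
  shows "((\<lambda>t. t powr s / (t\<^sup>2 + r\<^sup>2)) has_integral r powr (s - 1) * (pi / (2 * cos (pi * s / 2)))) {0<..}"
proof -
  define a where "a = (1 + s) / 2"
  define b where "b = (1 - s) / 2"
  let ?f = "\<lambda>v. v powr (a - 1) * (1 - v) powr (b - 1)"
  let ?g = "\<lambda>t. t\<^sup>2 / (t\<^sup>2 + r\<^sup>2)"
  let ?g' = "\<lambda>t. 2 * t * r\<^sup>2 / (t\<^sup>2 + r\<^sup>2)\<^sup>2"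
  have ab: "a > 0" "b > 0" using assms by (auto simp: a_def b_def)
  have B: "(?f has_integral Beta a b) {0<..<1}"
    using has_integral_Beta_real[OF ab] by (simp add: has_integral_Icc_iff_Ioo)
  have pos: "t\<^sup>2 + r\<^sup>2 > 0" for t using assms by (simp add: add_nonneg_pos)
  have img: "?g ` {0<..} = {0<..<1}"
  proof (intro equalityI subsetI)
    fix v assume "v \<in> ?g ` {0<..}"
    then obtain t where "v = ?g t" "t > 0" by auto
    thus "v \<in> {0<..<1}" using pos[of t] assms by (simp add: divide_less_eq_1)
  next
    fix v :: real assume v: "v \<in> {0<..<1}"
    define t where "t = r * sqrt (v / (1 - v))"
    have "t\<^sup>2 = r\<^sup>2 * (v / (1 - v))" using v by (simp add: t_def power_mult_distrib)
    hence "t\<^sup>2 + r\<^sup>2 = r\<^sup>2 / (1 - v)" using v by (simp add: field_simps)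
    hence "?g t = v" using \<open>t\<^sup>2 = _\<close> v assms by (simp add: field_simps)
    moreover have "t > 0" using v assms by (simp add: t_def)
    ultimately show "v \<in> ?g ` {0<..}" by (intro image_eqI[of _ _ t]) auto
  qed
  have inj: "inj_on ?g {0<..}"
  proof (rule inj_onI)
    fix x y assume xy: "x \<in> {0<..}" "y \<in> {0<..}" "?g x = ?g y"
    hence "x\<^sup>2 * r\<^sup>2 = y\<^sup>2 * r\<^sup>2" using pos[of x] pos[of y] by (simp add: field_simps)
    hence "x\<^sup>2 = y\<^sup>2" using assms by simp
    thus "x = y" using xy by (simp add: power2_eq_iff)
  qed
  have deriv: "(?g has_field_derivative ?g' t) (at t within {0<..})" for t
    using pos[of t] by (auto intro!: derivative_eq_intros simp: field_simps power2_eq_square)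
  have ai: "?f absolutely_integrable_on {0<..<1}"
    using B by (intro nonnegative_absolutely_integrable_1) (auto simp: integrable_on_def)
  have "?f absolutely_integrable_on ?g ` {0<..} \<and> integral (?g ` {0<..}) ?f = Beta a b"
    using ai B by (auto simp: img integral_unique)
  hence "(\<lambda>t. \<bar>?g' t\<bar> *\<^sub>R ?f (?g t)) absolutely_integrable_on {0<..} \<and>
      integral {0<..} (\<lambda>t. \<bar>?g' t\<bar> *\<^sub>R ?f (?g t)) = Beta a b"
    by (subst has_absolute_integral_change_of_variables_real) (use inj deriv in auto)
  hence "((\<lambda>t. \<bar>?g' t\<bar> *\<^sub>R ?f (?g t)) has_integral Beta a b) {0<..}"
    by (rule has_integral_of_absolutely)
  hence "((\<lambda>t. (r powr (s - 1) / 2) * (\<bar>?g' t\<bar> *\<^sub>R ?f (?g t))) has_integral (r powr (s - 1) / 2) * Beta a b) {0<..}"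
    by (rule has_integral_mult_right)
  moreover have "(r powr (s - 1) / 2) * Beta a b = r powr (s - 1) * (pi / (2 * cos (pi * s / 2)))"
    unfolding a_def b_def using Beta_complementary[OF assms(1,2)] by simp
  ultimately have "((\<lambda>t. (r powr (s - 1) / 2) * (\<bar>?g' t\<bar> *\<^sub>R ?f (?g t))) has_integral
     r powr (s - 1) * (pi / (2 * cos (pi * s / 2)))) {0<..}" by (simp only:)
  thus ?thesis
  proof (elim has_integral_eq[rotated])
    fix t :: real assume t: "t \<in> {0<..}"
    define D where "D = t\<^sup>2 + r\<^sup>2"
    have D: "D > 0" using pos by (simp add: D_def)
    have "1 - t\<^sup>2 / D = (D - t\<^sup>2) / D" using D by (simp add: diff_divide_distrib)
    hence "1 - ?g t = r\<^sup>2 / D" by (simp add: D_def)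
    hence "?f (?g t) = (t\<^sup>2 / D) powr (a - 1) * (r\<^sup>2 / D) powr (b - 1)" by (simp add: D_def)
    also have "\<dots> = (t\<^sup>2 powr (a - 1) * r\<^sup>2 powr (b - 1)) / (D powr (a - 1) * D powr (b - 1))"
      using D by (simp add: powr_divide)
    also have "D powr (a - 1) * D powr (b - 1) = 1 / D"
    proof -
      have "a - 1 + (b - 1) = -1" by (simp add: a_def b_def field_simps)
      hence "D powr (a - 1) * D powr (b - 1) = D powr (-1)" by (simp flip: powr_add)
      also have "\<dots> = 1 / D" using D by (simp add: powr_minus_divide)
      finally show ?thesis .
    qed
    also have "t\<^sup>2 powr (a - 1) = t powr s / t"
    proof -
      have "t\<^sup>2 = t powr 2" using t by simp
      hence "t\<^sup>2 powr (a - 1) = t powr (2 * (a - 1))" by (simp add: powr_powr)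
      also have "2 * (a - 1) = s - 1" by (simp add: a_def field_simps)
      finally show ?thesis using t by (simp add: powr_diff)
    qed
    also have "r\<^sup>2 powr (b - 1) = r powr (-s) / r"
    proof -
      have "r\<^sup>2 = r powr 2" using assms by simp
      hence "r\<^sup>2 powr (b - 1) = r powr (2 * (b - 1))" by (simp add: powr_powr)
      also have "2 * (b - 1) = -s - 1" by (simp add: b_def field_simps)
      finally show ?thesis using assms by (simp add: powr_diff)
    qed
    finally have f: "?f (?g t) = (t powr s / t) * (r powr (-s) / r) * D" by simp
    have "r powr (s - 1) * r powr (-s) = 1 / r"
      using assms by (simp add: powr_diff powr_minus)
    hence r: "r powr (s - 1) * (r powr (-s) * X) = X / r" for X
      by (metis mult.assoc mult.commute mult.right_neutral times_divide_eq_right)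
    have "(r powr (s - 1) / 2) * (\<bar>?g' t\<bar> *\<^sub>R ?f (?g t)) =
       (r powr (s - 1) / 2) * ((2 * t * r\<^sup>2 / D\<^sup>2) * ((t powr s / t) * (r powr (-s) / r) * D))"
      unfolding f using t assms D by (simp add: D_def)
    also have "\<dots> = r powr (s - 1) * (r powr (-s) * (r * t powr s / D))"
      using t D assms by (simp add: field_simps power2_eq_square)
    also have "\<dots> = t powr s / (t\<^sup>2 + r\<^sup>2)" unfolding r using assms by (simp add: D_def)
    finally show "(r powr (s - 1) / 2) * (\<bar>?g' t\<bar> *\<^sub>R ?f (?g t)) = t powr s / (t\<^sup>2 + r\<^sup>2)" .
  qed
qed

text \<open>The logarithmic derivative of the reflection formula of the Gamma function.\<close>
lemma Digamma_reflection:
  fixes z :: complex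
  assumes "z \<notin> \<int>"
  shows "Digamma (1 - z) - Digamma z = of_real pi * cot (of_real pi * z)"
proof -
  have z: "z \<notin> \<int>\<^sub>\<le>\<^sub>0" "1 - z \<notin> \<int>\<^sub>\<le>\<^sub>0"
    using assms Ints_diff[of 1 "1 - z"] by (auto dest: nonpos_Ints_subset_Ints [THEN subsetD])
  have sin0: "sin (of_real pi * w) \<noteq> 0" if "w \<notin> \<int>" for w :: complex
    using that by (subst sin_eq_0) auto
  let ?G = "\<lambda>z::complex. Gamma z * Gamma (1 - z)"
  have "(?G has_field_derivative ?G z * (Digamma z - Digamma (1 - z))) (at z)"
    using z by (auto intro!: derivative_eq_intros simp: algebra_simps)
  moreover have "(?G has_field_derivative - (of_real pi * (of_real pi * cos (of_real pi * z))) / (sin (of_real pi * z))\<^sup>2) (at z)"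
    unfolding Gamma_reflection_complex using sin0[OF assms]
    by (auto intro!: derivative_eq_intros simp: field_simps power2_eq_square)
  ultimately have "?G z * (Digamma z - Digamma (1 - z)) = - (of_real pi * (of_real pi * cos (of_real pi * z))) / (sin (of_real pi * z))\<^sup>2"
    by (rule DERIV_unique)
  hence "(of_real pi / sin (of_real pi * z)) *
     (Digamma (1 - z) - Digamma z - of_real pi * (cos (of_real pi * z) / sin (of_real pi * z))) = 0"
    unfolding Gamma_reflection_complex by (simp add: algebra_simps power2_eq_square)
  thus ?thesis using sin0[OF assms] by (simp add: cot_def)
qed

text \<open>The sum of a geometric series is a cotangent, hence a difference of two Digamma values; the limit
  formula of the latter provides the partial fractions.\<close>
lemma geometric_eq_Digamma:
  fixes z :: complex
  assumes "z \<notin> \<int>" and w: "w = exp (2 * of_real pi * \<i> * z)"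
  shows "w / (1 - w) = -1/2 + \<i> / (2 * of_real pi) * (Digamma (1 - z) - Digamma z)"
proof -
  define e where "e = exp (\<i> * (of_real pi * z))"
  have sin0: "sin (of_real pi * z) \<noteq> 0"
    using assms by (subst sin_eq_0) auto
  have e0: "e \<noteq> 0" by (simp add: e_def)
  have we: "w = e * e" by (simp add: w e_def mult_ac flip: exp_add)
  have s: "sin (of_real pi * z) = (e - 1 / e) / (2 * \<i>)"
    by (simp add: sin_exp_eq e_def exp_minus field_simps)
  have c: "cos (of_real pi * z) = (e + 1 / e) / 2"
    by (simp add: cos_exp_eq e_def exp_minus field_simps)
  have ne: "e * e \<noteq> 1" using sin0 e0 unfolding s by (auto simp: field_simps)
  have "\<i> / (2 * of_real pi) * (Digamma (1 - z) - Digamma z) = \<i> / 2 * cot (of_real pi * z)"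
    unfolding Digamma_reflection[OF assms(1)] by simp
  also have "\<dots> = - (e + 1 / e) / (2 * (e - 1 / e))"
    unfolding cot_def s c using e0 ne by (simp add: field_simps)
  also have "\<dots> = 1/2 + w / (1 - w)"
    unfolding we using e0 ne by (simp add: field_simps)
  finally show ?thesis by simp
qed

lemma Digamma_cnj_sums:
  assumes "y > 0"
  shows "(\<lambda>m. - (2 * \<i> * of_real (\<eta> / ((real m + y)\<^sup>2 + \<eta>\<^sup>2)))) sums
     (Digamma (Complex y (-\<eta>)) - Digamma (Complex y \<eta>))"
proof -
  have ne: "Complex y (-\<eta>) \<noteq> 0" "Complex y \<eta> \<noteq> 0" using assms by (auto simp: complex_eq_iff)
  have "(\<lambda>N. (\<Sum>m<N. - (2 * \<i> * of_real (\<eta> / ((real m + y)\<^sup>2 + \<eta>\<^sup>2))))) = (\<lambda>N.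
     (of_real (ln (real N)) - (\<Sum>n<N. inverse (Complex y (-\<eta>) + of_nat n))) -
     (of_real (ln (real N)) - (\<Sum>n<N. inverse (Complex y \<eta> + of_nat n))))"
  proof
    fix N
    have "- (2 * \<i> * of_real (\<eta> / ((real m + y)\<^sup>2 + \<eta>\<^sup>2))) =
      inverse (Complex y \<eta> + of_nat m) - inverse (Complex y (-\<eta>) + of_nat m)" for m
    proof -
      have "(real m + y)\<^sup>2 + \<eta>\<^sup>2 > 0" using assms by (intro add_pos_nonneg) auto
      moreover have "Complex y \<eta> + of_nat m = Complex (real m + y) \<eta>"
        "Complex y (-\<eta>) + of_nat m = Complex (real m + y) (-\<eta>)"
        by (simp_all add: complex_eq_iff)
      ultimately show ?thesis
        by (simp only: complex_inverse) (simp add: complex_eq_iff)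
    qed
    thus "(\<Sum>m<N. - (2 * \<i> * of_real (\<eta> / ((real m + y)\<^sup>2 + \<eta>\<^sup>2)))) =
     (of_real (ln (real N)) - (\<Sum>n<N. inverse (Complex y (-\<eta>) + of_nat n))) -
     (of_real (ln (real N)) - (\<Sum>n<N. inverse (Complex y \<eta> + of_nat n)))"
      by (simp add: sum_subtractf)
  qed
  thus ?thesis unfolding sums_def
    using tendsto_diff[OF Digamma_LIMSEQ[OF ne(1)] Digamma_LIMSEQ[OF ne(2)]] by simp
qed

section \<open>The functional equation\<close>

context even_char
begin

abbreviation bar_block :: "(nat \<Rightarrow> complex) \<Rightarrow> nat \<Rightarrow> complex" where
  "bar_block \<equiv> char_block (\<lambda>n. cnj (\<psi> n)) q"

lemma bar: "even_char q (\<lambda>n. cnj (\<psi> n))"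
  by (rule even_char_cnj) unfold_locales

lemma bar_sum_zero: "(\<Sum>a\<in>{1..<q}. cnj (\<psi> (int a))) = 0"
  by (rule even_char.sum_zero[OF bar])

text \<open>The Gauss sum expands \<open>\<psi>(n)\<close> in the powers \<open>unity (a n)\<close>, which leaves geometric series.\<close>
lemma gauss_exp_series:
  assumes t: "t > 0"
  shows "(\<lambda>n. \<psi> (int (Suc n)) * of_real (exp (- real (Suc n) * t))) sums
     ((\<Sum>a\<in>{1..<q}. cnj (\<psi> (int a)) * (unity a * exp (-t) / (1 - unity a * exp (-t)))) / gauss)"
proof -
  define w where "w a = unity a * of_real (exp (-t))" for a
  have u: "norm (unity a) = 1" for a
    by (simp add: unity_def norm_exp)
  have nw: "norm (w a) < 1" for a using t by (simp add: w_def norm_mult u)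
  have "(\<lambda>n. w a ^ Suc n) sums (w a / (1 - w a))" for a
    using sums_mult[OF geometric_sums[OF nw[of a]], of "w a"] by (simp add: field_simps)
  hence "(\<lambda>n. \<Sum>a\<in>{1..<q}. cnj (\<psi> (int a)) * w a ^ Suc n) sums (\<Sum>a\<in>{1..<q}. cnj (\<psi> (int a)) * (w a / (1 - w a)))"
    by (intro sums_sum sums_mult)
  hence "(\<lambda>n. (\<Sum>a\<in>{1..<q}. cnj (\<psi> (int a)) * w a ^ Suc n) / gauss) sums ((\<Sum>a\<in>{1..<q}. cnj (\<psi> (int a)) * (w a / (1 - w a))) / gauss)"
    by (rule sums_divide)
  moreover have "(\<Sum>a\<in>{1..<q}. cnj (\<psi> (int a)) * w a ^ Suc n) / gauss = \<psi> (int (Suc n)) * of_real (exp (- real (Suc n) * t))" for n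
  proof -
    have "w a ^ Suc n = unity (a * Suc n) * of_real (exp (- real (Suc n) * t))" for a
    proof -
      have "exp (-t) ^ Suc n = exp (- real (Suc n) * t)"
        by (subst exp_of_nat_mult [symmetric]) (simp add: algebra_simps)
      thus ?thesis by (simp only: w_def power_mult_distrib unity_power flip: of_real_power)
    qed
    hence "(\<Sum>a\<in>{1..<q}. cnj (\<psi> (int a)) * w a ^ Suc n) =
      (\<Sum>a\<in>{1..<q}. cnj (\<psi> (int a)) * unity (a * Suc n)) * of_real (exp (- real (Suc n) * t))"
      by (simp only: sum_distrib_right mult.assoc)
    thus ?thesis using gauss_nonzero by (simp only: gauss_sum) simp
  qed
  ultimately show ?thesis by (simp add: w_def)
qed

text \<open>The geometric series above are values of the cotangent at \<open>a/q + i t / (2 \<pi>)\<close>. The constants cancel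
  as the character is non-trivial, and evenness combines the two Digamma values into a conjugate pair.\<close>
lemma exp_kernel_transform:
  assumes t: "t > 0"
  obtains g where "block (\<lambda>n. of_real (exp (- real n * t))) sums g"
    "bar_block (\<lambda>n. of_real (t / ((real q * t)\<^sup>2 + (2 * pi * real n)\<^sup>2))) sums (gauss * g / (2 * (of_nat q)\<^sup>2))"
proof -
  define \<eta> where "\<eta> = t / (2 * pi)"
  have \<eta>: "\<eta> > 0" using t by (simp add: \<eta>_def)
  define z where "z a = Complex (real a / real q) \<eta>" for a
  define w where "w a = unity a * exp (-t)" for a
  define g where "g = (\<Sum>a\<in>{1..<q}. cnj (\<psi> (int a)) * (w a / (1 - w a))) / gauss"
  have "block (\<lambda>n. of_real (exp (- real n * t))) sums g"
    using sums_block[OF gauss_exp_series[OF t]] by (simp only: g_def w_def)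
  moreover have "bar_block (\<lambda>n. of_real (t / ((real q * t)\<^sup>2 + (2 * pi * real n)\<^sup>2))) sums (gauss * g / (2 * (of_nat q)\<^sup>2))"
  proof -
    have zn: "z a \<notin> \<int>" for a
      using \<eta> by (auto simp: z_def complex_is_Int_iff)
    have wz: "w a = exp (2 * of_real pi * \<i> * z a)" for a
    proof -
      have "2 * of_real pi * \<i> * z a = 2 * of_real pi * \<i> * of_nat a / of_nat q + of_real (-t)"
        by (simp add: z_def \<eta>_def complex_eq_iff)
      thus ?thesis by (simp only: exp_add w_def unity_def exp_of_real)
    qed
    have "gauss * g = (\<Sum>a\<in>{1..<q}. cnj (\<psi> (int a)) * (w a / (1 - w a)))"
      using gauss_nonzero by (simp add: g_def)
    also have "\<dots> = (\<Sum>a\<in>{1..<q}. cnj (\<psi> (int a)) * (-1/2) +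
       \<i> / (2 * of_real pi) * (cnj (\<psi> (int a)) * Digamma (1 - z a)) - \<i> / (2 * of_real pi) * (cnj (\<psi> (int a)) * Digamma (z a)))"
      by (intro sum.cong refl) (subst geometric_eq_Digamma[OF zn wz], simp add: algebra_simps)
    also have "\<dots> = (\<Sum>a\<in>{1..<q}. cnj (\<psi> (int a))) * (-1/2) +
       \<i> / (2 * of_real pi) * ((\<Sum>a\<in>{1..<q}. cnj (\<psi> (int a)) * Digamma (1 - z a)) - (\<Sum>a\<in>{1..<q}. cnj (\<psi> (int a)) * Digamma (z a)))"
      by (simp only: sum_distrib_right sum_distrib_left sum.distrib sum_subtractf right_diff_distrib add_diff_eq)
    also have "(\<Sum>a\<in>{1..<q}. cnj (\<psi> (int a)) * Digamma (1 - z a)) = (\<Sum>a\<in>{1..<q}. cnj (\<psi> (int a)) * Digamma (cnj (z a)))"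
    proof -
      have "(\<Sum>a\<in>{1..<q}. cnj (\<psi> (int a)) * Digamma (1 - z a)) = (\<Sum>a\<in>{1..<q}. cnj (\<psi> (int a)) * Digamma (cnj (z (q - a))))"
      proof (intro sum.cong refl)
        fix a assume "a \<in> {1..<q}"
        hence "1 - z a = cnj (z (q - a))"
          by (simp add: z_def complex_eq_iff of_nat_diff field_simps)
        thus "cnj (\<psi> (int a)) * Digamma (1 - z a) = cnj (\<psi> (int a)) * Digamma (cnj (z (q - a)))" by simp
      qed
      also have "\<dots> = (\<Sum>a\<in>{1..<q}. cnj (\<psi> (int a)) * Digamma (cnj (z a)))"
        by (rule even_char.sum_reflect[OF bar])
      finally show ?thesis .
    qed
    also have "(\<Sum>a\<in>{1..<q}. cnj (\<psi> (int a)) * Digamma (cnj (z a))) - (\<Sum>a\<in>{1..<q}. cnj (\<psi> (int a)) * Digamma (z a)) =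
      (\<Sum>a\<in>{1..<q}. cnj (\<psi> (int a)) * (Digamma (cnj (z a)) - Digamma (z a)))"
      by (simp only: sum_subtractf right_diff_distrib)
    finally have eq: "gauss * g / (2 * (of_nat q)\<^sup>2) =
      (\<Sum>a\<in>{1..<q}. cnj (\<psi> (int a)) * (Digamma (cnj (z a)) - Digamma (z a))) * (\<i> / (2 * of_real pi) / (2 * (of_nat q)\<^sup>2))"
      by (simp only: bar_sum_zero) simp
    have "(\<lambda>m. - (2 * \<i> * of_real (\<eta> / ((real m + real a / real q)\<^sup>2 + \<eta>\<^sup>2)))) sums (Digamma (cnj (z a)) - Digamma (z a))"
      if "a \<in> {1..<q}" for a
      using Digamma_cnj_sums[of "real a / real q" \<eta>] that by (simp add: z_def complex_cnj)
    hence "(\<lambda>m. (\<Sum>a\<in>{1..<q}. cnj (\<psi> (int a)) * - (2 * \<i> * of_real (\<eta> / ((real m + real a / real q)\<^sup>2 + \<eta>\<^sup>2)))) * (\<i> / (2 * of_real pi) / (2 * (of_nat q)\<^sup>2)))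
       sums (gauss * g / (2 * (of_nat q)\<^sup>2))"
      unfolding eq by (intro sums_mult2 sums_sum sums_mult)
    moreover have "(\<Sum>a\<in>{1..<q}. cnj (\<psi> (int a)) * - (2 * \<i> * of_real (\<eta> / ((real m + real a / real q)\<^sup>2 + \<eta>\<^sup>2)))) * (\<i> / (2 * of_real pi) / (2 * (of_nat q)\<^sup>2)) =
       bar_block (\<lambda>n. of_real (t / ((real q * t)\<^sup>2 + (2 * pi * real n)\<^sup>2))) m" for m
      unfolding char_block_def sum_distrib_right
    proof (intro sum.cong refl)
      fix a assume "a \<in> {1..<q}"
      define A where "A = (real q * t)\<^sup>2 + (2 * pi * real (q * m + a))\<^sup>2"
      have "(real m + real a / real q)\<^sup>2 + \<eta>\<^sup>2 = A / (2 * pi * real q)\<^sup>2"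
        using q_pos by (simp add: A_def \<eta>_def field_simps power2_eq_square)
      hence "\<eta> / ((real m + real a / real q)\<^sup>2 + \<eta>\<^sup>2) = (2 * pi * (real q)\<^sup>2) * (t / A)"
        by (simp add: \<eta>_def field_simps power2_eq_square)
      thus "cnj (\<psi> (int a)) * - (2 * \<i> * of_real (\<eta> / ((real m + real a / real q)\<^sup>2 + \<eta>\<^sup>2))) * (\<i> / (2 * of_real pi) / (2 * (of_nat q)\<^sup>2)) =
        cnj (\<psi> (int a)) * of_real (t / ((real q * t)\<^sup>2 + (2 * pi * real (q * m + a))\<^sup>2))"
        unfolding A_def [symmetric] using q_pos by (simp only: of_real_mult) (simp add: field_simps)
    qed
    ultimately show ?thesis by simp
  qed
  ultimately show ?thesis by (rule that)
qed

text \<open>Termwise integration of a block sum against a weight, for a kernel that decreases in \<open>n\<close>: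
  the partial sums are dominated by the first term.\<close>
lemma block_has_integral:
  fixes k :: "nat \<Rightarrow> real \<Rightarrow> real" and w :: "real \<Rightarrow> real"
  assumes dec: "\<And>t m n. t > 0 \<Longrightarrow> 0 < m \<Longrightarrow> m \<le> n \<Longrightarrow> k n t \<le> k m t"
    and nonneg: "\<And>t n. t > 0 \<Longrightarrow> k n t \<ge> 0" "\<And>t. t > 0 \<Longrightarrow> w t \<ge> 0"
    and int: "\<And>n. n > 0 \<Longrightarrow> ((\<lambda>t. w t * k n t) has_integral I n) {0<..}"
    and H: "\<And>t. t > 0 \<Longrightarrow> block (\<lambda>n. of_real (k n t)) sums H t"
    and J: "block (\<lambda>n. of_real (I n)) sums J"
  shows "((\<lambda>t. of_real (w t) * H t) has_integral J) {0<..}"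
proof (rule has_integral_dominated_convergence)
  show "((\<lambda>t. of_real (w t) * (\<Sum>m<N. block (\<lambda>n. of_real (k n t)) m)) has_integral (\<Sum>m<N. block (\<lambda>n. of_real (I n)) m)) {0<..}" for N
  proof -
    have "((\<lambda>t. \<Sum>m<N. \<Sum>a\<in>{1..<q}. \<psi> (int a) * of_real (w t * k (q * m + a) t)) has_integral
       (\<Sum>m<N. \<Sum>a\<in>{1..<q}. \<psi> (int a) * of_real (I (q * m + a)))) {0<..}"
      by (intro has_integral_sum has_integral_mult_right has_integral_of_real int) auto
    thus ?thesis by (simp add: char_block_def sum_distrib_left mult_ac)
  qed
  show "(\<lambda>t. q * (w t * k 1 t)) integrable_on {0<..}"
    using has_integral_mult_right[OF int[of 1]] by (auto simp: integrable_on_def)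
  show "\<forall>t\<in>{0<..}. norm (of_real (w t) * (\<Sum>m<N. block (\<lambda>n. of_real (k n t)) m)) \<le> q * (w t * k 1 t)" for N
  proof
    fix t :: real assume t: "t \<in> {0<..}"
    have "norm (\<Sum>m<N. block (\<lambda>n. of_real (k n t)) m) \<le> q * k 1 t"
      using t dec nonneg by (intro norm_sum_blocks_le) auto
    hence "w t * norm (\<Sum>m<N. block (\<lambda>n. of_real (k n t)) m) \<le> w t * (q * k 1 t)"
      using nonneg t by (intro mult_left_mono) auto
    thus "norm (of_real (w t) * (\<Sum>m<N. block (\<lambda>n. of_real (k n t)) m)) \<le> q * (w t * k 1 t)"
      using nonneg t by (simp add: norm_mult mult_ac)
  qed
  show "\<forall>t\<in>{0<..}. (\<lambda>N. of_real (w t) * (\<Sum>m<N. block (\<lambda>n. of_real (k n t)) m)) \<longlonglongrightarrow> of_real (w t) * H t"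
    using H by (auto intro!: tendsto_mult simp: sums_def)
  show "(\<lambda>N. \<Sum>m<N. block (\<lambda>n. of_real (I n)) m) \<longlonglongrightarrow> J"
    using J by (simp add: sums_def)
qed

abbreviation bar_L :: "complex \<Rightarrow> complex" where
  "bar_L \<equiv> block_L (\<lambda>n. cnj (\<psi> n)) q"

text \<open>The two evaluations of one Mellin transform.\<close>
lemma functional_equation_real:
  assumes s: "0 < s" "s < 1"
  shows "gauss * of_real (Gamma s) * L (of_real s) =
    of_real (pi * (2 * pi / q) powr (s - 1) / cos (pi * s / 2)) * bar_L (1 - of_real s)"
proof -
  interpret B: even_char q "\<lambda>n. cnj (\<psi> n)" by (rule bar)
  have "\<exists>g. block (\<lambda>n. of_real (exp (- real n * t))) sums g \<and>
    bar_block (\<lambda>n. of_real (t / ((real q * t)\<^sup>2 + (2 * pi * real n)\<^sup>2))) sums (gauss * g / (2 * (of_nat q)\<^sup>2))" if "t > 0" for t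
    using exp_kernel_transform[OF that] by blast
  then obtain g where g: "\<And>t. t > 0 \<Longrightarrow> block (\<lambda>n. of_real (exp (- real n * t))) sums g t"
    "\<And>t. t > 0 \<Longrightarrow> bar_block (\<lambda>n. of_real (t / ((real q * t)\<^sup>2 + (2 * pi * real n)\<^sup>2))) sums (gauss * g t / (2 * (of_nat q)\<^sup>2))"
    by metis
  have powr: "of_nat n powr (- of_real x) = complex_of_real (real n powr (- x))" for n x
    using powr_of_real[of "real n" "-x"] by simp
  have I1: "((\<lambda>t. of_real (t powr (s - 1)) * g t) has_integral of_real (Gamma s) * L (of_real s)) {0<..}"
  proof (rule block_has_integral[where k = "\<lambda>n t. exp (- real n * t)" and I = "\<lambda>n. Gamma s * real n powr (-s)"])
    show "((\<lambda>t. t powr (s - 1) * exp (- real n * t)) has_integral Gamma s * real n powr - s) {0<..}" if "n > 0" for n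
      using has_integral_Gamma_scaled[OF s(1), of "real n"] that by simp
    have "(\<lambda>m. of_real (Gamma s) * block (\<lambda>n. of_nat n powr (- of_real s)) m) sums (of_real (Gamma s) * L (of_real s))"
      using s by (intro sums_mult L_sums) auto
    thus "block (\<lambda>n. of_real (Gamma s * real n powr - s)) sums (of_real (Gamma s) * L (of_real s))"
      by (simp only: powr of_real_mult) (simp add: char_block_def [abs_def] sum_distrib_left mult_ac)
  qed (use g in auto)
  define K where "K = (2 * pi / q) powr (s - 1) * (pi / (2 * cos (pi * s / 2))) / (real q)\<^sup>2"
  have I2: "((\<lambda>t. of_real (t powr (s - 1)) * (gauss * g t / (2 * (of_nat q)\<^sup>2))) has_integral of_real K * bar_L (1 - of_real s)) {0<..}"
  proof (rule B.block_has_integral[where k = "\<lambda>n t. t / ((real q * t)\<^sup>2 + (2 * pi * real n)\<^sup>2)" and I = "\<lambda>n. K * real n powr (s - 1)"])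
    show "((\<lambda>t. t powr (s - 1) * (t / ((real q * t)\<^sup>2 + (2 * pi * real n)\<^sup>2))) has_integral K * real n powr (s - 1)) {0<..}" if "n > 0" for n
    proof -
      define r where "r = 2 * pi / q * real n"
      have r: "r > 0" using that q_pos by (simp add: r_def)
      have "((\<lambda>t. (1 / (real q)\<^sup>2) * (t powr s / (t\<^sup>2 + r\<^sup>2))) has_integral (1 / (real q)\<^sup>2) * (r powr (s - 1) * (pi / (2 * cos (pi * s / 2))))) {0<..}"
        by (intro has_integral_mult_right has_integral_powr_over_quadratic s r)
      moreover have "(1 / (real q)\<^sup>2) * (r powr (s - 1) * (pi / (2 * cos (pi * s / 2)))) = K * real n powr (s - 1)"
          by (simp only: K_def r_def powr_mult) (simp add: powr_mult mult_ac)
      ultimately have "((\<lambda>t. (1 / (real q)\<^sup>2) * (t powr s / (t\<^sup>2 + r\<^sup>2))) has_integral K * real n powr (s - 1)) {0<..}" by simp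
      thus ?thesis
      proof (elim has_integral_eq[rotated])
        fix t :: real assume "t \<in> {0<..}"
        moreover have "(real q * t)\<^sup>2 + (2 * pi * real n)\<^sup>2 = (real q)\<^sup>2 * (t\<^sup>2 + r\<^sup>2)"
          using q_pos by (simp add: r_def field_simps power2_eq_square)
        ultimately show "(1 / (real q)\<^sup>2) * (t powr s / (t\<^sup>2 + r\<^sup>2)) = t powr (s - 1) * (t / ((real q * t)\<^sup>2 + (2 * pi * real n)\<^sup>2))"
          by (simp add: powr_diff)
      qed
    qed
    have "(\<lambda>m. of_real K * bar_block (\<lambda>n. of_nat n powr (- of_real (1 - s))) m) sums (of_real K * bar_L (of_real (1 - s)))"
      using s by (intro sums_mult B.L_sums) auto
    thus "bar_block (\<lambda>n. of_real (K * real n powr (s - 1))) sums (of_real K * bar_L (1 - of_real s))"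
      by (simp only: powr of_real_mult) (simp add: char_block_def [abs_def] sum_distrib_left mult_ac)
    show "t / ((real q * t)\<^sup>2 + (2 * pi * real n)\<^sup>2) \<le> t / ((real q * t)\<^sup>2 + (2 * pi * real m)\<^sup>2)"
      if "t > 0" "0 < m" "m \<le> n" for t m n
      using that by (intro divide_left_mono add_left_mono power_mono mult_left_mono mult_pos_pos add_nonneg_pos) auto
  qed (use g in auto)
  have "((\<lambda>t. gauss / (2 * (of_nat q)\<^sup>2) * (of_real (t powr (s - 1)) * g t)) has_integral
     gauss / (2 * (of_nat q)\<^sup>2) * (of_real (Gamma s) * L (of_real s))) {0<..}"
    by (rule has_integral_mult_right[OF I1])
  hence "((\<lambda>t. of_real (t powr (s - 1)) * (gauss * g t / (2 * (of_nat q)\<^sup>2))) has_integral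
     gauss / (2 * (of_nat q)\<^sup>2) * (of_real (Gamma s) * L (of_real s))) {0<..}"
    by (simp add: mult_ac)
  from has_integral_unique[OF this I2] have eq: "gauss / (2 * (of_nat q)\<^sup>2) * (of_real (Gamma s) * L (of_real s)) =
    of_real K * bar_L (1 - of_real s)" .
  have "gauss * of_real (Gamma s) * L (of_real s) = (2 * (of_nat q)\<^sup>2) * (gauss / (2 * (of_nat q)\<^sup>2) * (of_real (Gamma s) * L (of_real s)))"
    using q_pos by simp
  also have "\<dots> = of_real (2 * (real q)\<^sup>2 * K) * bar_L (1 - of_real s)"
    unfolding eq by simp
  also have "2 * (real q)\<^sup>2 * K = pi * (2 * pi / q) powr (s - 1) / cos (pi * s / 2)"
    using q_pos by (simp add: K_def)
  finally show ?thesis .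
qed

end

section \<open>Expansion at the point 0\<close>

context even_char
begin

text \<open>One side of the functional equation in the variable \<open>u = 1 - s\<close>, without the factor
  \<open>sin (\<pi> u / 2)\<close>, which vanishes at \<open>0\<close>.\<close>
definition gamma_L :: "complex \<Rightarrow> complex" where
  "gamma_L u = gauss * Gamma (1 - u) * of_real (2 * pi / q) powr u * L (1 - u)"

lemma strip_Gamma_arg: "Re u < 1 \<Longrightarrow> 1 - u \<notin> \<int>\<^sub>\<le>\<^sub>0"
  by (auto elim!: nonpos_Ints_cases simp: complex_eq_iff)

lemma gamma_L_holomorphic: "gamma_L holomorphic_on {u. Re u < 1}"
proof -
  have "(L \<circ> (\<lambda>u. 1 - u)) holomorphic_on {u. Re u < 1}"
    by (rule holomorphic_on_compose_gen[OF _ L_holomorphic]) (auto intro!: holomorphic_intros)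
  hence "(\<lambda>u. L (1 - u)) holomorphic_on {u. Re u < 1}" by (simp add: o_def)
  moreover have "(\<lambda>u. Gamma (1 - u)) holomorphic_on {u. Re u < 1}"
    by (intro holomorphic_intros) (use strip_Gamma_arg in blast)
  ultimately show ?thesis
    unfolding gamma_L_def [abs_def] by (intro holomorphic_intros) (auto dest: strip_Gamma_arg)
qed

lemma functional_equation:
  assumes "-1 < Re u" "Re u < 1"
  shows "sin (of_real pi * u / 2) * gamma_L u = of_real pi * bar_L u"
proof -
  interpret B: even_char q "\<lambda>n. cnj (\<psi> n)" by (rule bar)
  let ?D = "{u. -1 < Re u} \<inter> {u. Re u < 1}"
  let ?F = "\<lambda>u. sin (of_real pi * u / 2) * gamma_L u - of_real pi * bar_L u"
  let ?U = "(of_real :: real \<Rightarrow> complex) ` {0<..<1}"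
  have "?F u = 0"
  proof (rule analytic_continuation[of ?F ?D ?U "of_real (1/2)"])
    show "?F holomorphic_on ?D"
      by (intro holomorphic_intros holomorphic_on_subset[OF gamma_L_holomorphic] holomorphic_on_subset[OF B.L_holomorphic]) auto
    show "open ?D" by (intro open_Int open_halfspace_Re_gt open_halfspace_Re_lt)
    show "connected ?D" by (intro convex_connected convex_Int convex_halfspace_Re_gt convex_halfspace_Re_lt)
    show "?U \<subseteq> ?D" by auto
    show "of_real (1/2) \<in> ?D" by simp
    show "u \<in> ?D" using assms by simp
    show "of_real (1/2) islimpt ?U"
      unfolding islimpt_approachable
    proof (intro allI impI)
      fix e :: real assume e: "e > 0"
      define d where "d = min (e / 2) (1 / 4)"
      have d: "d > 0" "d < e" "d < 1/2" using e by (auto simp: d_def min_def)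
      have "dist (of_real (1/2 + d)) (of_real (1/2) :: complex) < e"
        unfolding dist_of_real using d by (simp add: dist_norm)
      thus "\<exists>x'\<in>?U. x' \<noteq> of_real (1/2) \<and> dist x' (of_real (1/2)) < e"
        using d by (intro bexI[of _ "of_real (1/2 + d)"] conjI imageI) (simp_all only: of_real_eq_iff, auto)
    qed
    fix z assume "z \<in> ?U"
    then obtain v where v: "0 < v" "v < 1" "z = of_real v" by auto
    define X where "X = 2 * pi / q"
    have X: "X > 0" using q_pos by (simp add: X_def)
    have sin0: "sin (pi * v / 2) > 0" using v by (intro sin_gt_zero) auto
    have cs: "cos (pi * (1 - v) / 2) = sin (pi * v / 2)"
      using cos_diff[of "pi / 2" "pi * v / 2"] by (simp add: field_simps)
    have FE: "gauss * of_real (Gamma (1 - v)) * L (of_real (1 - v)) =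
      of_real (pi * X powr (- v) / sin (pi * v / 2)) * bar_L (of_real v)"
      using functional_equation_real[of "1 - v"] v cs by (simp add: X_def)
    have "sin (of_real pi * z / 2) * gamma_L z = of_real (sin (pi * v / 2) * X powr v) * (gauss * of_real (Gamma (1 - v)) * L (of_real (1 - v)))"
    proof -
      have "sin (of_real pi * z / 2) = of_real (sin (pi * v / 2))"
        using sin_of_real[of "pi * v / 2", where 'a = complex] by (simp add: v)
      moreover have "Gamma (1 - z) = of_real (Gamma (1 - v))"
        using Gamma_complex_of_real[of "1 - v"] by (simp add: v)
      moreover have "of_real X powr z = complex_of_real (X powr v)"
        using powr_of_real[of X v] X v by simp
      moreover have "gamma_L z = gauss * Gamma (1 - z) * of_real X powr z * L (1 - z)"
        by (simp only: gamma_L_def X_def)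
      ultimately show ?thesis by (simp add: v mult_ac)
    qed
    also have "\<dots> = of_real ((sin (pi * v / 2) * X powr v) * (pi * X powr (- v) / sin (pi * v / 2))) * bar_L z"
      unfolding FE by (simp add: v)
    also have "(sin (pi * v / 2) * X powr v) * (pi * X powr (- v) / sin (pi * v / 2)) = pi"
      using sin0 X by (simp add: powr_minus field_simps)
    finally show "?F z = 0" by simp
  qed
  thus ?thesis by simp
qed

lemma gamma_L_0: "gamma_L 0 = gauss * L 1"
  using q_pos by (simp add: gamma_L_def)

lemma deriv_gamma_L_0:
  "(gamma_L has_field_derivative
     gauss * ((of_real (euler_mascheroni + ln (2 * pi / q))) * L 1 - deriv L 1)) (at 0)"
proof -
  define X where "X = 2 * pi / q"
  have X: "X > 0" using q_pos by (simp add: X_def)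
  have L1: "(L has_field_derivative deriv L 1) (at 1)"
    by (rule holomorphic_derivI[OF L_holomorphic open_halfspace_Re_gt]) auto
  have d1: "((\<lambda>u. L (1 - u)) has_field_derivative deriv L 1 * (-1)) (at 0)"
    by (rule DERIV_chain2[of L]) (use L1 in \<open>auto intro!: derivative_eq_intros\<close>)
  have d2: "((\<lambda>u::complex. Gamma (1 - u)) has_field_derivative (Gamma 1 * Digamma 1) * (-1)) (at 0)"
    by (rule DERIV_chain2[of Gamma]) (auto intro!: derivative_eq_intros)
  have d3: "((\<lambda>u. complex_of_real X powr u) has_field_derivative of_real (ln X)) (at 0)"
    using has_field_derivative_powr_right[of "of_real X" 0] X by (simp add: Ln_of_real)
  have eq: "gamma_L u = gauss * (Gamma (1 - u) * (of_real X powr u * L (1 - u)))" for u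
    by (simp only: gamma_L_def X_def mult.assoc)
  show ?thesis
    unfolding eq [abs_def]
    unfolding X_def [symmetric]
    by (rule DERIV_cong[OF DERIV_cmult[OF DERIV_mult[OF d2 DERIV_mult[OF d3 d1]]]])
       (use X in \<open>simp add: algebra_simps\<close>)
qed

text \<open>The simple zero of the sine at \<open>0\<close> expresses the first two derivatives of the conjugate L-function
  at \<open>0\<close> by the value and the first derivative of \<open>L\<close> at \<open>1\<close>.\<close>
lemma bar_L_derivs_0:
  "deriv bar_L 0 = gauss * L 1 / 2"
  "(deriv ^^ 2) bar_L 0 = gauss * ((of_real (euler_mascheroni + ln (2 * pi / q))) * L 1 - deriv L 1)"
proof -
  let ?D = "{u. -1 < Re u} \<inter> {u. Re u < 1}"
  have D: "open ?D" by (intro open_Int open_halfspace_Re_gt open_halfspace_Re_lt)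
  have D0: "0 \<in> ?D" by simp
  let ?f = "\<lambda>u. (1/2) * (cos (of_real pi * u / 2) * gamma_L u) + (1 / of_real pi) * (sin (of_real pi * u / 2) * deriv gamma_L u)"
  have hol: "gamma_L holomorphic_on ?D" by (rule holomorphic_on_subset[OF gamma_L_holomorphic]) auto
  have hol': "deriv gamma_L holomorphic_on ?D" by (rule holomorphic_deriv[OF hol D])
  have s: "((\<lambda>u. sin (of_real pi * u / 2)) has_field_derivative (of_real pi / 2 * cos (of_real pi * u / 2))) (at u)" for u :: complex
    by (auto intro!: derivative_eq_intros)
  have c: "((\<lambda>u. cos (of_real pi * u / 2)) has_field_derivative (- of_real pi / 2 * sin (of_real pi * u / 2))) (at u)" for u :: complex
    by (auto intro!: derivative_eq_intros)
  have d1: "(bar_L has_field_derivative ?f u) (at u)" if u: "u \<in> ?D" for u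
  proof (rule has_field_derivative_transform_within_open[OF _ D u])
    have "((\<lambda>u. (1 / of_real pi) * (sin (of_real pi * u / 2) * gamma_L u)) has_field_derivative
      (1 / of_real pi) * ((of_real pi / 2 * cos (of_real pi * u / 2)) * gamma_L u + deriv gamma_L u * sin (of_real pi * u / 2))) (at u)"
      by (intro DERIV_cmult DERIV_mult s holomorphic_derivI[OF hol D u])
    thus "((\<lambda>u. (1 / of_real pi) * (sin (of_real pi * u / 2) * gamma_L u)) has_field_derivative ?f u) (at u)"
      by (rule DERIV_cong) (simp add: field_simps)
    show "(1 / of_real pi) * (sin (of_real pi * v / 2) * gamma_L v) = bar_L v" if "v \<in> ?D" for v
      using functional_equation[of v] that by simp
  qed
  have d: "deriv bar_L u = ?f u" if "u \<in> ?D" for u by (rule DERIV_imp_deriv[OF d1[OF that]])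
  show "deriv bar_L 0 = gauss * L 1 / 2" using d[OF D0] by (simp add: gamma_L_0)
  have "(deriv bar_L has_field_derivative deriv gamma_L 0) (at 0)"
  proof (rule has_field_derivative_transform_within_open[OF _ D D0])
    have "(?f has_field_derivative
      (1/2) * ((- of_real pi / 2 * sin (of_real pi * 0 / 2)) * gamma_L 0 + deriv gamma_L 0 * cos (of_real pi * 0 / 2))
      + (1 / of_real pi) * ((of_real pi / 2 * cos (of_real pi * 0 / 2)) * deriv gamma_L 0 + deriv (deriv gamma_L) 0 * sin (of_real pi * 0 / 2))) (at 0)"
      by (intro DERIV_add DERIV_cmult DERIV_mult s c holomorphic_derivI[OF hol D D0] holomorphic_derivI[OF hol' D D0])
    thus "(?f has_field_derivative deriv gamma_L 0) (at 0)"
      by (rule DERIV_cong) simp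
    show "?f v = deriv bar_L v" if "v \<in> ?D" for v using d[OF that] by simp
  qed
  hence "deriv (deriv bar_L) 0 = deriv gamma_L 0" by (rule DERIV_imp_deriv)
  also have "\<dots> = gauss * ((of_real (euler_mascheroni + ln (2 * pi / q))) * L 1 - deriv L 1)"
    by (rule DERIV_imp_deriv[OF deriv_gamma_L_0])
  finally show "(deriv ^^ 2) bar_L 0 = gauss * ((of_real (euler_mascheroni + ln (2 * pi / q))) * L 1 - deriv L 1)"
    by (simp add: numeral_2_eq_2)
qed

lemma ln_split: "a \<in> {1..<q} \<Longrightarrow> ln (real (q * m + a)) = ln (real q) + ln (real m + real a / real q)"
proof -
  assume a: "a \<in> {1..<q}"
  have "real (q * m + a) = real q * (real m + real a / real q)" using q_pos by (simp add: field_simps)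
  moreover have "real m + real a / real q > 0" using a q_pos by (intro add_nonneg_pos) auto
  ultimately show ?thesis using q_pos by (simp only: ln_mult_pos of_nat_0_less_iff)
qed

text \<open>The block sums of powers of \<open>log (m + a/q)\<close>.\<close>
definition ln_block :: "nat \<Rightarrow> nat \<Rightarrow> complex" where
  "ln_block k m = (\<Sum>a\<in>{1..<q}. \<psi> (int a) * of_real (ln (real m + real a / real q) ^ k))"

lemma ln_block_1_sums: "ln_block 1 sums (- deriv L 0)"
proof -
  have "(\<lambda>m. block (\<lambda>n. (- of_real (ln (real n))) ^ 1 * of_nat n powr (-0)) m) sums (deriv ^^ 1) L 0"
    by (rule L_higher_deriv_sums) auto
  from sums_minus[OF this]
  have "(\<lambda>m. - block (\<lambda>n. (- of_real (ln (real n))) ^ 1 * of_nat n powr (-0)) m) sums (- deriv L 0)" by simp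
  moreover have "- block (\<lambda>n. (- of_real (ln (real n))) ^ 1 * of_nat n powr (-0)) m = ln_block 1 m" for m
  proof -
    have "- block (\<lambda>n. (- of_real (ln (real n))) ^ 1 * of_nat n powr (-0)) m =
      (\<Sum>a\<in>{1..<q}. \<psi> (int a) * of_real (ln (real q)) + \<psi> (int a) * of_real (ln (real m + real a / real q)))"
      unfolding char_block_def sum_negf [symmetric]
    proof (intro sum.cong refl)
      fix a assume a: "a \<in> {1..<q}"
      hence "(of_nat (q * m + a) :: complex) \<noteq> 0" by (simp only: of_nat_eq_0_iff) auto
      hence "of_nat (q * m + a) powr (- 0) = (1 :: complex)" by (simp only: powr_def) simp
      thus "- (\<psi> (int a) * ((- of_real (ln (real (q * m + a)))) ^ 1 * of_nat (q * m + a) powr (-0))) =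
        \<psi> (int a) * of_real (ln (real q)) + \<psi> (int a) * of_real (ln (real m + real a / real q))"
        by (simp only: ln_split[OF a]) (simp add: algebra_simps)
    qed
    also have "\<dots> = ln_block 1 m"
      using sum_zero by (simp add: ln_block_def sum.distrib flip: sum_distrib_right)
    finally show ?thesis .
  qed
  ultimately show ?thesis by simp
qed

lemma ln_block_2_sums: "ln_block 2 sums ((deriv ^^ 2) L 0 + 2 * of_real (ln (real q)) * deriv L 0)"
proof -
  have "(\<lambda>m. block (\<lambda>n. (- of_real (ln (real n))) ^ 2 * of_nat n powr (-0)) m) sums (deriv ^^ 2) L 0"
    by (rule L_higher_deriv_sums) auto
  from sums_diff[OF this sums_mult[OF ln_block_1_sums, of "2 * of_real (ln (real q))"]]
  have "(\<lambda>m. block (\<lambda>n. (- of_real (ln (real n))) ^ 2 * of_nat n powr (-0)) m - 2 * of_real (ln (real q)) * ln_block 1 m) sums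
    ((deriv ^^ 2) L 0 + 2 * of_real (ln (real q)) * deriv L 0)" by simp
  moreover have "block (\<lambda>n. (- of_real (ln (real n))) ^ 2 * of_nat n powr (-0)) m =
     2 * of_real (ln (real q)) * ln_block 1 m + ln_block 2 m" for m
  proof -
    have "block (\<lambda>n. (- of_real (ln (real n))) ^ 2 * of_nat n powr (-0)) m =
      (\<Sum>a\<in>{1..<q}. (of_real (ln (real q)))\<^sup>2 * \<psi> (int a)
         + 2 * of_real (ln (real q)) * (\<psi> (int a) * of_real (ln (real m + real a / real q) ^ 1))
         + \<psi> (int a) * of_real (ln (real m + real a / real q) ^ 2))"
      unfolding char_block_def
    proof (intro sum.cong refl)
      fix a assume a: "a \<in> {1..<q}"
      hence "(of_nat (q * m + a) :: complex) \<noteq> 0" by (simp only: of_nat_eq_0_iff) auto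
      hence "of_nat (q * m + a) powr (- 0) = (1 :: complex)" by (simp only: powr_def) simp
      thus "(\<psi> (int a) * ((- of_real (ln (real (q * m + a)))) ^ 2 * of_nat (q * m + a) powr (-0))) =
        (of_real (ln (real q)))\<^sup>2 * \<psi> (int a)
         + 2 * of_real (ln (real q)) * (\<psi> (int a) * of_real (ln (real m + real a / real q) ^ 1))
         + \<psi> (int a) * of_real (ln (real m + real a / real q) ^ 2)"
        by (simp only: ln_split[OF a]) (simp add: algebra_simps power2_eq_square)
    qed
    also have "\<dots> = (of_real (ln (real q)))\<^sup>2 * (\<Sum>a\<in>{1..<q}. \<psi> (int a)) + 2 * of_real (ln (real q)) * ln_block 1 m + ln_block 2 m"
      by (simp only: ln_block_def sum.distrib sum_distrib_left)
    finally show ?thesis by (simp only: sum_zero) simp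
  qed
  ultimately show ?thesis by simp
qed

text \<open>The limit formula for the logarithm of the Gamma function.\<close>
lemma sum_ln_Gamma:
  "(\<Sum>a\<in>{1..<q}. \<psi> (int a) * of_real (ln (Gamma (real a / real q)))) = deriv L 0"
proof -
  have "(\<lambda>N. \<Sum>a\<in>{1..<q}. \<psi> (int a) * of_real (ln_Gamma_series (real a / real q) N)) \<longlonglongrightarrow>
    (\<Sum>a\<in>{1..<q}. \<psi> (int a) * of_real (ln (Gamma (real a / real q))))"
  proof (intro tendsto_sum tendsto_mult tendsto_const tendsto_of_real)
    fix a assume "a \<in> {1..<q}"
    hence "real a / real q > 0" by simp
    thus "ln_Gamma_series (real a / real q) \<longlonglongrightarrow> ln (Gamma (real a / real q))"
      using ln_Gamma_real_LIMSEQ[of "real a / real q"] by (simp add: ln_Gamma_real_pos)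
  qed
  moreover have "(\<Sum>a\<in>{1..<q}. \<psi> (int a) * of_real (ln_Gamma_series (real a / real q) N)) = - (\<Sum>m<Suc N. ln_block 1 m)" for N
  proof -
    have "(\<Sum>a\<in>{1..<q}. \<psi> (int a) * of_real (ln_Gamma_series (real a / real q) N)) =
      (\<Sum>a\<in>{1..<q}. of_real (ln (real N)) / of_nat q * (\<psi> (int a) * of_nat a)
         + of_real (\<Sum>k=1..N. ln (real k)) * \<psi> (int a)
         - (\<Sum>m<Suc N. \<psi> (int a) * of_real (ln (real m + real a / real q) ^ 1)))"
    proof (intro sum.cong refl)
      fix a assume a: "a \<in> {1..<q}"
      define x where "x = real a / real q"
      have x: "x > 0" using a by (simp add: x_def)
      have "(\<Sum>k=1..N. ln (x / real k + 1)) = (\<Sum>k=1..N. ln (real k + x) - ln (real k))"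
      proof (intro sum.cong refl)
        fix k assume "k \<in> {1..N}"
        hence k: "real k > 0" by simp
        hence "x / real k + 1 = (real k + x) / real k" by (simp add: field_simps)
        thus "ln (x / real k + 1) = ln (real k + x) - ln (real k)" using k x by (simp add: ln_div)
      qed
      moreover have "(\<Sum>m<Suc N. ln (real m + x)) = ln x + (\<Sum>k=1..N. ln (real k + x))"
        by (subst sum.lessThan_Suc_shift) (simp add: sum.atLeast1_atMost_eq)
      ultimately have "ln_Gamma_series x N = x * ln (real N) + (\<Sum>k=1..N. ln (real k)) - (\<Sum>m<Suc N. ln (real m + x))"
        by (simp add: ln_Gamma_series_def sum_subtractf)
      hence "\<psi> (int a) * of_real (ln_Gamma_series x N) = \<psi> (int a) *
        (of_real x * of_real (ln (real N)) + of_real (\<Sum>k=1..N. ln (real k)) - (\<Sum>m<Suc N. of_real (ln (real m + x))))"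
        by (simp only: of_real_add of_real_diff of_real_mult of_real_sum)
      thus "\<psi> (int a) * of_real (ln_Gamma_series (real a / real q) N) = of_real (ln (real N)) / of_nat q * (\<psi> (int a) * of_nat a)
         + of_real (\<Sum>k=1..N. ln (real k)) * \<psi> (int a)
         - (\<Sum>m<Suc N. \<psi> (int a) * of_real (ln (real m + real a / real q) ^ 1))"
        by (simp only: sum_distrib_left [symmetric] x_def power_one_right) (simp add: algebra_simps)
    qed
    also have "\<dots> = of_real (ln (real N)) / of_nat q * (\<Sum>a\<in>{1..<q}. \<psi> (int a) * of_nat a)
         + of_real (\<Sum>k=1..N. ln (real k)) * (\<Sum>a\<in>{1..<q}. \<psi> (int a)) - (\<Sum>m<Suc N. ln_block 1 m)"
      by (simp only: sum.distrib sum_subtractf sum_distrib_left ln_block_def sum.swap[of _ "{..<Suc N}"])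
    finally show ?thesis by (simp only: sum_zero sum_linear_zero) simp
  qed
  moreover have "(\<lambda>N. - (\<Sum>m<Suc N. ln_block 1 m)) \<longlonglongrightarrow> deriv L 0"
    using tendsto_minus[OF LIMSEQ_Suc[OF ln_block_1_sums[unfolded sums_def]]] by simp
  ultimately show ?thesis using LIMSEQ_unique by simp
qed

text \<open>The series that defines \<open>S\<close> converges: with \<open>y = x / m\<close> its terms are
  \<open>2 log m (log (1 + y) - y) + (log (1 + y))\<^sup>2\<close>.\<close>
lemma S_fun_sums:
  assumes "0 < x" "x \<le> 1"
  shows "(\<lambda>k. (ln (x + real (Suc k)))\<^sup>2 - (ln (real (Suc k)))\<^sup>2 - 2 * x * (ln (real (Suc k)) / real (Suc k)))
     sums (S_fun x - 2 * gamma_1 * x - (ln x)\<^sup>2)"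
proof -
  have "summable (\<lambda>k. (ln (x + real (Suc k)))\<^sup>2 - (ln (real (Suc k)))\<^sup>2 - 2 * x * (ln (real (Suc k)) / real (Suc k)))"
  proof (rule summable_comparison_test_ev)
    show "summable (\<lambda>k. 5 * real (Suc k) powr (-3/2))"
      by (intro summable_mult, subst summable_Suc_iff) (simp add: summable_real_powr_iff)
    have main: "\<bar>(ln (x + m))\<^sup>2 - (ln m)\<^sup>2 - 2 * x * (ln m / m)\<bar> \<le> 5 * m powr (-3/2)" if m: "m \<ge> 1" for m :: real
    proof -
      define y where "y = x / m"
      have y: "0 \<le> y" "y \<le> 1" using assms m by (auto simp: y_def field_simps)
      have "x + m = m * (1 + y)" using m by (simp add: y_def field_simps)
      hence "ln (x + m) = ln m + ln (1 + y)" using m y by (simp add: ln_mult)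
      hence eq: "(ln (x + m))\<^sup>2 - (ln m)\<^sup>2 - 2 * x * (ln m / m) = 2 * ln m * (ln (1 + y) - y) + (ln (1 + y))\<^sup>2"
        by (simp add: y_def power2_eq_square algebra_simps)
      have b1: "\<bar>ln (1 + y) - y\<bar> \<le> y\<^sup>2" by (rule abs_ln_one_plus_x_minus_x_bound_nonneg) (use y in auto)
      have b2: "(ln (1 + y))\<^sup>2 \<le> y\<^sup>2" using y by (intro power_mono ln_add_one_self_le_self) auto
      have b3: "ln m \<le> 2 * m powr (1/2)" using ln_powr_bound[of m "1/2"] m by simp
      have "\<bar>2 * ln m * (ln (1 + y) - y) + (ln (1 + y))\<^sup>2\<bar> \<le> \<bar>2 * ln m * (ln (1 + y) - y)\<bar> + \<bar>(ln (1 + y))\<^sup>2\<bar>"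
        by (rule abs_triangle_ineq)
      also have "\<dots> = 2 * ln m * \<bar>ln (1 + y) - y\<bar> + (ln (1 + y))\<^sup>2" using m by (simp add: abs_mult)
      also have "\<dots> \<le> 2 * (2 * m powr (1/2)) * y\<^sup>2 + 1 * y\<^sup>2"
        using b1 b2 b3 m by (intro add_mono mult_mono) auto
      also have "\<dots> \<le> 2 * (2 * m powr (1/2)) * y\<^sup>2 + m powr (1/2) * y\<^sup>2"
        using m by (intro add_left_mono mult_right_mono ge_one_powr_ge_zero) auto
      also have "\<dots> = 5 * m powr (1/2) * y\<^sup>2" by simp
      also have "\<dots> \<le> 5 * m powr (1/2) * (1 / m)\<^sup>2"
        using assms m y by (intro mult_left_mono power_mono) (auto simp: y_def divide_right_mono)
      also have "(1 / m)\<^sup>2 = m powr (-2)"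
        using m by (simp add: powr_minus power_one_over field_simps)
      also have "5 * m powr (1/2) * m powr (-2) = 5 * m powr (-3/2)"
        by (simp flip: powr_add)
      finally show ?thesis unfolding eq .
    qed
    show "\<forall>\<^sub>F k in sequentially. norm ((ln (x + real (Suc k)))\<^sup>2 - (ln (real (Suc k)))\<^sup>2 - 2 * x * (ln (real (Suc k)) / real (Suc k)))
        \<le> 5 * real (Suc k) powr (-3/2)"
      by (intro always_eventually allI, unfold real_norm_def, rule main) simp
  qed
  thus ?thesis by (simp add: S_fun_def Let_def summable_sums)
qed

lemma sum_S_fun:
  "(\<Sum>a\<in>{1..<q}. \<psi> (int a) * of_real (S_fun (real a / real q))) = (deriv ^^ 2) L 0 + 2 * of_real (ln (real q)) * deriv L 0"
proof -
  let ?u = "\<lambda>x k. (ln (x + real (Suc k)))\<^sup>2 - (ln (real (Suc k)))\<^sup>2 - 2 * x * (ln (real (Suc k)) / real (Suc k))"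
  let ?S = "\<Sum>a\<in>{1..<q}. \<psi> (int a) * of_real (S_fun (real a / real q))"
  have "(\<lambda>k. \<Sum>a\<in>{1..<q}. \<psi> (int a) * of_real (?u (real a / real q) k)) sums
    (\<Sum>a\<in>{1..<q}. \<psi> (int a) * of_real (S_fun (real a / real q) - 2 * gamma_1 * (real a / real q) - (ln (real a / real q))\<^sup>2))"
    by (intro sums_sum sums_mult sums_of_real S_fun_sums) auto
  also have "(\<Sum>a\<in>{1..<q}. \<psi> (int a) * of_real (S_fun (real a / real q) - 2 * gamma_1 * (real a / real q) - (ln (real a / real q))\<^sup>2))
    = (\<Sum>a\<in>{1..<q}. \<psi> (int a) * of_real (S_fun (real a / real q)) - (2 * of_real gamma_1 / of_nat q) * (\<psi> (int a) * of_nat a)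
        - \<psi> (int a) * of_real (ln (real 0 + real a / real q) ^ 2))"
    by (intro sum.cong refl) (simp add: algebra_simps)
  also have "\<dots> = ?S - (2 * of_real gamma_1 / of_nat q) * (\<Sum>a\<in>{1..<q}. \<psi> (int a) * of_nat a) - ln_block 2 0"
    by (simp only: sum_subtractf sum_distrib_left ln_block_def)
  also have "\<dots> = ?S - ln_block 2 0" by (simp only: sum_linear_zero) simp
  also have "(\<lambda>k. \<Sum>a\<in>{1..<q}. \<psi> (int a) * of_real (?u (real a / real q) k)) = (\<lambda>k. ln_block 2 (Suc k))"
  proof
    fix k
    have "(\<Sum>a\<in>{1..<q}. \<psi> (int a) * of_real (?u (real a / real q) k)) =
      (\<Sum>a\<in>{1..<q}. \<psi> (int a) * of_real (ln (real (Suc k) + real a / real q) ^ 2) - (of_real (ln (real (Suc k))))\<^sup>2 * \<psi> (int a)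
         - (2 * of_real (ln (real (Suc k)) / real (Suc k)) / of_nat q) * (\<psi> (int a) * of_nat a))"
      by (intro sum.cong refl) (simp add: algebra_simps del: of_nat_Suc)
    also have "\<dots> = ln_block 2 (Suc k) - (of_real (ln (real (Suc k))))\<^sup>2 * (\<Sum>a\<in>{1..<q}. \<psi> (int a))
       - (2 * of_real (ln (real (Suc k)) / real (Suc k)) / of_nat q) * (\<Sum>a\<in>{1..<q}. \<psi> (int a) * of_nat a)"
      by (simp only: sum_subtractf sum_distrib_left ln_block_def)
    finally show "(\<Sum>a\<in>{1..<q}. \<psi> (int a) * of_real (?u (real a / real q) k)) = ln_block 2 (Suc k)"
      by (simp only: sum_zero sum_linear_zero) simp
  qed
  finally have "ln_block 2 sums ?S" by (simp add: sums_Suc_iff)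
  thus ?thesis using ln_block_2_sums sums_unique2 by blast
qed

lemma log_deriv_L_1:
  assumes "L 1 \<noteq> 0"
  shows "deriv L 1 / L 1 = of_real (euler_mascheroni + ln (2 * pi)) - 1 / 2 *
    ((\<Sum>a\<in>{1..<q}. cnj (\<psi> (int a)) * of_real (S_fun (real a / real q))) /
     (\<Sum>a\<in>{1..<q}. cnj (\<psi> (int a)) * of_real (ln (Gamma (real a / real q)))))"
proof -
  interpret B: even_char q "\<lambda>n. cnj (\<psi> n)" by (rule bar)
  have ln: "ln (2 * pi / q) = ln (2 * pi) - ln (real q)" using q_pos by (simp add: ln_div)
  have "(\<Sum>a\<in>{1..<q}. cnj (\<psi> (int a)) * of_real (S_fun (real a / real q))) =
     gauss * (of_real (euler_mascheroni + ln (2 * pi)) * L 1 - deriv L 1)"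
    unfolding B.sum_S_fun bar_L_derivs_0 ln by (simp add: algebra_simps)
  moreover have "(\<Sum>a\<in>{1..<q}. cnj (\<psi> (int a)) * of_real (ln (Gamma (real a / real q)))) = gauss * L 1 / 2"
    unfolding B.sum_ln_Gamma bar_L_derivs_0 ..
  ultimately show ?thesis
    using assms gauss_nonzero by (simp only:) (simp add: field_simps)
qed

end

section \<open>Sums over divisors\<close>

lemma has_sum_divisors:
  fixes f :: "nat \<Rightarrow> nat \<Rightarrow> 'a :: {topological_comm_monoid_add, t3_space}"
  assumes "((\<lambda>(d, k). f d k) has_sum S) ({1..} \<times> {1..})"
  shows "((\<lambda>N. \<Sum>d | d dvd N. f d (N div d)) has_sum S) {1..}"
proof -
  have bij: "bij_betw (\<lambda>(N, d). (d, N div d)) (Sigma {1..} (\<lambda>N. {d. d dvd N})) ({1..} \<times> {1..} :: (nat \<times> nat) set)"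
    by (rule bij_betwI[where g = "\<lambda>(d, k). (d * k, d)"]) (auto elim!: dvdE)
  have "((\<lambda>(N, d). f d (N div d)) has_sum S) (Sigma {1..} (\<lambda>N. {d. d dvd N}))"
    using has_sum_reindex_bij_betw[OF bij, of "\<lambda>(d, k). f d k" S] assms
    by (simp add: case_prod_unfold)
  thus ?thesis
    by (rule has_sum_SigmaD) (auto intro!: has_sum_finite finite_divisors_nat)
qed

lemma has_sum_product:
  fixes f :: "'a \<Rightarrow> 'c :: {real_normed_field, banach}" and g :: "'b \<Rightarrow> 'c"
  assumes "(\<lambda>x. norm (f x)) summable_on A" "(\<lambda>y. norm (g y)) summable_on B"
    and "(f has_sum a) A" "(g has_sum b) B"
  shows "((\<lambda>(x, y). f x * g y) has_sum a * b) (A \<times> B)"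
    "(\<lambda>(x, y). norm (f x * g y)) summable_on (A \<times> B)"
proof -
  have s: "(\<lambda>p. norm ((\<lambda>(x, y). f x * g y) p)) summable_on (A \<times> B)"
    unfolding Infinite_Sum.abs_summable_on_Sigma_iff
    using assms(1,2) by (auto simp: norm_mult infsum_cmult_right' abs_mult infsum_nonneg intro!: summable_on_cmult_right summable_on_cmult_left)
  show "(\<lambda>(x, y). norm (f x * g y)) summable_on (A \<times> B)"
    using s by (simp add: case_prod_unfold)
  show "((\<lambda>(x, y). f x * g y) has_sum a * b) (A \<times> B)"
  proof (rule has_sum_SigmaI)
    show "((\<lambda>y. case (x, y) of (x, y) \<Rightarrow> f x * g y) has_sum f x * b) B" for x
      using assms(4) by (simp add: has_sum_cmult_right)
    show "((\<lambda>x. f x * b) has_sum a * b) A" by (rule has_sum_cmult_left[OF assms(3)])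
    show "(\<lambda>(x, y). f x * g y) summable_on A \<times> B" by (rule abs_summable_summable[OF s])
  qed
qed

lemma bij_Suc: "bij_betw Suc UNIV {1..}"
  by (auto simp: bij_betw_def image_def Suc_le_eq gr0_conv_Suc)

lemma has_sum_from_1:
  fixes f :: "nat \<Rightarrow> 'a :: banach"
  assumes "summable (\<lambda>n. norm (f (Suc n)))" "(\<lambda>n. f (Suc n)) sums S"
  shows "(f has_sum S) {1..}" "(\<lambda>n. norm (f n)) summable_on {1..}"
proof -
  show "(f has_sum S) {1..}"
    using norm_summable_imp_has_sum[OF assms] has_sum_reindex_bij_betw[OF bij_Suc, of f S] by simp
  show "(\<lambda>n. norm (f n)) summable_on {1..}"
    using norm_summable_imp_summable_on[of "\<lambda>n. norm (f (Suc n))"] assms(1)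
      summable_on_reindex_bij_betw[OF bij_Suc, of "\<lambda>n. norm (f n)"] by simp
qed

lemma sums_from_1: "(f has_sum S) {1..} \<Longrightarrow> (\<lambda>n. f (Suc n)) sums S"
  using has_sum_reindex_bij_betw[OF bij_Suc, of f S] by (auto intro: has_sum_imp_sums)

lemma summable_on_powr_from_1:
  assumes "a < -1"
  shows "(\<lambda>n. real n powr a) summable_on {1..}"
proof -
  have "summable (\<lambda>n. real n powr a)" using assms by (simp add: summable_real_powr_iff)
  hence s: "summable (\<lambda>n. norm (real (Suc n) powr a))"
    using summable_Suc_iff[of "\<lambda>n. real n powr a"] by simp
  from has_sum_from_1(1)[where f = "\<lambda>n. real n powr a", OF s summable_sums[OF summable_norm_cancel[OF s]]]
  show ?thesis by (auto simp: summable_on_def)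
qed

section \<open>Non-vanishing at 1 for real characters\<close>

text \<open>The Dirichlet convolution of \<open>x\<close> with the constant function \<open>1\<close>.\<close>
definition divisor_sum :: "(nat \<Rightarrow> real) \<Rightarrow> nat \<Rightarrow> real" where
  "divisor_sum x N = (\<Sum>d | d dvd N. x d)"

lemma divisor_sum_coprime_mult:
  assumes mult: "\<And>m n. x (m * n) = x m * x n" and "coprime a b" "a > 0" "b > 0"
  shows "divisor_sum x (a * b) = divisor_sum x a * divisor_sum x b"
proof -
  have "bij_betw (\<lambda>(d, e). d * e) ({d. d dvd a} \<times> {e. e dvd b}) {d. d dvd a * b}"
    unfolding bij_betw_def
  proof
    show "inj_on (\<lambda>(d, e). d * e) ({d. d dvd a} \<times> {e. e dvd b})"
    proof (rule inj_onI, clarify)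
      fix d e d' e' assume *: "d dvd a" "e dvd b" "d' dvd a" "e' dvd b" and eq: "d * e = d' * e'"
      have "coprime d e'" "coprime d' e" using * assms(2) coprime_divisors by blast+
      hence "d dvd d'" "d' dvd d" using eq
        by (metis coprime_dvd_mult_left_iff dvd_triv_left)+
      hence "d = d'" by (rule dvd_antisym)
      moreover have "d > 0" using * assms by (auto intro!: Nat.gr0I)
      ultimately show "d = d' \<and> e = e'" using eq by simp
    qed
    show "(\<lambda>(d, e). d * e) ` ({d. d dvd a} \<times> {e. e dvd b}) = {d. d dvd a * b}"
    proof (intro equalityI subsetI)
      fix d assume "d \<in> {d. d dvd a * b}"
      then obtain d1 d2 where "d = d1 * d2" "d1 dvd a" "d2 dvd b" using division_decomp[of d a b] by auto
      thus "d \<in> (\<lambda>(d, e). d * e) ` ({d. d dvd a} \<times> {e. e dvd b})" by auto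
    qed (auto intro: mult_dvd_mono)
  qed
  hence "divisor_sum x (a * b) = (\<Sum>(d, e)\<in>{d. d dvd a} \<times> {e. e dvd b}. x (d * e))"
    unfolding divisor_sum_def by (subst sum.reindex_bij_betw [symmetric]) (auto simp: case_prod_unfold)
  also have "\<dots> = divisor_sum x a * divisor_sum x b"
    by (simp add: divisor_sum_def mult sum_product sum.cartesian_product)
  finally show ?thesis .
qed

lemma divisor_sum_prime_power:
  fixes p :: nat
  assumes mult: "\<And>m n. x (m * n) = x m * x n" and one: "x 1 = 1"
    and "\<And>n. x n \<in> {-1, 0, 1}" "prime p"
  shows "divisor_sum x (p ^ k) \<ge> (if even k then 1 else 0)"
proof -
  have pw: "x (p ^ i) = x p ^ i" for i by (induction i) (use mult one in auto)
  have "{d. d dvd p ^ k} = (\<lambda>i. p ^ i) ` {..k}"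
    by (auto simp: divides_primepow_nat[OF assms(4)])
  moreover have "inj_on (\<lambda>i. p ^ i) {..k}"
    using prime_gt_1_nat[OF assms(4)] by (intro inj_onI) (simp add: power_inject_exp)
  ultimately have "divisor_sum x (p ^ k) = (\<Sum>i\<le>k. x p ^ i)"
    by (simp add: divisor_sum_def sum.reindex pw)
  also have "\<dots> \<ge> (if even k then 1 else 0)"
  proof -
    have "x p = -1 \<or> x p = 0 \<or> x p = 1" using assms(3)[of p] by auto
    thus ?thesis
    proof (elim disjE)
      assume "x p = -1"
      moreover have "(\<Sum>i\<le>k. (-1::real) ^ i) = (if even k then 1 else 0)" by (induction k) auto
      ultimately show ?thesis by simp
    next
      assume "x p = 0"
      moreover have "(\<Sum>i\<le>k. (0::real) ^ i) = 1" by (induction k) auto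
      ultimately show ?thesis by simp
    qed auto
  qed
  finally show ?thesis .
qed

text \<open>Induction that splits off the full power of one prime.\<close>
lemma divisor_sum_nonneg:
  fixes N :: nat
  assumes mult: "\<And>m n. x (m * n) = x m * x n" and one: "x 1 = 1"
    and val: "\<And>n. x n \<in> {-1, 0, 1}" and "N > 0"
  shows "divisor_sum x N \<ge> 0 \<and> divisor_sum x (N\<^sup>2) \<ge> 1"
  using \<open>N > 0\<close>
proof (induction N rule: less_induct)
  case (less N)
  show ?case
  proof (cases "N = 1")
    case True
    thus ?thesis using one by (simp add: divisor_sum_def)
  next
    case False
    then obtain p where p: "prime p" "p dvd N" using prime_factor_nat by blast
    have "\<not> is_unit p" using p by auto
    then obtain m where m: "N = p ^ multiplicity p N * m" "\<not> p dvd m"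
      using multiplicity_decompose'[of N p] less.prems by auto
    define k where "k = multiplicity p N"
    have k: "k > 0" using p less.prems by (simp add: k_def prime_multiplicity_gt_zero_iff)
    have N: "N = p ^ k * m" using m by (simp add: k_def)
    have m0: "m > 0" using less.prems N by (auto intro!: Nat.gr0I)
    have "p ^ k > 1" using prime_gt_1_nat[OF p(1)] k by (rule one_less_power)
    hence "m < N" using m0 N by simp
    have IH: "divisor_sum x m \<ge> 0" "divisor_sum x (m\<^sup>2) \<ge> 1" using less.IH[OF \<open>m < N\<close> m0] by auto
    have cop: "coprime p m" using p m by (simp add: prime_imp_coprime)
    have "divisor_sum x N = divisor_sum x (p ^ k) * divisor_sum x m"
      unfolding N using cop m0 prime_gt_0_nat[OF p(1)] mult by (intro divisor_sum_coprime_mult) auto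
    moreover have "divisor_sum x (p ^ k) \<ge> 0"
      using divisor_sum_prime_power[OF mult one val p(1), of k] by (auto split: if_splits)
    ultimately have "divisor_sum x N \<ge> 0" using IH by simp
    have "N\<^sup>2 = p ^ (2 * k) * m\<^sup>2" by (simp add: N power_mult_distrib power_mult mult.commute)
    hence "divisor_sum x (N\<^sup>2) = divisor_sum x (p ^ (2 * k)) * divisor_sum x (m\<^sup>2)"
      using cop m0 prime_gt_0_nat[OF p(1)] mult by (simp only:) (intro divisor_sum_coprime_mult, auto)
    moreover have "divisor_sum x (p ^ (2 * k)) \<ge> 1"
      using divisor_sum_prime_power[OF mult one val p(1), of "2 * k"] by simp
    ultimately have "divisor_sum x (N\<^sup>2) \<ge> 1 * 1" using IH by (simp only:) (intro mult_mono, auto)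
    with \<open>divisor_sum x N \<ge> 0\<close> show ?thesis by simp
  qed
qed

text \<open>The difference between \<open>1 / (n (1 - t))\<close> and the Lambert kernel. It is non-negative and decreases in \<open>n\<close>,
  so that its sums against a character are bounded.\<close>
definition lambert_diff :: "real \<Rightarrow> nat \<Rightarrow> real" where
  "lambert_diff t n = 1 / (real n * (1 - t)) - t ^ n / (1 - t ^ n)"

text \<open>An instance of the arithmetic-geometric mean inequality.\<close>
lemma geometric_sum_ge:
  fixes r :: real
  assumes "0 < r"
  shows "(\<Sum>i<Suc n. (r\<^sup>2) ^ i) \<ge> real (Suc n) * r ^ n"
proof (induction n)
  case (Suc n)
  have B: "1 + real (Suc (Suc n)) * (r - 1) \<le> r ^ Suc (Suc n)"
    using Bernoulli_inequality[of "r - 1" "Suc (Suc n)"] assms by simp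
  have "real (Suc (Suc n)) * r ^ Suc n = r ^ n * (real (Suc (Suc n)) * r)" by simp
  also have "\<dots> \<le> r ^ n * (real (Suc n) + r ^ Suc (Suc n))"
    using B assms by (intro mult_left_mono) (auto simp: algebra_simps)
  also have "\<dots> = real (Suc n) * r ^ n + (r\<^sup>2) ^ Suc n"
  proof -
    have "n + Suc (Suc n) = 2 * Suc n" by simp
    hence "r ^ n * r ^ Suc (Suc n) = (r\<^sup>2) ^ Suc n" by (simp only: power_mult [symmetric] power_add [symmetric])
    thus ?thesis by (simp only: distrib_left mult.commute)
  qed
  also have "\<dots> \<le> (\<Sum>i<Suc n. (r\<^sup>2) ^ i) + (r\<^sup>2) ^ Suc n" using Suc by simp
  finally show ?case by simp
qed auto

lemma lambert_diff_Suc_le: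
  assumes t: "0 < t" "t < 1" and n: "n > 0"
  shows "lambert_diff t (Suc n) \<le> lambert_diff t n"
proof -
  define E where "E n = (\<Sum>i<n. t ^ i)" for n
  define r where "r = sqrt t"
  have r: "0 < r" "r \<le> 1" "r\<^sup>2 = t" using t by (auto simp: r_def)
  have E_ge: "E (Suc k) \<ge> real (Suc k) * r ^ k" for k
    using geometric_sum_ge[OF r(1), of k] by (simp add: E_def r(3))
  have Epos: "E k > 0" if "k > 0" for k
    using that t by (auto simp: E_def intro!: sum_pos)
  have pow: "1 - t ^ k = (1 - t) * E k" for k by (simp add: E_def one_diff_power_eq)
  obtain k where k: "n = Suc k" using n by (cases n) auto
  have EE: "E n * E (Suc n) \<ge> real n * real (Suc n) * t ^ n"
  proof -
    have "real n * real (Suc n) * t ^ n = real n * real (Suc n) * (r ^ n * r ^ n)"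
      by (simp flip: r(3) power_mult_distrib add: power2_eq_square)
    also have "\<dots> \<le> real n * real (Suc n) * (r ^ k * r ^ n)"
      using r by (intro mult_left_mono mult_right_mono) (auto simp: k intro!: mult_left_le_one_le)
    also have "\<dots> = (real n * r ^ k) * (real (Suc n) * r ^ n)" by simp
    also have "\<dots> \<le> E n * E (Suc n)"
      using E_ge[of k] E_ge[of n] r by (intro mult_mono) (auto simp: k intro!: less_imp_le[OF Epos])
    finally show ?thesis .
  qed
  have E0: "E n > 0" "E (Suc n) > 0" using Epos n by auto
  have Estep: "E (Suc n) = 1 + t * E n"
    by (simp only: E_def sum.lessThan_Suc_shift sum_distrib_left) simp
  have diff: "(1 - t) * (lambert_diff t n - lambert_diff t (Suc n)) =
    (1 / real n - 1 / real (Suc n)) - (t ^ n / E n - t ^ Suc n / E (Suc n))"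
  proof -
    have "(1 - t) * lambert_diff t k = 1 / real k - t ^ k / E k" if "k > 0" for k
    proof -
      have "u * (1 / (v * u) - w / (u * e)) = 1 / v - w / e" if "u \<noteq> 0" for u v w e :: real
        using that by (simp add: right_diff_distrib)
      thus ?thesis unfolding lambert_diff_def pow using t by simp
    qed
    from this[of n] this[of "Suc n"] show ?thesis using n by (simp add: right_diff_distrib)
  qed
  have "t ^ n / E n - t ^ Suc n / E (Suc n) = t ^ n * (E (Suc n) - t * E n) / (E n * E (Suc n))"
    using E0 by (simp add: field_simps)
  also have "\<dots> = t ^ n / (E n * E (Suc n))" by (simp add: Estep)
  also have "\<dots> \<le> t ^ n / (real n * real (Suc n) * t ^ n)"
    using EE t n E0 by (intro divide_left_mono mult_pos_pos) auto
  also have "\<dots> = 1 / (real n * real (Suc n))" using t by simp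
  also have "\<dots> = 1 / real n - 1 / real (Suc n)" using n by (simp add: field_simps)
  finally have "(1 - t) * (lambert_diff t n - lambert_diff t (Suc n)) \<ge> 0" unfolding diff by simp
  thus ?thesis using t by (simp add: zero_le_mult_iff)
qed

lemma lambert_diff_antimono:
  assumes t: "0 < t" "t < 1" and "0 < m" "m \<le> n"
  shows "lambert_diff t n \<le> lambert_diff t m"
  using assms(4)
proof (induction n rule: dec_induct)
  case (step n)
  have "lambert_diff t (Suc n) \<le> lambert_diff t n"
    using step assms(3) by (intro lambert_diff_Suc_le[OF t]) auto
  with step show ?case by simp
qed simp

lemma lambert_diff_nonneg:
  assumes t: "0 < t" "t < 1" and "0 < n"
  shows "lambert_diff t n \<ge> 0"
proof -
  have "real n * t ^ n = (\<Sum>i<n. t ^ n)" by simp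
  also have "\<dots> \<le> (\<Sum>i<n. t ^ i)" using t by (intro sum_mono power_decreasing) auto
  finally have "(1 - t) * (real n * t ^ n) \<le> 1 - t ^ n"
    unfolding one_diff_power_eq[of t n] using t by (intro mult_left_mono) auto
  moreover have "t ^ n < 1" using t assms(3) by (simp add: power_Suc_less_one power_less_one_iff)
  ultimately have "t ^ n / (1 - t ^ n) \<le> 1 / (real n * (1 - t))"
    using t assms(3) by (simp add: field_simps)
  thus ?thesis by (simp add: lambert_diff_def)
qed

text \<open>The Lambert series of \<open>x\<close> is the power series of its divisor sums.\<close>
lemma lambert_series:
  fixes x :: "nat \<Rightarrow> real"
  assumes t: "0 < t" "t < 1" and bd: "\<And>n. \<bar>x n\<bar> \<le> 1"
  obtains S where "((\<lambda>d. x d * (t ^ d / (1 - t ^ d))) has_sum S) {1..}"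
    "((\<lambda>N. divisor_sum x N * t ^ N) has_sum S) {1..}"
proof -
  have geo: "summable (\<lambda>n. norm (t ^ Suc n))" "(\<lambda>n. t ^ Suc n) sums (t / (1 - t))"
    using t geometric_sums[of t] sums_mult[OF geometric_sums[of t], of t]
    by (auto intro!: summable_mult summable_geometric)
  have geo': "summable (\<lambda>n. norm (t ^ (Suc n - 1)))" "(\<lambda>n. t ^ (Suc n - 1)) sums (1 / (1 - t))"
    using t geometric_sums[of t] by (auto intro!: summable_geometric)
  note g = has_sum_from_1[where f = "\<lambda>n. t ^ n", OF geo]
  note g' = has_sum_from_1[where f = "\<lambda>n. t ^ (n - 1)", OF geo']
  have prod: "(\<lambda>(d, k). norm (t ^ (d - 1) * t ^ k)) summable_on ({1..} \<times> {1..})"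
    by (rule has_sum_product(2)[OF g'(2) g(2) g'(1) g(1)])
  have "(\<lambda>p. norm ((\<lambda>(d, k). x d * t ^ (d * k)) p)) summable_on ({1..} \<times> {1..})"
  proof (rule Infinite_Sum.abs_summable_on_comparison_test'[OF prod])
    fix p :: "nat \<times> nat" assume "p \<in> {1..} \<times> {1..}"
    then obtain d k where p: "p = (Suc d, Suc k)"
      by (cases p) (auto simp: Suc_le_eq gr0_conv_Suc)
    have "norm (x (Suc d) * t ^ (Suc d * Suc k)) \<le> 1 * t ^ (Suc d * Suc k)"
      unfolding norm_mult using bd t by (intro mult_mono) auto
    also have "\<dots> \<le> t ^ (d + Suc k)"
      using t by (simp only: mult_1) (intro power_decreasing, auto)
    finally show "norm ((\<lambda>(d, k). x d * t ^ (d * k)) p) \<le> (case p of (d, k) \<Rightarrow> norm (t ^ (d - 1) * t ^ k))"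
      using t by (simp add: p power_add mult_ac)
  qed
  from abs_summable_summable[OF this] obtain S where S: "((\<lambda>(d, k). x d * t ^ (d * k)) has_sum S) ({1..} \<times> {1..})"
    by (auto simp: summable_on_def)
  have "((\<lambda>d. x d * (t ^ d / (1 - t ^ d))) has_sum S) {1..}"
  proof (rule has_sum_SigmaD[OF S])
    fix d :: nat assume d: "d \<in> {1..}"
    have td: "0 < t ^ d" "t ^ d < 1" using t d by (auto simp: power_less_one_iff)
    have "((\<lambda>k. (t ^ d) ^ k) has_sum (t ^ d / (1 - t ^ d))) {1..}"
      using td geometric_sums[of "t ^ d"] sums_mult[OF geometric_sums[of "t ^ d"], of "t ^ d"]
      by (intro has_sum_from_1) (auto intro!: summable_mult summable_geometric)
    from has_sum_cmult_right[OF this, of "x d"]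
    show "((\<lambda>k. case (d, k) of (d, k) \<Rightarrow> x d * t ^ (d * k)) has_sum x d * (t ^ d / (1 - t ^ d))) {1..}"
      by (simp add: power_mult)
  qed
  moreover have "((\<lambda>N. divisor_sum x N * t ^ N) has_sum S) {1..}"
  proof -
    have "((\<lambda>N. \<Sum>d | d dvd N. x d * t ^ (d * (N div d))) has_sum S) {1..}"
      by (rule has_sum_divisors[OF S])
    thus ?thesis by (simp add: divisor_sum_def sum_distrib_right)
  qed
  ultimately show ?thesis by (rule that)
qed

context even_char
begin

text \<open>If \<open>L(1) = 0\<close>, the Lambert series \<open>S\<close> equals minus the sum of \<open>\<psi>(n)\<close> against \<open>lambert_diff\<close>, which
  is at most \<open>q\<close> for every \<open>t\<close>; but \<open>S\<close> is at least the sum of \<open>t ^ k\<^sup>2\<close>.\<close>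
lemma L_1_real_nonzero:
  assumes real: "\<And>n. (\<psi> n)\<^sup>2 = (if coprime n (int q) then 1 else 0)"
  shows "L 1 \<noteq> 0"
proof
  assume L1: "L 1 = 0"
  define x where "x n = Re (\<psi> (int n))" for n :: nat
  have psi_val: "\<psi> n \<in> {-1, 0, 1}" for n
    using real[of n] by (cases "coprime n (int q)") (auto simp: power2_eq_1_iff)
  have psi_x: "\<psi> (int n) = of_real (x n)" for n
    using psi_val[of "int n"] by (auto simp: x_def)
  have xval: "x n \<in> {-1, 0, 1}" for n using psi_val[of "int n"] by (auto simp: x_def)
  have xbd: "\<bar>x n\<bar> \<le> 1" for n using xval[of n] by auto
  have x1: "x 1 = 1" by (simp add: x_def at_1)
  have xmult: "x (m * n) = x m * x n" for m n
    using mult[of "int m" "int n"] by (simp add: psi_x flip: of_real_mult of_nat_mult)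
  define K where "K = Suc q"
  \<comment> \<open>\<open>t\<close> is so close to \<open>1\<close> that \<open>t ^ k\<^sup>2\<close> is almost \<open>1\<close> for the first \<open>q + 1\<close> squares, whereas \<open>S\<close> will be at most \<open>q\<close>\<close>
  define t where "t = 1 - 1 / (2 * real K ^ 3)"
  have K: "real K \<ge> 1" by (simp add: K_def)
  hence K3: "real K ^ 3 \<ge> 1" by (simp add: one_le_power)
  have "0 < 2 * real K ^ 3" "1 < 2 * real K ^ 3" using K3 by linarith+
  hence "0 < 1 / (2 * real K ^ 3)" "1 / (2 * real K ^ 3) < 1"
    by (simp_all only: divide_less_eq_1_pos zero_less_divide_1_iff)
  hence t: "0 < t" "t < 1" unfolding t_def by linarith+
  obtain S where S: "((\<lambda>d. x d * (t ^ d / (1 - t ^ d))) has_sum S) {1..}"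
    "((\<lambda>N. divisor_sum x N * t ^ N) has_sum S) {1..}"
    by (rule lambert_series[where x = x, OF t xbd])
  have "S \<le> q"
  proof -
    have "(\<lambda>n. x (Suc n) * (t ^ Suc n / (1 - t ^ Suc n))) sums S"
      by (rule sums_from_1[OF S(1)])
    hence "(\<lambda>n. of_real (x (Suc n) * (t ^ Suc n / (1 - t ^ Suc n))) :: complex) sums of_real S"
      by (rule sums_of_real)
    hence "(\<lambda>n. \<psi> (int (Suc n)) * of_real (t ^ Suc n / (1 - t ^ Suc n))) sums of_real S"
      by (simp only: psi_x of_real_mult)
    hence b1: "block (\<lambda>n. of_real (t ^ n / (1 - t ^ n))) sums of_real S"
      by (rule sums_block)
    have "block (\<lambda>n. of_nat n powr (-1)) sums 0"
      using L_sums[of 1] L1 by simp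
    from sums_mult[OF this, of "of_real (1 / (1 - t))"]
    have b2: "(\<lambda>m. of_real (1 / (1 - t)) * block (\<lambda>n. of_nat n powr (-1)) m) sums 0" by simp
    have "of_real (1 / (1 - t)) * block (\<lambda>n. of_nat n powr (-1)) m - block (\<lambda>n. of_real (t ^ n / (1 - t ^ n))) m
      = block (\<lambda>n. of_real (lambert_diff t n)) m" for m
      unfolding char_block_def sum_distrib_left sum_subtractf [symmetric]
    proof (intro sum.cong refl)
      fix a assume a: "a \<in> {1..<q}"
      define n where "n = q * m + a"
      have "of_nat n powr (-1) = complex_of_real (1 / real n)"
        using a by (simp add: powr_minus_divide n_def)
      hence e: "of_real (lambert_diff t n) = of_real (1 / (1 - t)) * (of_nat n powr (-1)) - complex_of_real (t ^ n / (1 - t ^ n))"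
        by (simp only: lambert_diff_def of_real_diff) (simp add: mult.commute)
      show "of_real (1 / (1 - t)) * (\<psi> (int a) * of_nat (q * m + a) powr (-1)) -
         \<psi> (int a) * of_real (t ^ (q * m + a) / (1 - t ^ (q * m + a))) =
         \<psi> (int a) * of_real (lambert_diff t (q * m + a))"
        unfolding n_def [symmetric] e by (simp only: right_diff_distrib mult.left_commute)
    qed
    with sums_diff[OF b2 b1] have "block (\<lambda>n. of_real (lambert_diff t n)) sums (- of_real S)" by simp
    hence "(\<lambda>N. norm (\<Sum>m<N. block (\<lambda>n. of_real (lambert_diff t n)) m)) \<longlonglongrightarrow> norm (- complex_of_real S)"
      unfolding sums_def by (rule tendsto_norm)
    moreover have "norm (\<Sum>m<N. block (\<lambda>n. of_real (lambert_diff t n)) m) \<le> q * lambert_diff t 1" for N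
      by (intro norm_sum_blocks_le lambert_diff_antimono[OF t] lambert_diff_nonneg[OF t]) auto
    moreover have "lambert_diff t 1 = 1" using t by (simp add: lambert_diff_def field_simps)
    ultimately have "norm (- complex_of_real S) \<le> q"
      by (intro LIMSEQ_le_const2) auto
    thus "S \<le> q" by simp
  qed
  moreover have "S \<ge> real K - 1 / 2"
  proof -
    have "(\<Sum>N\<in>(\<lambda>k. k\<^sup>2) ` {1..K}. divisor_sum x N * t ^ N) \<le> S"
      using divisor_sum_nonneg[OF xmult x1 xval] t
      by (intro finite_sum_le_has_sum[OF S(2)]) auto
    moreover have "(\<Sum>N\<in>(\<lambda>k. k\<^sup>2) ` {1..K}. divisor_sum x N * t ^ N) = (\<Sum>k\<in>{1..K}. divisor_sum x (k\<^sup>2) * t ^ (k\<^sup>2))"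
      by (subst sum.reindex) (auto simp: inj_on_def)
    moreover have "(\<Sum>k\<in>{1..K}. 1 - 1 / (2 * real K)) \<le> (\<Sum>k\<in>{1..K}. divisor_sum x (k\<^sup>2) * t ^ (k\<^sup>2))"
    proof (rule sum_mono)
      fix k assume k: "k \<in> {1..K}"
      have "1 - 1 / (2 * real K) = 1 + real (K\<^sup>2) * (- (1 / (2 * real K ^ 3)))"
        using K by (simp add: field_simps power2_eq_square power3_eq_cube)
      also have "\<dots> \<le> 1 + real (k\<^sup>2) * (- (1 / (2 * real K ^ 3)))"
        using k by (simp add: divide_right_mono power_mono)
      also have "\<dots> \<le> t ^ (k\<^sup>2)"
        using Bernoulli_inequality[of "- (1 / (2 * real K ^ 3))" "k\<^sup>2"] t unfolding t_def by simp
      also have "\<dots> = 1 * t ^ (k\<^sup>2)" by simp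
      also have "\<dots> \<le> divisor_sum x (k\<^sup>2) * t ^ (k\<^sup>2)"
        using divisor_sum_nonneg[OF xmult x1 xval, of k] k t by (intro mult_right_mono) auto
      finally show "1 - 1 / (2 * real K) \<le> divisor_sum x (k\<^sup>2) * t ^ (k\<^sup>2)" .
    qed
    moreover have "(\<Sum>k\<in>{1..K}. 1 - 1 / (2 * real K)) = real K - 1 / 2"
      using K by (simp add: field_simps)
    ultimately show ?thesis by linarith
  qed
  ultimately show False by (simp add: K_def)
qed

end

section \<open>Non-vanishing at 1 for complex characters\<close>

lemma mangoldt_le_ln:
  assumes "n > 0"
  shows "mangoldt n \<le> ln (real n)"
proof -
  have "mangoldt n \<le> (\<Sum>d | d dvd n. mangoldt d :: real)"
    using assms by (intro member_le_sum) (auto simp: mangoldt_nonneg)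
  also have "\<dots> = ln (real n)" using mangoldt_sum[of n, where 'a = real] assms by simp
  finally show ?thesis .
qed

lemma summable_mangoldt:
  assumes "\<sigma> > 1"
  shows "(\<lambda>n. norm (mangoldt n * real n powr (-\<sigma>))) summable_on {1..}"
proof -
  define a where "a = (\<sigma> - 1) / 2"
  have a: "a > 0" "a - \<sigma> < -1" using assms by (auto simp: a_def field_simps)
  show ?thesis
  proof (rule Infinite_Sum.abs_summable_on_comparison_test')
    show "(\<lambda>n. (1 / a) * real n powr (a - \<sigma>)) summable_on {1..}"
      by (intro summable_on_cmult_right summable_on_powr_from_1 a)
    fix n :: nat assume n: "n \<in> {1..}"
    have "mangoldt n \<le> real n powr a / a"
      using mangoldt_le_ln[of n] ln_powr_bound[of "real n" a] n a by simp
    hence "mangoldt n * real n powr (-\<sigma>) \<le> (real n powr a / a) * real n powr (-\<sigma>)"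
      by (intro mult_right_mono) auto
    also have "\<dots> = (1 / a) * real n powr (a - \<sigma>)" by (simp add: powr_diff powr_minus divide_inverse)
    finally show "norm (mangoldt n * real n powr (-\<sigma>)) \<le> (1 / a) * real n powr (a - \<sigma>)"
      by (simp add: mangoldt_nonneg)
  qed
qed

text \<open>Multiplying the Dirichlet series of a completely multiplicative function by that of its product
  with the von Mangoldt function gives, up to sign, the derivative of the former.\<close>
lemma mangoldt_convolution:
  fixes f :: "nat \<Rightarrow> complex"
  assumes mult: "\<And>m n. f (m * n) = f m * f n" and bd: "\<And>n. norm (f n) \<le> 1" and \<sigma>: "\<sigma> > 1"
    and F: "((\<lambda>n. f n * of_real (real n powr (-\<sigma>))) has_sum F) {1..}"
  obtains D where "((\<lambda>n. f n * of_real (mangoldt n * real n powr (-\<sigma>))) has_sum D) {1..}"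
    "((\<lambda>n. f n * of_real (ln (real n) * real n powr (-\<sigma>))) has_sum D * F) {1..}"
proof -
  have s1: "(\<lambda>n. norm (f n * of_real (real n powr (-\<sigma>)))) summable_on {1..}"
  proof (rule Infinite_Sum.abs_summable_on_comparison_test')
    show "(\<lambda>n. real n powr (-\<sigma>)) summable_on {1..}" using \<sigma> by (intro summable_on_powr_from_1) auto
    show "norm (f n * of_real (real n powr (-\<sigma>))) \<le> real n powr (-\<sigma>)" for n
      using bd[of n] by (simp only: norm_mult norm_of_real) (simp add: mult_left_le_one_le)
  qed
  have s2: "(\<lambda>n. norm (f n * of_real (mangoldt n * real n powr (-\<sigma>)))) summable_on {1..}"
  proof (rule Infinite_Sum.abs_summable_on_comparison_test'[OF summable_mangoldt[OF \<sigma>]])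
    show "norm (f n * of_real (mangoldt n * real n powr (-\<sigma>))) \<le> norm (mangoldt n * real n powr (-\<sigma>))" for n
      using bd[of n] by (simp only: norm_mult[of "f n"] norm_of_real real_norm_def) (simp add: mult_left_le_one_le)
  qed
  obtain D where D: "((\<lambda>n. f n * of_real (mangoldt n * real n powr (-\<sigma>))) has_sum D) {1..}"
    using abs_summable_summable[OF s2] by (auto simp: summable_on_def)
  have "((\<lambda>(d, k). (f d * of_real (mangoldt d * real d powr (-\<sigma>))) * (f k * of_real (real k powr (-\<sigma>)))) has_sum D * F) ({1..} \<times> {1..})"
    by (rule has_sum_product(1)[OF s2 s1 D F])
  hence "((\<lambda>N. \<Sum>d | d dvd N. (f d * of_real (mangoldt d * real d powr (-\<sigma>))) * (f (N div d) * of_real (real (N div d) powr (-\<sigma>)))) has_sum D * F) {1..}"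
    by (rule has_sum_divisors)
  also have "?this \<longleftrightarrow> ((\<lambda>n. f n * of_real (ln (real n) * real n powr (-\<sigma>))) has_sum D * F) {1..}"
  proof (rule has_sum_cong)
    fix N :: nat assume N: "N \<in> {1..}"
    have "(\<Sum>d | d dvd N. (f d * of_real (mangoldt d * real d powr (-\<sigma>))) * (f (N div d) * of_real (real (N div d) powr (-\<sigma>)))) =
      (\<Sum>d | d dvd N. (f N * of_real (real N powr (-\<sigma>))) * of_real (mangoldt d))"
    proof (intro sum.cong refl)
      fix d assume "d \<in> {d. d dvd N}"
      then obtain k where k: "N = d * k" by auto
      hence dk: "N div d = k" using N by auto
      show "(f d * of_real (mangoldt d * real d powr (-\<sigma>))) * (f (N div d) * of_real (real (N div d) powr (-\<sigma>)))
        = (f N * of_real (real N powr (-\<sigma>))) * of_real (mangoldt d)"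
        unfolding dk by (simp add: k mult powr_mult)
    qed
    also have "\<dots> = f N * of_real (real N powr (-\<sigma>)) * of_real (\<Sum>d | d dvd N. mangoldt d)"
      by (simp only: sum_distrib_left of_real_sum)
    also have "(\<Sum>d | d dvd N. mangoldt d) = ln (real N)" using N mangoldt_sum[of N, where 'a = real] by simp
    finally show "(\<Sum>d | d dvd N. (f d * of_real (mangoldt d * real d powr (-\<sigma>))) * (f (N div d) * of_real (real (N div d) powr (-\<sigma>))))
      = f N * of_real (ln (real N) * real N powr (-\<sigma>))" by (simp add: mult_ac)
  qed
  finally show ?thesis using D that by blast
qed

text \<open>Comparison of \<open>n powr (-1 - \<delta>)\<close> with its primitive, for the bounds on \<open>\<zeta>(1 + \<delta>)\<close>.\<close>
lemma powr_step_bounds: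
  fixes n \<delta> :: real
  assumes "n > 0" "\<delta> > 0"
  shows "\<delta> * (n + 1) powr (-1 - \<delta>) \<le> n powr (-\<delta>) - (n + 1) powr (-\<delta>)"
    "n powr (-\<delta>) - (n + 1) powr (-\<delta>) \<le> \<delta> * n powr (-1 - \<delta>)"
proof -
  have split: "m powr (-1 - \<delta>) = m powr (-\<delta>) / m" if "m > 0" for m
    using that by (simp add: powr_diff powr_minus field_simps)
  have "ln n \<le> ln (n + 1) - 1 / (n + 1)"
  proof -
    have "ln (n / (n + 1)) \<le> n / (n + 1) - 1" using assms by (intro ln_le_minus_one) auto
    also have "n / (n + 1) - 1 = - (1 / (n + 1))" using assms by (simp add: field_simps)
    finally show ?thesis using assms by (simp add: ln_div)
  qed
  hence "-\<delta> * ln (n + 1) + \<delta> / (n + 1) \<le> -\<delta> * ln n"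
    using mult_left_mono[of "ln n" "ln (n + 1) - 1 / (n + 1)" \<delta>] assms by (simp add: algebra_simps)
  hence A: "exp (-\<delta> * ln (n + 1)) * exp (\<delta> / (n + 1)) \<le> exp (-\<delta> * ln n)"
    by (simp flip: exp_add)
  have "exp (-\<delta> * ln (n + 1)) * (1 + \<delta> / (n + 1)) \<le> exp (-\<delta> * ln (n + 1)) * exp (\<delta> / (n + 1))"
    using exp_ge_add_one_self[of "\<delta> / (n + 1)"] by (intro mult_left_mono) auto
  from order.trans[OF this A] have "(n + 1) powr (-\<delta>) * (1 + \<delta> / (n + 1)) \<le> n powr (-\<delta>)"
    using assms by (simp add: powr_def)
  thus "\<delta> * (n + 1) powr (-1 - \<delta>) \<le> n powr (-\<delta>) - (n + 1) powr (-\<delta>)"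
    using split[of "n + 1"] assms by (simp add: algebra_simps)
  have "ln (n + 1) \<le> ln n + 1 / n"
  proof -
    have "ln ((n + 1) / n) \<le> (n + 1) / n - 1" using assms by (intro ln_le_minus_one) auto
    also have "(n + 1) / n - 1 = 1 / n" using assms by (simp add: field_simps)
    finally show ?thesis using assms by (simp add: ln_div)
  qed
  hence "-\<delta> * ln n + - (\<delta> / n) \<le> -\<delta> * ln (n + 1)"
    using mult_left_mono[of "ln (n + 1)" "ln n + 1 / n" \<delta>] assms by (simp add: algebra_simps)
  hence A: "exp (-\<delta> * ln n) * exp (- (\<delta> / n)) \<le> exp (-\<delta> * ln (n + 1))"
    by (simp flip: exp_add)
  have "exp (-\<delta> * ln n) * (1 + - (\<delta> / n)) \<le> exp (-\<delta> * ln n) * exp (- (\<delta> / n))"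
    using exp_ge_add_one_self[of "- (\<delta> / n)"] by (intro mult_left_mono) auto
  from order.trans[OF this A] have "n powr (-\<delta>) * (1 - \<delta> / n) \<le> (n + 1) powr (-\<delta>)"
    using assms by (simp add: powr_def)
  thus "n powr (-\<delta>) - (n + 1) powr (-\<delta>) \<le> \<delta> * n powr (-1 - \<delta>)"
    using split[of n] assms by (simp add: algebra_simps)
qed

lemma zeta_bounds:
  assumes "\<delta> > 0"
  obtains Z where "((\<lambda>n. real n powr (-1 - \<delta>)) has_sum Z) {1..}" "1 / \<delta> \<le> Z" "Z \<le> 1 + 1 / \<delta>"
proof -
  obtain Z where Z: "((\<lambda>n. real n powr (-1 - \<delta>)) has_sum Z) {1..}"
    using summable_on_powr_from_1[of "-1 - \<delta>"] assms by (auto simp: summable_on_def)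
  have sZ: "(\<lambda>n. real (Suc n) powr (-1 - \<delta>)) sums Z" using sums_from_1[OF Z] .
  have "(\<lambda>n. real (Suc n) powr (-\<delta>)) \<longlonglongrightarrow> 0"
    by (rule LIMSEQ_Suc) (use assms in \<open>intro tendsto_neg_powr filterlim_real_sequentially, auto\<close>)
  from telescope_sums'[OF this]
  have tel: "(\<lambda>n. real (Suc n) powr (-\<delta>) - real (Suc (Suc n)) powr (-\<delta>)) sums 1" by simp
  have "1 \<le> \<delta> * Z"
  proof (rule sums_le[OF _ tel sums_mult[OF sZ]])
    show "real (Suc n) powr (-\<delta>) - real (Suc (Suc n)) powr (-\<delta>) \<le> \<delta> * real (Suc n) powr (-1 - \<delta>)" for n
      using powr_step_bounds(2)[of "real (Suc n)" \<delta>] assms by (simp add: add_ac)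
  qed
  moreover have "\<delta> * (Z - 1) \<le> 1"
  proof (rule sums_le[OF _ sums_mult tel])
    show "\<delta> * real (Suc (Suc n)) powr (-1 - \<delta>) \<le> real (Suc n) powr (-\<delta>) - real (Suc (Suc n)) powr (-\<delta>)" for n
      using powr_step_bounds(1)[of "real (Suc n)" \<delta>] assms by (simp add: add_ac)
    show "(\<lambda>n. real (Suc (Suc n)) powr (-1 - \<delta>)) sums (Z - 1)"
      using sZ by (subst sums_Suc_iff) simp
  qed
  ultimately show ?thesis using that[OF Z] assms by (simp add: field_simps)
qed

text \<open>The bound for \<open>- \<zeta>'/\<zeta>\<close> at \<open>1 + \<delta>\<close> comes from a difference quotient of \<open>\<zeta>\<close> with step \<open>\<delta> / 8\<close>. It is
  not sharp, but any constant below \<open>4 / 3\<close> in place of \<open>8 / 7\<close> suffices later on.\<close>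
lemma mangoldt_sum_upper_bound:
  assumes \<delta>: "\<delta> > 0"
  obtains D where "((\<lambda>n. mangoldt n * real n powr (-1 - \<delta>)) has_sum D) {1..}" "D \<le> 8 + 8 / 7 / \<delta>"
proof -
  obtain Z where Z: "((\<lambda>n. real n powr (-1 - \<delta>)) has_sum Z) {1..}" "1 / \<delta> \<le> Z" "Z \<le> 1 + 1 / \<delta>"
    using zeta_bounds[OF \<delta>] by blast
  define h where "h = \<delta> / 8"
  have h: "h > 0" "\<delta> - h > 0" using \<delta> by (auto simp: h_def)
  obtain Z' where Z': "((\<lambda>n. real n powr (-1 - (\<delta> - h))) has_sum Z') {1..}" "Z' \<le> 1 + 1 / (\<delta> - h)"
    using zeta_bounds[OF h(2)] by blast
  have "((\<lambda>n. 1 * complex_of_real (real n powr (-(1 + \<delta>)))) has_sum of_real Z) {1..}"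
    using has_sum_of_real[OF Z(1), where 'a = complex] by simp
  then obtain D where D: "((\<lambda>n. 1 * complex_of_real (mangoldt n * real n powr (-(1 + \<delta>)))) has_sum D) {1..}"
    "((\<lambda>n. 1 * complex_of_real (ln (real n) * real n powr (-(1 + \<delta>)))) has_sum D * of_real Z) {1..}"
    using mangoldt_convolution[of "\<lambda>_. 1" "1 + \<delta>"] \<delta> by auto
  have D1: "((\<lambda>n. mangoldt n * real n powr (-1 - \<delta>)) has_sum Re D) {1..}"
    using has_sum_Re[OF D(1)] by (simp add: of_real_mult [symmetric] del: of_real_mult of_real_mangoldt)
  have D2: "((\<lambda>n. ln (real n) * real n powr (-1 - \<delta>)) has_sum Re D * Z) {1..}"
    using has_sum_Re[OF D(2)] by (simp add: of_real_mult [symmetric] del: of_real_mult)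
  have "((\<lambda>n. (1 / h) * (real n powr (-1 - (\<delta> - h)) + (-1) * real n powr (-1 - \<delta>))) has_sum (1 / h) * (Z' + (-1) * Z)) {1..}"
    by (intro has_sum_cmult_right has_sum_add Z Z')
  with D2 have "Re D * Z \<le> (1 / h) * (Z' + (-1) * Z)"
  proof (rule has_sum_mono)
    fix n :: nat assume n: "n \<in> {1..}"
    have "real n powr h = exp (h * ln (real n))" using n by (simp add: powr_def)
    hence "h * ln (real n) \<le> real n powr h - 1"
      using exp_ge_add_one_self[of "h * ln (real n)"] by linarith
    hence "(h * ln (real n)) * real n powr (-1 - \<delta>) \<le> (real n powr h - 1) * real n powr (-1 - \<delta>)"
      by (intro mult_right_mono) auto
    also have "\<dots> = real n powr (-1 - (\<delta> - h)) - real n powr (-1 - \<delta>)"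
      by (simp add: left_diff_distrib flip: powr_add) (simp add: algebra_simps)
    finally show "ln (real n) * real n powr (-1 - \<delta>) \<le> (1 / h) * (real n powr (-1 - (\<delta> - h)) + (-1) * real n powr (-1 - \<delta>))"
      using h by (simp add: field_simps)
  qed
  also have "\<dots> \<le> (1 / h) * (1 + 1 / (\<delta> - h) - 1 / \<delta>)"
    using Z' Z h by (intro mult_left_mono) auto
  also have "\<dots> = (8 + 8 / 7 / \<delta>) * (1 / \<delta>)"
    using \<delta> by (simp add: h_def field_simps)
  also have "\<dots> \<le> (8 + 8 / 7 / \<delta>) * Z" using Z \<delta> by (intro mult_left_mono) auto
  finally have "Re D \<le> 8 + 8 / 7 / \<delta>"
  proof (rule mult_right_le_imp_le)
    have "0 < 1 / \<delta>" using \<delta> by simp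
    thus "0 < Z" using Z by linarith
  qed
  thus ?thesis using that D1 by blast
qed

context even_char
begin

lemma dirichlet_has_sum:
  assumes "\<sigma> > 1"
  shows "((\<lambda>n. \<psi> (int n) * of_real (real n powr (-\<sigma>))) has_sum L (of_real \<sigma>)) {1..}"
proof -
  have p: "of_nat n powr (- of_real \<sigma>) = complex_of_real (real n powr (-\<sigma>))" for n
    using powr_of_real[of "real n" "-\<sigma>"] by simp
  have s: "summable (\<lambda>n. norm (\<psi> (int (Suc n)) * of_real (real (Suc n) powr (-\<sigma>))))"
    using summable_dirichlet_series[of "of_real \<sigma>"] assms by (simp only: p Re_complex_of_real)
  have unique: "(\<lambda>n. \<psi> (int (Suc n)) * of_real (real (Suc n) powr (-\<sigma>))) sums T \<Longrightarrow> T = L (of_real \<sigma>)" for T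
  proof -
    assume "(\<lambda>n. \<psi> (int (Suc n)) * of_real (real (Suc n) powr (-\<sigma>))) sums T"
    hence "block (\<lambda>n. of_real (real n powr (-\<sigma>))) sums T" by (rule sums_block)
    moreover have "block (\<lambda>n. of_real (real n powr (-\<sigma>))) sums L (of_real \<sigma>)"
      using L_sums[of "of_real \<sigma>"] assms by (simp only: p Re_complex_of_real)
    ultimately show "T = L (of_real \<sigma>)" by (rule sums_unique2)
  qed
  note S = summable_sums[OF summable_norm_cancel[OF s]]
  have "(\<lambda>n. \<psi> (int (Suc n)) * of_real (real (Suc n) powr (-\<sigma>))) sums L (of_real \<sigma>)"
    using S unfolding unique[OF S] .
  from has_sum_from_1(1)[where f = "\<lambda>n. \<psi> (int n) * of_real (real n powr (-\<sigma>))", OF s this] show ?thesis .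
qed

lemma mangoldt_has_sum_log_deriv:
  assumes \<sigma>: "\<sigma> > 1"
  obtains D where "((\<lambda>n. \<psi> (int n) * of_real (mangoldt n * real n powr (-\<sigma>))) has_sum D) {1..}"
    "deriv L (of_real \<sigma>) = - D * L (of_real \<sigma>)"
proof -
  have p: "of_nat n powr (- of_real \<sigma>) = complex_of_real (real n powr (-\<sigma>))" for n
    using powr_of_real[of "real n" "-\<sigma>"] by simp
  obtain D where D: "((\<lambda>n. \<psi> (int n) * of_real (mangoldt n * real n powr (-\<sigma>))) has_sum D) {1..}"
    "((\<lambda>n. \<psi> (int n) * of_real (ln (real n) * real n powr (-\<sigma>))) has_sum D * L (of_real \<sigma>)) {1..}"
    by (rule mangoldt_convolution[of "\<lambda>n. \<psi> (int n)", OF _ norm_le_1 \<sigma> dirichlet_has_sum[OF \<sigma>]])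
       (auto simp: mult)
  have "(\<lambda>n. \<psi> (int (Suc n)) * of_real (ln (real (Suc n)) * real (Suc n) powr (-\<sigma>))) sums (D * L (of_real \<sigma>))"
    by (rule sums_from_1[OF D(2)])
  hence "block (\<lambda>n. of_real (ln (real n) * real n powr (-\<sigma>))) sums (D * L (of_real \<sigma>))"
    by (rule sums_block)
  hence "(\<lambda>m. - block (\<lambda>n. of_real (ln (real n) * real n powr (-\<sigma>))) m) sums (- (D * L (of_real \<sigma>)))"
    by (rule sums_minus)
  moreover have "(\<lambda>m. - block (\<lambda>n. of_real (ln (real n) * real n powr (-\<sigma>))) m) sums deriv L (of_real \<sigma>)"
  proof -
    have "(\<lambda>m. block (\<lambda>n. (- of_real (ln (real n))) ^ 1 * of_nat n powr (- of_real \<sigma>)) m) sums (deriv ^^ 1) L (of_real \<sigma>)"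
      using \<sigma> by (intro L_higher_deriv_sums) auto
    thus ?thesis
      by (simp only: p) (simp add: char_block_def [abs_def] sum_negf mult_ac)
  qed
  ultimately have "deriv L (of_real \<sigma>) = - (D * L (of_real \<sigma>))" using sums_unique2 by blast
  thus ?thesis using that D(1) by simp
qed

text \<open>The series at \<open>3\<close> is dominated by its first term; so \<open>L\<close> has only isolated zeros.\<close>
lemma L_3_nonzero: "L 3 \<noteq> 0"
proof
  assume L3: "L 3 = 0"
  obtain Z where Z: "((\<lambda>n. real n powr (-1 - 2)) has_sum Z) {1..}" "Z \<le> 1 + 1 / 2"
    using zeta_bounds[of 2] by auto
  have "((\<lambda>n. \<psi> (int n) * of_real (real n powr (-3))) has_sum 0) {1..}"
    using dirichlet_has_sum[of 3] L3 by simp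
  from has_sum_Re[OF this] have R: "((\<lambda>n. Re (\<psi> (int n)) * real n powr (-3)) has_sum 0) {1..}" by simp
  have "((\<lambda>n. Re (\<psi> (int n)) * real n powr (-3) + real n powr (-3)) has_sum 0 + Z) {1..}"
    using has_sum_add[OF R Z(1)] by simp
  note lower = finite_sum_le_has_sum[OF this, of "{1}"]
  have "Re (\<psi> 1) + 1 \<le> Z"
  proof -
    have "Re (\<psi> (int n)) * real n powr (-3) + real n powr (-3) \<ge> 0" for n
    proof -
      have "\<bar>Re (\<psi> (int n))\<bar> \<le> 1" using abs_Re_le_cmod[of "\<psi> (int n)"] norm_le_1[of "int n"] by linarith
      hence "0 \<le> (Re (\<psi> (int n)) + 1) * real n powr (-3)" by (intro mult_nonneg_nonneg) auto
      thus ?thesis by (simp add: distrib_right)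
    qed
    thus ?thesis using lower by simp
  qed
  thus False using Z by (simp add: at_1)
qed

text \<open>To the right of \<open>1\<close>, the logarithmic derivative grows like \<open>m / (s - 1)\<close>, where \<open>m\<close> is the order of the
  zero at \<open>1\<close>.\<close>
lemma log_deriv_lower_bound:
  obtains m :: nat and C e :: real where "e > 0" "L 1 = 0 \<Longrightarrow> m > 0"
    "\<And>\<delta>. 0 < \<delta> \<Longrightarrow> \<delta> < e \<Longrightarrow> L (of_real (1 + \<delta>)) \<noteq> 0 \<and>
        Re (deriv L (of_real (1 + \<delta>)) / L (of_real (1 + \<delta>))) \<ge> real m / \<delta> - C"
proof -
  have "\<exists>g r (m::nat). 0 < r \<and> g holomorphic_on ball 1 r \<and> (L 1 = 0 \<longrightarrow> m > 0) \<and>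
     (\<forall>w\<in>ball 1 r. L w = (w - 1) ^ m * g w \<and> g w \<noteq> 0)"
  proof (cases "L 1 = 0")
    case False
    have "isCont L 1"
      using L_holomorphic by (intro continuous_on_interior[OF holomorphic_on_imp_continuous_on])
        (auto simp: interior_open open_halfspace_Re_gt)
    then obtain r where r: "r > 0" "\<And>w. dist 1 w < r \<Longrightarrow> L w \<noteq> 0"
      using continuous_at_avoid[of 1 L 0] False by blast
    let ?r = "min r 1"
    have "L holomorphic_on ball 1 ?r"
    proof (rule holomorphic_on_subset[OF L_holomorphic], safe)
      fix w :: complex assume "w \<in> ball 1 ?r"
      hence "norm (1 - w) < 1" by (simp add: dist_norm)
      hence "\<bar>Re (1 - w)\<bar> < 1" using abs_Re_le_cmod[of "1 - w"] by linarith
      thus "-1 < Re w" by simp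
    qed
    thus ?thesis using r False by (intro exI[of _ L] exI[of _ ?r] exI[of _ 0]) auto
  next
    case True
    let ?S = "{s. Re s > -1}"
    have nonconst: "\<not> L constant_on ?S"
    proof
      assume "L constant_on ?S"
      then obtain c where "\<And>s. s \<in> ?S \<Longrightarrow> L s = c" by (auto simp: constant_on_def)
      hence "L 1 = c" "L 3 = c" by auto
      thus False using True L_3_nonzero by simp
    qed
    have "connected ?S" by (intro convex_connected convex_halfspace_Re_gt)
    moreover have "1 \<in> ?S" by simp
    ultimately show ?thesis
      by (rule holomorphic_factor_zero_nonconstant[OF L_holomorphic open_halfspace_Re_gt _ _ True nonconst]) blast
  qed
  then obtain g r m where r: "0 < r" and g: "g holomorphic_on ball 1 r" and m: "L 1 = 0 \<Longrightarrow> (m::nat) > 0"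
    and L: "\<And>w. w \<in> ball 1 r \<Longrightarrow> L w = (w - 1) ^ m * g w" and g0: "\<And>w. w \<in> ball 1 r \<Longrightarrow> g w \<noteq> 0"
    by blast
  let ?h = "\<lambda>w. deriv g w / g w"
  have sub: "cball (1::complex) (r / 2) \<subseteq> ball 1 r" using r by (auto simp: dist_norm)
  have "continuous_on (cball 1 (r / 2)) ?h"
    using g g0 sub
    by (intro continuous_on_subset[OF holomorphic_on_imp_continuous_on[OF holomorphic_on_divide[of _ "ball 1 r"]]]
        holomorphic_deriv) auto
  hence "compact (?h ` cball 1 (r / 2))" by (intro compact_continuous_image) auto
  hence "bounded (?h ` cball 1 (r / 2))" by (rule compact_imp_bounded)
  then obtain C where "\<forall>y\<in>?h ` cball 1 (r / 2). norm y \<le> C"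
    unfolding bounded_iff by (rule exE)
  hence C: "norm (?h w) \<le> C" if "w \<in> cball 1 (r / 2)" for w using that by (rule bspec[OF _ imageI])
  have main: "L (of_real (1 + \<delta>)) \<noteq> 0 \<and> Re (deriv L (of_real (1 + \<delta>)) / L (of_real (1 + \<delta>))) \<ge> real m / \<delta> - C"
    if \<delta>: "0 < \<delta>" "\<delta> < r / 2" for \<delta>
  proof -
    define w :: complex where "w = of_real (1 + \<delta>)"
    have w: "w \<in> cball 1 (r / 2)" "w - 1 = of_real \<delta>" using \<delta> by (auto simp: w_def dist_norm)
    hence wb: "w \<in> ball 1 r" using sub by blast
    have w1: "w - 1 \<noteq> 0" using \<delta> w by simp
    have "((\<lambda>w. (w - 1) ^ m * g w) has_field_derivative
       (of_nat m * (w - 1) ^ (m - 1)) * g w + deriv g w * (w - 1) ^ m) (at w)"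
      by (intro DERIV_mult holomorphic_derivI[OF g open_ball wb])
         (auto intro!: derivative_eq_intros)
    hence "(L has_field_derivative (of_nat m * (w - 1) ^ (m - 1)) * g w + deriv g w * (w - 1) ^ m) (at w)"
      by (rule has_field_derivative_transform_within_open[OF _ open_ball wb]) (simp add: L)
    hence "deriv L w = (of_nat m * (w - 1) ^ (m - 1)) * g w + deriv g w * (w - 1) ^ m"
      by (rule DERIV_imp_deriv)
    moreover have "((of_nat m * u ^ (m - 1)) * x + y * u ^ m) / (u ^ m * x) = of_nat m / u + y / x"
      if "u \<noteq> 0" "x \<noteq> 0" for u x y :: complex
      using that by (cases m) (auto simp: field_simps)
    ultimately have "deriv L w / L w = of_nat m / (w - 1) + ?h w"
      using w1 g0[OF wb] by (simp only: L[OF wb])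
    hence "Re (deriv L w / L w) = real m / \<delta> + Re (?h w)"
    proof -
      have "of_nat m / (w - 1) = complex_of_real (real m / \<delta>)" by (simp add: w(2))
      with \<open>deriv L w / L w = _\<close> show ?thesis by simp
    qed
    moreover have "\<bar>Re (?h w)\<bar> \<le> C" using abs_Re_le_cmod[of "?h w"] C[OF w(1)] by linarith
    moreover have "L w \<noteq> 0" unfolding L[OF wb] using w1 g0[OF wb] by simp
    ultimately show ?thesis unfolding w_def by linarith
  qed
  show ?thesis by (rule that[of "r / 2" m C]) (use r m main in auto)
qed

lemma square_even_char:
  assumes "\<exists>n. (\<psi> n)\<^sup>2 \<noteq> (if coprime n (int q) then 1 else 0)"
  shows "even_char q (\<lambda>n. (\<psi> n)\<^sup>2)"
proof -
  have "(\<lambda>n. (\<psi> n)\<^sup>2) \<noteq> principal_character q"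
    using assms by (auto simp: fun_eq_iff principal_character_def)
  moreover have "dirichlet_character q (\<lambda>n. (\<psi> n)\<^sup>2)"
    using dchar by (auto simp: dirichlet_character_def power_mult_distrib)
  moreover have "\<psi> (-1) = 1" using even[of 1] at_1 by simp
  ultimately show ?thesis using prime_q odd_q by (simp add: even_char_def even_nontrivial_characters_def)
qed

text \<open>The classical inequality \<open>3 + 4 cos \<theta> + cos (2 \<theta>) \<ge> 0\<close>.\<close>
lemma three_four_one: "3 + 4 * Re (\<psi> n) + Re ((\<psi> n)\<^sup>2) \<ge> 0"
proof (cases "\<psi> n = 0")
  case False
  hence "norm (\<psi> n) = 1" using norm_eq_1 nonzero_iff by blast
  hence "(Re (\<psi> n))\<^sup>2 + (Im (\<psi> n))\<^sup>2 = 1" by (simp add: cmod_def)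
  hence "Re ((\<psi> n)\<^sup>2) = 2 * (Re (\<psi> n))\<^sup>2 - 1" by (simp add: Re_power2)
  moreover have "2 * (1 + Re (\<psi> n))\<^sup>2 \<ge> 0" by simp
  ultimately show ?thesis by (simp add: power2_sum)
qed simp

text \<open>A zero at \<open>1\<close> would give the 3-4-1 sum an upper bound \<open>(24/7 - 4) / \<delta> + O(1)\<close>, which is negative for
  small \<open>\<delta>\<close>.\<close>
lemma L_1_complex_nonzero:
  assumes sq: "\<exists>n. (\<psi> n)\<^sup>2 \<noteq> (if coprime n (int q) then 1 else 0)"
  shows "L 1 \<noteq> 0"
proof
  assume L1: "L 1 = 0"
  interpret S: even_char q "\<lambda>n. (\<psi> n)\<^sup>2" by (rule square_even_char[OF sq])
  obtain m C e where 1: "e > 0" "m > (0::nat)"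
    "\<And>\<delta>. 0 < \<delta> \<Longrightarrow> \<delta> < e \<Longrightarrow> L (of_real (1 + \<delta>)) \<noteq> 0 \<and>
        Re (deriv L (of_real (1 + \<delta>)) / L (of_real (1 + \<delta>))) \<ge> real m / \<delta> - C"
    using log_deriv_lower_bound L1 by metis
  obtain m' C' e' where 2: "e' > 0"
    "\<And>\<delta>. 0 < \<delta> \<Longrightarrow> \<delta> < e' \<Longrightarrow> S.L (of_real (1 + \<delta>)) \<noteq> 0 \<and>
        Re (deriv S.L (of_real (1 + \<delta>)) / S.L (of_real (1 + \<delta>))) \<ge> real m' / \<delta> - C'"
    using S.log_deriv_lower_bound by metis
  have key: "4 / 7 / \<delta> \<le> 24 + 4 * C + C'" if \<delta>: "0 < \<delta>" "\<delta> < e" "\<delta> < e'" for \<delta>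
  proof -
    let ?w = "\<lambda>n. mangoldt n * real n powr (-1 - \<delta>)"
    have \<sigma>: "1 + \<delta> > 1" and eq: "-(1 + \<delta>) = -1 - \<delta>" using \<delta> by auto
    obtain D0 where D0: "(?w has_sum D0) {1..}" "D0 \<le> 8 + 8 / 7 / \<delta>"
      using mangoldt_sum_upper_bound[OF \<delta>(1)] by blast
    obtain D1 where D1: "((\<lambda>n. \<psi> (int n) * of_real (?w n)) has_sum D1) {1..}"
      "deriv L (of_real (1 + \<delta>)) = - D1 * L (of_real (1 + \<delta>))"
      using mangoldt_has_sum_log_deriv[OF \<sigma>] unfolding eq by blast
    obtain D2 where D2: "((\<lambda>n. (\<psi> (int n))\<^sup>2 * of_real (?w n)) has_sum D2) {1..}"
      "deriv S.L (of_real (1 + \<delta>)) = - D2 * S.L (of_real (1 + \<delta>))"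
      using S.mangoldt_has_sum_log_deriv[OF \<sigma>] unfolding eq by blast
    have R: "Re (z * of_real y) = Re z * y" for z y by simp
    have "((\<lambda>n. 3 * ?w n + 4 * Re (\<psi> (int n) * of_real (?w n)) + Re ((\<psi> (int n))\<^sup>2 * of_real (?w n))) has_sum 3 * D0 + 4 * Re D1 + Re D2) {1..}"
      by (intro has_sum_add has_sum_cmult_right has_sum_Re D0 D1 D2)
    hence "3 * D0 + 4 * Re D1 + Re D2 \<ge> 0"
    proof (rule has_sum_nonneg)
      fix n :: nat
      have "0 \<le> (3 + 4 * Re (\<psi> (int n)) + Re ((\<psi> (int n))\<^sup>2)) * ?w n"
        using three_four_one[of "int n"] by (intro mult_nonneg_nonneg) (auto simp: mangoldt_nonneg)
      thus "0 \<le> 3 * ?w n + 4 * Re (\<psi> (int n) * of_real (?w n)) + Re ((\<psi> (int n))\<^sup>2 * of_real (?w n))"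
        unfolding R by (simp only: distrib_right mult.assoc)
    qed
    moreover have "Re D1 \<le> C - real m / \<delta>"
    proof -
      have "deriv L (of_real (1 + \<delta>)) / L (of_real (1 + \<delta>)) = - D1"
        using 1(3)[OF \<delta>(1,2)] unfolding D1(2) by (intro nonzero_mult_div_cancel_right) blast
      thus ?thesis using 1(3)[of \<delta>] \<delta> by simp
    qed
    moreover have "1 / \<delta> \<le> real m / \<delta>" using 1(2) \<delta> by (intro divide_right_mono) auto
    moreover have "Re D2 \<le> C'"
    proof -
      have "deriv S.L (of_real (1 + \<delta>)) / S.L (of_real (1 + \<delta>)) = - D2"
        using 2(2)[OF \<delta>(1,3)] unfolding D2(2) by (intro nonzero_mult_div_cancel_right) blast
      hence "Re D2 \<le> C' - real m' / \<delta>" using 2(2)[of \<delta>] \<delta> by simp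
      moreover have "real m' / \<delta> \<ge> 0" using \<delta> by simp
      ultimately show ?thesis by linarith
    qed
    ultimately have "0 \<le> 24 + 3 * (8 / 7 / \<delta>) - 4 * (1 / \<delta>) + 4 * C + C'" using D0(2) by linarith
    thus ?thesis by simp
  qed
  define M where "M = \<bar>24 + 4 * C + C'\<bar> + 1"
  have M: "M > 0" "M > 24 + 4 * C + C'" by (auto simp: M_def)
  define \<delta> where "\<delta> = Min {e / 2, e' / 2, 4 / 7 / M}"
  have \<delta>: "\<delta> > 0" "\<delta> \<le> e / 2" "\<delta> \<le> e' / 2" "\<delta> \<le> 4 / 7 / M"
    using 1(1) 2(1) M by (auto simp: \<delta>_def)
  hence "M \<le> 4 / 7 / \<delta>" using M by (simp add: field_simps)
  also have "\<dots> \<le> 24 + 4 * C + C'" using \<delta> 1(1) 2(1) by (intro key) auto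
  finally show False using M by simp
qed

lemma L_1_nonzero: "L 1 \<noteq> 0"
  using L_1_real_nonzero L_1_complex_nonzero by blast

end

section \<open>The Euler-Kronecker constant\<close>

theorem mainTheorem1:
  fixes q :: nat
  assumes "prime q" and "odd q"
  shows "euler_kronecker_plus q =
    (of_nat q - 1) / 2 * euler_mascheroni
    + (of_nat q - 3) / 2 * of_real (ln (2 * pi))
    - 1 / 2 * (\<Sum>\<psi>\<in>even_nontrivial_characters q.
        (\<Sum>a=1..q-1. cnj (\<psi> (int a)) * of_real (S_fun (real a / real q))) /
        (\<Sum>a=1..q-1. cnj (\<psi> (int a)) * of_real (ln (Gamma (real a / real q)))))"
proof -
  have "q \<noteq> 2" using assms by auto
  hence q3: "q \<ge> 3" using prime_ge_2_nat[OF assms(1)] by simp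
  have ivl: "{1..q-1} = {1..<q}" using q3 by auto
  let ?E = "even_nontrivial_characters q"
  let ?R = "\<lambda>\<psi>::int \<Rightarrow> complex. (\<Sum>a=1..q-1. cnj (\<psi> (int a)) * of_real (S_fun (real a / real q))) /
        (\<Sum>a=1..q-1. cnj (\<psi> (int a)) * of_real (ln (Gamma (real a / real q))))"
  have "(\<Sum>\<psi>\<in>?E. deriv (dirichlet_L q \<psi>) 1 / dirichlet_L q \<psi> 1) =
    (\<Sum>\<psi>\<in>?E. of_real (euler_mascheroni + ln (2 * pi)) - 1 / 2 * ?R \<psi>)"
  proof (intro sum.cong refl)
    fix \<psi> assume "\<psi> \<in> ?E"
    then interpret even_char q \<psi> using assms by (simp add: even_char_def)
    show "deriv (dirichlet_L q \<psi>) 1 / dirichlet_L q \<psi> 1 = of_real (euler_mascheroni + ln (2 * pi)) - 1 / 2 * ?R \<psi>"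
      unfolding ivl deriv_dirichlet_L_1 using dirichlet_L_eq[of 1] log_deriv_L_1[OF L_1_nonzero] by simp
  qed
  also have "\<dots> = of_nat ((q - 3) div 2) * of_real (euler_mascheroni + ln (2 * pi)) - 1 / 2 * (\<Sum>\<psi>\<in>?E. ?R \<psi>)"
    by (simp only: sum_subtractf sum_distrib_left sum_constant finite_card_even_nontrivial_characters[OF assms])
  also have "of_nat ((q - 3) div 2) = ((of_nat q - 3) / 2 :: complex)"
  proof -
    have "q = 2 * ((q - 3) div 2) + 3" using q3 assms(2) by presburger
    hence "(of_nat q :: complex) = of_nat (2 * ((q - 3) div 2) + 3)" by (rule arg_cong)
    also have "\<dots> = 2 * of_nat ((q - 3) div 2) + 3" by simp
    finally show ?thesis by simp
  qed
  finally have "euler_kronecker_plus q = euler_mascheroni + ((of_nat q - 3) / 2 * of_real (euler_mascheroni + ln (2 * pi)) - 1 / 2 * (\<Sum>\<psi>\<in>?E. ?R \<psi>))"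
    by (simp only: euler_kronecker_plus_def)
  moreover have "g + ((Q - 3) / 2 * (g + l) - y) = (Q - 1) / 2 * g + (Q - 3) / 2 * l - y" for Q g l y :: complex
    by (simp add: field_simps)
  ultimately show ?thesis by (simp only: of_real_add of_real_euler_mascheroni)
qed

end
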